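(* Let $\mathcal M$ be a smooth connected Riemannian manifold with injectivity radius uniformly bounded from below by some $I>0$. Let $C(w)=\int_{\mathcal Z}Q(z,w)\,dP(z)$ be a three times continuously differentiable cost function on $\mathcal M$, and for $z\in\mathcal Z$, $w\in\mathcal M$ let $H(z,w)\in T_w\mathcal M$ satisfy $\int_{\mathcal Z} H(z,w)\,dP(z)=\nabla C(w)$ for all $w\in\mathcal M$. Let $(z_t)_{t\ge 0}$ be independent random variables with law $P$, and consider the algorithm $$w_{t+1}=\exp_{w_t}\bigl(-\gamma_t H(z_t,w_t)\bigr),\qquad t\ge 0,$$ started from some $w_0\in\mathcal M$, where the positive step sizes $(\gamma_t)_{t\ge0}$ satisfy $\sum_t\gamma_t^2<\infty$ and $\sum_t\gamma_t=+\infty$. Suppose there exists a compact set $K\subset\mathcal M$ such that $w_t\in K$ for all $t\ge 0$, and that there exists $A>0$ such that $\|H(z,w)\|\le A$ for all $w\in K$ and all $z\in\mathcal Z$. Then $C(w_t)$ converges almost surely and $\nabla C(w_t)\to 0$ almost surely.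
   Context: $(\mathcal Z,P)$ is a probability space (a measurable space with a probability measure $P$), $Q:\mathcal Z\times\mathcal M\to\mathbb R$ is the loss function, and $H:(z,w)\mapsto H(z,w)\in T_w\mathcal M$ is a measurable "stochastic gradient". $\nabla C(w)\in T_w\mathcal M$ is the Riemannian gradient of $C$, $\exp_w$ is the Riemannian exponential map at $w$, and $\|\cdot\|$ is the Riemannian norm on tangent spaces. *)

theory Defs
  imports "HOL-Probability.Probability"
begin

fun Ck_on :: "nat \<Rightarrow> 'a::euclidean_space set \<Rightarrow> ('a \<Rightarrow> 'b::real_normed_vector) \<Rightarrow> bool" where
  "Ck_on 0 S f \<longleftrightarrow> continuous_on S f"
| "Ck_on (Suc k) S f \<longleftrightarrow>
     (\<forall>x\<in>S. f differentiable (at x)) \<and> (\<forall>v. Ck_on k S (\<lambda>x. frechet_derivative f (at x) v))"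

definition smooth_on :: "'a::euclidean_space set \<Rightarrow> ('a \<Rightarrow> 'b::real_normed_vector) \<Rightarrow> bool" where
  "smooth_on S f \<longleftrightarrow> (\<forall>k. Ck_on k S f)"

text \<open>
  The underlying space of the manifold is a whole type \<open>'m\<close>, Hausdorff and second countable through
  its type classes. A chart is a pair of its (open) domain and the coordinate map; the values of the
  coordinate map outside the domain are irrelevant. The atlas need not be maximal.
\<close>

type_synonym ('m, 'e) chart = "'m set \<times> ('m \<Rightarrow> 'e)"

abbreviation chart_dom :: "('m, 'e) chart \<Rightarrow> 'm set" where
  "chart_dom \<equiv> fst"

abbreviation chart_map :: "('m, 'e) chart \<Rightarrow> 'm \<Rightarrow> 'e" where
  "chart_map \<equiv> snd"

definition chart_inv :: "('m, 'e) chart \<Rightarrow> 'e \<Rightarrow> 'm" where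
  "chart_inv c = inv_into (chart_dom c) (chart_map c)"

definition smooth_atlas ::
    "('m::{t2_space,second_countable_topology}, 'e::euclidean_space) chart set \<Rightarrow> bool" where
  "smooth_atlas A \<longleftrightarrow>
     (\<Union>c\<in>A. chart_dom c) = UNIV \<and>
     (\<forall>c\<in>A. open (chart_dom c) \<and> open (chart_map c ` chart_dom c) \<and>
        homeomorphism (chart_dom c) (chart_map c ` chart_dom c) (chart_map c) (chart_inv c)) \<and>
     (\<forall>c\<in>A. \<forall>d\<in>A. smooth_on (chart_map c ` (chart_dom c \<inter> chart_dom d)) (chart_map d \<circ> chart_inv c))"

definition Ck_function :: "('m, 'e::euclidean_space) chart set \<Rightarrow> nat \<Rightarrow> ('m \<Rightarrow> real) \<Rightarrow> bool" where
  "Ck_function A k f \<longleftrightarrow> (\<forall>c\<in>A. Ck_on k (chart_map c ` chart_dom c) (f \<circ> chart_inv c))"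

text \<open>
  A tangent vector at \<open>p\<close> is the family of its coordinate representations in all charts around \<open>p\<close>;
  these are related by the derivatives of the transition maps. For the charts that do not
  contain \<open>p\<close> the family is 0, so that tangent vectors are determined by their representation in
  any one chart around \<open>p\<close>. The vector space operations of the tangent space are the pointwise ones.
\<close>

type_synonym ('m, 'e) tvec = "('m, 'e) chart \<Rightarrow> 'e"

definition tangent_space ::
    "('m, 'e::euclidean_space) chart set \<Rightarrow> 'm \<Rightarrow> ('m, 'e) tvec set" where
  "tangent_space A p =
     {v. (\<forall>c. c \<notin> A \<or> p \<notin> chart_dom c \<longrightarrow> v c = 0) \<and>
         (\<forall>c\<in>A. \<forall>d\<in>A. p \<in> chart_dom c \<inter> chart_dom d \<longrightarrow>
            v d = frechet_derivative (chart_map d \<circ> chart_inv c) (at (chart_map c p)) (v c))}"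

definition tv_add :: "('m, 'e::euclidean_space) tvec \<Rightarrow> ('m, 'e) tvec \<Rightarrow> ('m, 'e) tvec" where
  "tv_add u v = (\<lambda>c. u c + v c)"

definition tv_scale :: "real \<Rightarrow> ('m, 'e::euclidean_space) tvec \<Rightarrow> ('m, 'e) tvec" where
  "tv_scale a v = (\<lambda>c. a *\<^sub>R v c)"

text \<open>The tangent vector at \<open>p\<close> whose representation in the chart \<open>c\<close> is \<open>x\<close>:\<close>

definition coord_vec ::
    "('m, 'e::euclidean_space) chart set \<Rightarrow> ('m, 'e) chart \<Rightarrow> 'm \<Rightarrow> 'e \<Rightarrow> ('m, 'e) tvec" where
  "coord_vec A c p x =
     (\<lambda>d. if d \<in> A \<and> p \<in> chart_dom d
          then frechet_derivative (chart_map d \<circ> chart_inv c) (at (chart_map c p)) x else 0)"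

type_synonym ('m, 'e) metric = "'m \<Rightarrow> ('m, 'e) tvec \<Rightarrow> ('m, 'e) tvec \<Rightarrow> real"

definition local_metric ::
    "('m, 'e::euclidean_space) chart set \<Rightarrow> ('m, 'e) metric \<Rightarrow> ('m, 'e) chart \<Rightarrow> 'e \<Rightarrow> 'e \<Rightarrow> 'e \<Rightarrow> real" where
  "local_metric A g c q x y =
     g (chart_inv c q) (coord_vec A c (chart_inv c q) x) (coord_vec A c (chart_inv c q) y)"

definition riemannian_metric ::
    "('m, 'e::euclidean_space) chart set \<Rightarrow> ('m, 'e) metric \<Rightarrow> bool" where
  "riemannian_metric A g \<longleftrightarrow>
     (\<forall>p. \<forall>u\<in>tangent_space A p. \<forall>v\<in>tangent_space A p. \<forall>w\<in>tangent_space A p. \<forall>a.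
        g p u v = g p v u \<and>
        g p (tv_add u v) w = g p u w + g p v w \<and>
        g p (tv_scale a u) v = a * g p u v) \<and>
     (\<forall>p. \<forall>u\<in>tangent_space A p. u \<noteq> (\<lambda>c. 0) \<longrightarrow> g p u u > 0) \<and>
     (\<forall>c\<in>A. \<forall>x y. smooth_on (chart_map c ` chart_dom c) (\<lambda>q. local_metric A g c q x y))"

definition tv_norm :: "('m, 'e) metric \<Rightarrow> 'm \<Rightarrow> ('m, 'e) tvec \<Rightarrow> real" where
  "tv_norm g p v = sqrt (g p v v)"

definition gradient ::
    "('m, 'e::euclidean_space) chart set \<Rightarrow> ('m, 'e) metric \<Rightarrow> ('m \<Rightarrow> real) \<Rightarrow> 'm \<Rightarrow> ('m, 'e) tvec" where
  "gradient A g f p =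
     (THE u. u \<in> tangent_space A p \<and>
        (\<forall>v\<in>tangent_space A p. \<forall>c\<in>A. p \<in> chart_dom c \<longrightarrow>
           g p u v = frechet_derivative (f \<circ> chart_inv c) (at (chart_map c p)) (v c)))"

text \<open>
  The coordinate representation of the covariant derivative (Levi-Civita connection) of the constant
  coordinate field \<open>y\<close> in the direction \<open>x\<close>, i.e. the Christoffel symbols contracted with \<open>x\<close>
  and \<open>y\<close>; it is given by the Koszul formula for the commuting fields \<open>x\<close>, \<open>y\<close>, \<open>b\<close>.
\<close>

definition christoffel ::
    "('m, 'e::euclidean_space) chart set \<Rightarrow> ('m, 'e) metric \<Rightarrow> ('m, 'e) chart \<Rightarrow> 'e \<Rightarrow> 'e \<Rightarrow> 'e \<Rightarrow> 'e" where
  "christoffel A g c q x y =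
     (THE a. \<forall>b. local_metric A g c q a b =
        (frechet_derivative (\<lambda>r. local_metric A g c r y b) (at q) x
         + frechet_derivative (\<lambda>r. local_metric A g c r x b) (at q) y
         - frechet_derivative (\<lambda>r. local_metric A g c r x y) (at q) b) / 2)"

definition velocity ::
    "('m, 'e::euclidean_space) chart set \<Rightarrow> real set \<Rightarrow> (real \<Rightarrow> 'm) \<Rightarrow> real \<Rightarrow> ('m, 'e) tvec" where
  "velocity A J \<sigma> t =
     (\<lambda>c. if c \<in> A \<and> \<sigma> t \<in> chart_dom c
          then vector_derivative (chart_map c \<circ> \<sigma>) (at t within J) else 0)"

text \<open>
  Geodesics on an interval \<open>J\<close>: in every chart, \<open>x'' + \<Gamma>(x)(x', x') = 0\<close> (one-sided derivatives
  at end points of \<open>J\<close> that belong to \<open>J\<close>).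
\<close>

definition geodesic_on ::
    "('m::topological_space, 'e::euclidean_space) chart set \<Rightarrow> ('m, 'e) metric \<Rightarrow> real set \<Rightarrow> (real \<Rightarrow> 'm) \<Rightarrow> bool" where
  "geodesic_on A g J \<sigma> \<longleftrightarrow>
     continuous_on J \<sigma> \<and>
     (\<forall>t\<in>J. \<forall>c\<in>A. \<sigma> t \<in> chart_dom c \<longrightarrow>
        ((chart_map c \<circ> \<sigma>) has_vector_derivative velocity A J \<sigma> t c) (at t within J) \<and>
        ((\<lambda>s. velocity A J \<sigma> s c) has_vector_derivative
           - christoffel A g c (chart_map c (\<sigma> t)) (velocity A J \<sigma> t c) (velocity A J \<sigma> t c))
          (at t within J))"

definition exp_domain ::
    "('m::topological_space, 'e::euclidean_space) chart set \<Rightarrow> ('m, 'e) metric \<Rightarrow> 'm \<Rightarrow> ('m, 'e) tvec set" where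
  "exp_domain A g p =
     {v \<in> tangent_space A p.
        \<exists>\<sigma>. geodesic_on A g {0..1} \<sigma> \<and> \<sigma> 0 = p \<and> velocity A {0..1} \<sigma> 0 = v}"

definition exp_map ::
    "('m::topological_space, 'e::euclidean_space) chart set \<Rightarrow> ('m, 'e) metric \<Rightarrow> 'm \<Rightarrow> ('m, 'e) tvec \<Rightarrow> 'm" where
  "exp_map A g p v =
     (THE q. \<exists>\<sigma>. geodesic_on A g {0..1} \<sigma> \<and> \<sigma> 0 = p \<and> velocity A {0..1} \<sigma> 0 = v \<and> \<sigma> 1 = q)"

definition diffeo_onto_open_image ::
    "('m::topological_space, 'e::euclidean_space) chart set \<Rightarrow> 'e set \<Rightarrow> ('e \<Rightarrow> 'm) \<Rightarrow> bool" where
  "diffeo_onto_open_image A S f \<longleftrightarrow>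
     open S \<and> inj_on f S \<and> open (f ` S) \<and> continuous_on S f \<and>
     (\<forall>d\<in>A. smooth_on {x\<in>S. f x \<in> chart_dom d} (chart_map d \<circ> f) \<and>
            smooth_on (chart_map d ` (chart_dom d \<inter> f ` S)) (inv_into S f \<circ> chart_inv d))"

text \<open>
  The supremum of the radii \<open>r\<close> such that the exponential map at \<open>p\<close> is defined and a
  diffeomorphism onto its image on the open ball of radius \<open>r\<close> in the tangent space at \<open>p\<close>. The
  tangent space is identified with the model space through the linear isomorphism given by a chart
  around \<open>p\<close>; the choice of that chart does not matter.
\<close>

definition injectivity_radius ::
    "('m::topological_space, 'e::euclidean_space) chart set \<Rightarrow> ('m, 'e) metric \<Rightarrow> 'm \<Rightarrow> ereal" where
  "injectivity_radius A g p =
     Sup {ereal r | r. 0 < r \<and> {v \<in> tangent_space A p. tv_norm g p v < r} \<subseteq> exp_domain A g p \<and>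
        (\<forall>c\<in>A. p \<in> chart_dom c \<longrightarrow>
           diffeo_onto_open_image A {x. tv_norm g p (coord_vec A c p x) < r}
             (\<lambda>x. exp_map A g p (coord_vec A c p x)))}"

end

(* The descent inequality C (w (t+1)) <= C (w t) - gamma t * |grad C|^2 + noise + O(gamma t ^ 2) follows
   from a second-order Taylor expansion along the geodesic from w t to w (t+1). Geodesics have constant
   speed, so for small steps those starting in K stay inside finitely many chart balls, which makes the
   constants uniform. The noise is a martingale with square-summable increments and converges almost
   surely; hence C (w t) converges and the sum of gamma t * |grad C (w t)|^2 is finite. Since |grad C|^2
   changes by O(gamma t) in one step and the gamma t are not summable, it tends to 0.

   The martingale argument needs w t to be measurable with respect to the past, also for the first, possibly
   large, steps. The bound on the injectivity radius makes all geodesics extendible by a fixed length, so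
   that exp is everywhere defined; it is continuous by the Gronwall inequality for the geodesic equation. *)

theory Submission
  imports Defs
begin

section \<open>Analysis in coordinates\<close>

text \<open>A tangent vector is a family of coordinate vectors indexed by charts, so the tangent
  bundle carries neither a topology nor a sigma-algebra here. Convergence and measurability of
  tangent vectors are therefore expressed chart by chart, and the local analysis takes place in
  \<open>coord_metric\<close>, for a metric on an open subset of a Euclidean space. Existence of
  geodesics is read off from the definition of the injectivity radius, which requires exp to be
  defined on balls; Gronwall's inequality then supplies uniqueness and continuous dependence. The
  noise is \<open>\<gamma> t\<close> times the difference between the derivative of \<open>C\<close>
  in the sampled direction and its mean, the squared gradient norm; on \<open>K\<close> this
  difference is bounded, so square-summable steps give square-summable increments. Once the noise is
  known to be summable almost surely, what remains is a deterministic statement about real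
  sequences, \<open>descent_converges\<close>, applied path by path.\<close>

lemma Ck_on_Suc_has_derivative:
  assumes "Ck_on (Suc k) S f" "x \<in> S"
  shows "(f has_derivative frechet_derivative f (at x)) (at x)"
  using assms by (auto simp: frechet_derivative_works)

lemma Ck_on_continuous_on: "Ck_on k S f \<Longrightarrow> continuous_on S f"
proof (cases k)
  case (Suc n)
  assume "Ck_on k S f"
  then show ?thesis
    using Suc by (auto intro!: continuous_at_imp_continuous_on differentiable_imp_continuous_within)
qed simp

lemma Ck_on_Suc_imp: "Ck_on (Suc k) S f \<Longrightarrow> Ck_on k S f"
proof (induction k arbitrary: f)
  case 0
  then show ?case using Ck_on_continuous_on by (metis Ck_on.simps(1))
next
  case (Suc k)
  then show ?case by (meson Ck_on.simps(2))
qed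

lemma Ck_on_mono:
  assumes "Ck_on k S f" "n \<le> k"
  shows "Ck_on n S f"
  using assms(2,1) by (induction rule: inc_induct) (blast intro: Ck_on_Suc_imp)+

section \<open>Uniform bounds and Lipschitz constants for multilinear forms\<close>

lemma linear_sum_Basis:
  fixes \<phi> :: "'e::euclidean_space \<Rightarrow> real"
  assumes "linear \<phi>"
  shows "\<phi> a = (\<Sum>b\<in>Basis. (a \<bullet> b) * \<phi> b)"
proof -
  have "\<phi> a = \<phi> (\<Sum>b\<in>Basis. (a \<bullet> b) *\<^sub>R b)" by (simp add: euclidean_representation)
  then show ?thesis using assms by (simp add: linear_sum linear_scale)
qed

text \<open>One constant serves both as supremum bound and as Lipschitz constant, so that scalings
  and finite sums carry the two along together.\<close>

definition bound_lip :: "'a::metric_space set \<Rightarrow> real \<Rightarrow> ('a \<Rightarrow> real) \<Rightarrow> bool" where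
  "bound_lip X M \<phi> \<longleftrightarrow> (\<forall>q\<in>X. \<bar>\<phi> q\<bar> \<le> M) \<and> (\<forall>q\<in>X. \<forall>q'\<in>X. \<bar>\<phi> q - \<phi> q'\<bar> \<le> M * dist q q')"

lemma bound_lip_abs: "bound_lip X M \<phi> \<Longrightarrow> q \<in> X \<Longrightarrow> \<bar>\<phi> q\<bar> \<le> M"
  and bound_lip_diff: "bound_lip X M \<phi> \<Longrightarrow> q \<in> X \<Longrightarrow> q' \<in> X \<Longrightarrow> \<bar>\<phi> q - \<phi> q'\<bar> \<le> M * dist q q'"
  by (auto simp: bound_lip_def)

lemma bound_lip_mono:
  assumes "bound_lip X M \<phi>" "M \<le> M'"
  shows "bound_lip X M' \<phi>"
  unfolding bound_lip_def
proof (intro conjI ballI)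
  show "\<bar>\<phi> q\<bar> \<le> M'" if "q \<in> X" for q
    using bound_lip_abs[OF assms(1) that] assms(2) by linarith
  show "\<bar>\<phi> q - \<phi> q'\<bar> \<le> M' * dist q q'" if "q \<in> X" "q' \<in> X" for q q'
    using bound_lip_diff[OF assms(1) that] mult_right_mono[OF assms(2), of "dist q q'"] by simp
qed

lemma bound_lip_scale:
  assumes "bound_lip X M \<phi>"
  shows "bound_lip X (\<bar>c\<bar> * M) (\<lambda>q. c * \<phi> q)"
  using assms unfolding bound_lip_def
  by (auto simp: abs_mult right_diff_distrib[symmetric] mult.assoc intro!: mult_left_mono)

lemma bound_lip_add:
  assumes "bound_lip X M \<phi>" "bound_lip X N \<psi>"
  shows "bound_lip X (M + N) (\<lambda>q. \<phi> q + \<psi> q)"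
  unfolding bound_lip_def
proof (intro conjI ballI)
  show "\<bar>\<phi> q + \<psi> q\<bar> \<le> M + N" if "q \<in> X" for q
    using bound_lip_abs[OF assms(1) that] bound_lip_abs[OF assms(2) that] by linarith
  show "\<bar>\<phi> q + \<psi> q - (\<phi> q' + \<psi> q')\<bar> \<le> (M + N) * dist q q'" if "q \<in> X" "q' \<in> X" for q q'
    using bound_lip_diff[OF assms(1) that] bound_lip_diff[OF assms(2) that]
    by (auto simp: distrib_right)
qed

lemma bound_lip_zero: "bound_lip X 0 (\<lambda>q. 0)"
  by (auto simp: bound_lip_def)

lemma bound_lip_sum:
  assumes "finite I" "\<And>i. i \<in> I \<Longrightarrow> bound_lip X (M i) (\<phi> i)"
  shows "bound_lip X (\<Sum>i\<in>I. M i) (\<lambda>q. \<Sum>i\<in>I. \<phi> i q)"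
  using assms by (induction I rule: finite_induct) (auto intro!: bound_lip_add bound_lip_zero)

text \<open>
  Iterating this lemma, with \<open>\<nu>\<close> collecting the norms of the arguments already treated, turns bounds
  on the coefficients of a multilinear form into uniform bounds on the form.
\<close>

lemma bound_lip_linear:
  fixes \<Phi> :: "'e::euclidean_space \<Rightarrow> 'i \<Rightarrow> 'a::metric_space \<Rightarrow> real"
  assumes lin: "\<And>i q. q \<in> X \<Longrightarrow> linear (\<lambda>a. \<Phi> a i q)"
    and basis: "\<And>b. b \<in> Basis \<Longrightarrow> \<exists>M. \<forall>i. bound_lip X (M * \<nu> i) (\<Phi> b i)"
    and \<nu>: "\<And>i. \<nu> i \<ge> 0"
  shows "\<exists>M\<ge>0. \<forall>a i. bound_lip X (M * (norm a * \<nu> i)) (\<Phi> a i)"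
proof -
  obtain M where M: "\<And>b i. b \<in> Basis \<Longrightarrow> bound_lip X (M b * \<nu> i) (\<Phi> b i)"
    using basis by metis
  define N where "N = (\<Sum>b\<in>Basis. \<bar>M b\<bar>)"
  have "bound_lip X (N * (norm a * \<nu> i)) (\<Phi> a i)" for a i
  proof -
    have "bound_lip X (\<bar>a \<bullet> b\<bar> * (M b * \<nu> i)) (\<lambda>q. (a \<bullet> b) * \<Phi> b i q)" if "b \<in> Basis" for b
      by (intro bound_lip_scale M that)
    then have "bound_lip X (\<bar>M b\<bar> * (norm a * \<nu> i)) (\<lambda>q. (a \<bullet> b) * \<Phi> b i q)" if "b \<in> Basis" for b
    proof (rule bound_lip_mono)
      have "\<bar>a \<bullet> b\<bar> * (M b * \<nu> i) \<le> \<bar>a \<bullet> b\<bar> * (\<bar>M b\<bar> * \<nu> i)"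
        using \<nu>[of i] by (intro mult_left_mono mult_right_mono) auto
      also have "\<dots> \<le> norm a * (\<bar>M b\<bar> * \<nu> i)"
        using that \<nu>[of i] by (intro mult_right_mono Basis_le_norm) auto
      finally have "\<bar>a \<bullet> b\<bar> * (M b * \<nu> i) \<le> norm a * (\<bar>M b\<bar> * \<nu> i)" .
      then show "\<bar>a \<bullet> b\<bar> * (M b * \<nu> i) \<le> \<bar>M b\<bar> * (norm a * \<nu> i)"
        by (simp add: mult_ac)
    qed (use that in auto)
    then have "bound_lip X (\<Sum>b\<in>Basis. \<bar>M b\<bar> * (norm a * \<nu> i)) (\<lambda>q. \<Sum>b\<in>Basis. (a \<bullet> b) * \<Phi> b i q)"
      by (intro bound_lip_sum) auto
    then have "bound_lip X (N * (norm a * \<nu> i)) (\<lambda>q. \<Sum>b\<in>Basis. (a \<bullet> b) * \<Phi> b i q)"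
      by (simp add: N_def sum_distrib_right)
    moreover have "(\<Sum>b\<in>Basis. (a \<bullet> b) * \<Phi> b i q) = \<Phi> a i q" if "q \<in> X" for q
      using linear_sum_Basis[OF lin[OF that, of i], of a] by simp
    ultimately show ?thesis by (simp add: bound_lip_def)
  qed
  moreover have "N \<ge> 0" unfolding N_def by (intro sum_nonneg) auto
  ultimately show ?thesis by blast
qed

text \<open>The derivatives in the basis directions are continuous, hence bounded on the compact
  ball, and together they bound the operator norm. Convexity of the ball turns this into a Lipschitz
  constant.\<close>

lemma Ck_on_bound_lip:
  fixes \<phi> :: "'e::euclidean_space \<Rightarrow> real"
  assumes "Ck_on 1 S \<phi>" "cball x r \<subseteq> S"
  obtains M where "M \<ge> 0" "bound_lip (cball x r) M \<phi>"
proof -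
  let ?D = "\<lambda>q. frechet_derivative \<phi> (at q)"
  have bdd: "\<exists>M. \<forall>q\<in>cball x r. \<bar>\<psi> q\<bar> \<le> M" if "continuous_on S \<psi>" for \<psi> :: "'e \<Rightarrow> real"
  proof -
    have "compact (\<psi> ` cball x r)"
      using that assms(2) by (intro compact_continuous_image) (auto intro: continuous_on_subset)
    then have "bounded (\<psi> ` cball x r)" by (rule compact_imp_bounded)
    then show ?thesis by (auto simp: bounded_iff)
  qed
  have D: "(\<phi> has_derivative ?D q) (at q)" if "q \<in> cball x r" for q
    using assms that by (intro Ck_on_Suc_has_derivative[of 0]) auto
  obtain M0 where M0: "\<And>q. q \<in> cball x r \<Longrightarrow> \<bar>\<phi> q\<bar> \<le> M0"
    using bdd[OF Ck_on_continuous_on[OF assms(1)]] by blast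
  have "\<forall>b. \<exists>M. \<forall>q\<in>cball x r. \<bar>?D q b\<bar> \<le> M"
    using assms(1) by (intro allI bdd) auto
  then obtain N where N: "\<And>b q. q \<in> cball x r \<Longrightarrow> \<bar>?D q b\<bar> \<le> N b"
    by metis
  define L where "L = (\<Sum>b\<in>Basis. \<bar>N b\<bar>)"
  have L: "\<bar>?D q a\<bar> \<le> L * norm a" if "q \<in> cball x r" for q a
  proof -
    have "linear (?D q)" using D[OF that] by (auto dest: has_derivative_linear)
    then have "\<bar>?D q a\<bar> = \<bar>\<Sum>b\<in>Basis. (a \<bullet> b) * ?D q b\<bar>"
      using linear_sum_Basis by metis
    also have "\<dots> \<le> (\<Sum>b\<in>Basis. \<bar>a \<bullet> b\<bar> * \<bar>?D q b\<bar>)"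
      by (metis (mono_tags, lifting) abs_mult sum.cong sum_abs)
    also have "\<dots> \<le> (\<Sum>b\<in>Basis. norm a * \<bar>N b\<bar>)"
      using N[OF that] by (intro sum_mono mult_mono Basis_le_norm) (auto intro: order.trans[OF _ abs_ge_self])
    finally show ?thesis by (simp add: L_def sum_distrib_left mult.commute)
  qed
  have lip: "\<bar>\<phi> q - \<phi> q'\<bar> \<le> L * dist q q'" if "q \<in> cball x r" "q' \<in> cball x r" for q q'
  proof -
    have "norm (\<phi> q - \<phi> q') \<le> L * norm (q - q')"
    proof (rule differentiable_bound[OF convex_cball _ _ that])
      show "(\<phi> has_derivative ?D y) (at y within cball x r)" if "y \<in> cball x r" for y
        using D[OF that] by (rule has_derivative_at_withinI)
      show "onorm (?D y) \<le> L" if "y \<in> cball x r" for y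
        using L[OF that] by (intro onorm_le) (auto simp: mult.commute)
    qed
    then show ?thesis by (simp add: dist_norm)
  qed
  \<comment> \<open>For an empty ball \<open>M0\<close> may be negative; the absolute value keeps
    the constant nonnegative.\<close>
  have "bound_lip (cball x r) (\<bar>M0\<bar> + \<bar>L\<bar>) \<phi>"
    unfolding bound_lip_def
  proof (intro conjI ballI)
    show "\<bar>\<phi> q\<bar> \<le> \<bar>M0\<bar> + \<bar>L\<bar>" if "q \<in> cball x r" for q
      using M0[OF that] by linarith
    show "\<bar>\<phi> q - \<phi> q'\<bar> \<le> (\<bar>M0\<bar> + \<bar>L\<bar>) * dist q q'" if "q \<in> cball x r" "q' \<in> cball x r" for q q'
      using lip[OF that] by (rule order.trans) (intro mult_right_mono; simp)
  qed
  then show thesis by (intro that[of "\<bar>M0\<bar> + \<bar>L\<bar>"]) auto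
qed

text \<open>The squared norm is differentiable also at zeros of \<open>f\<close>; multiplied by the
  integrating factor \<open>exp (- 2 * L * (t - a))\<close> it does not increase, by
  Cauchy-Schwarz.\<close>

lemma gronwall:
  fixes f :: "real \<Rightarrow> 'a::real_inner"
  assumes "a \<le> b"
    and f: "\<And>t. t \<in> {a..b} \<Longrightarrow> (f has_vector_derivative f' t) (at t within {a..b})"
    and le: "\<And>t. t \<in> {a..b} \<Longrightarrow> norm (f' t) \<le> L * norm (f t)"
  shows "norm (f b) \<le> exp (L * (b - a)) * norm (f a)"
proof -
  let ?h = "\<lambda>t. exp (- (2 * L * (t - a))) * (f t \<bullet> f t)"
  have "?h b \<le> ?h a"
  proof (rule DERIV_nonpos_imp_decreasing_open[where f = ?h])
    show "a \<le> b" by fact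
    show "continuous_on {a..b} ?h"
      using f by (intro continuous_intros continuous_on_vector_derivative[where f' = f']) auto
    show "\<exists>y. DERIV ?h t :> y \<and> y \<le> 0" if "a < t" "t < b" for t
    proof (intro exI conjI)
      have "(f has_vector_derivative f' t) (at t)"
        using f[of t] that by (simp add: at_within_Icc_at)
      then have *: "(f has_derivative (\<lambda>h. h *\<^sub>R f' t)) (at t)"
        by (simp add: has_vector_derivative_def)
      show "DERIV ?h t :> exp (- (2 * L * (t - a))) * (2 * (f t \<bullet> f' t) - 2 * L * (f t \<bullet> f t))"
        unfolding has_field_derivative_def
        by (rule has_derivative_eq_rhs, (rule derivative_eq_intros * refl)+)
          (auto simp: fun_eq_iff inner_commute algebra_simps)
      have "f t \<bullet> f' t \<le> norm (f t) * norm (f' t)" by (rule norm_cauchy_schwarz)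
      also have "\<dots> \<le> norm (f t) * (L * norm (f t))"
        using le[of t] that by (intro mult_left_mono) auto
      also have "\<dots> = L * (f t \<bullet> f t)" by (simp add: dot_square_norm power2_eq_square)
      finally show "exp (- (2 * L * (t - a))) * (2 * (f t \<bullet> f' t) - 2 * L * (f t \<bullet> f t)) \<le> 0"
        by (auto simp: mult_le_0_iff)
    qed
  qed
  then have "exp (- (2 * L * (b - a))) * (norm (f b))\<^sup>2 \<le> (norm (f a))\<^sup>2"
    by (simp add: dot_square_norm)
  then have "exp (2 * L * (b - a)) * (exp (- (2 * L * (b - a))) * (norm (f b))\<^sup>2)
      \<le> exp (2 * L * (b - a)) * (norm (f a))\<^sup>2"
    by (intro mult_left_mono) auto
  then have "(norm (f b))\<^sup>2 \<le> exp (2 * L * (b - a)) * (norm (f a))\<^sup>2"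
    unfolding mult.assoc[symmetric] exp_add[symmetric] by simp
  also have "exp (2 * L * (b - a)) = (exp (L * (b - a)))\<^sup>2"
    by (simp add: power2_eq_square flip: exp_add)
  finally have "(norm (f b))\<^sup>2 \<le> (exp (L * (b - a)) * norm (f a))\<^sup>2"
    by (simp add: power_mult_distrib)
  then show ?thesis by (rule power2_le_imp_le) simp
qed

lemma vector_derivative_bound:
  fixes f :: "real \<Rightarrow> 'a::real_normed_vector"
  assumes f: "\<And>s. s \<in> {a..b} \<Longrightarrow> (f has_vector_derivative f' s) (at s within {a..b})"
    and le: "\<And>s. s \<in> {a..b} \<Longrightarrow> norm (f' s) \<le> M" and "a \<le> b"
  shows "norm (f b - f a) \<le> M * (b - a)"
proof -
  have "norm (f b - f a) \<le> M * norm (b - a)"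
  proof (rule differentiable_bound[where S = "{a..b}" and f' = "\<lambda>s h. h *\<^sub>R f' s"])
    show "(f has_derivative (\<lambda>h. h *\<^sub>R f' s)) (at s within {a..b})" if "s \<in> {a..b}" for s
      using f[OF that] by (simp add: has_vector_derivative_def)
    show "onorm (\<lambda>h. h *\<^sub>R f' s) \<le> M" if "s \<in> {a..b}" for s
      using mult_left_mono[OF le[OF that] abs_ge_zero] by (intro onorm_le) (auto simp: mult.commute)
  qed (use assms in auto)
  then show ?thesis using \<open>a \<le> b\<close> by simp
qed


text \<open>
  Makes gradients and Christoffel symbols locally Lipschitz without any formula for the inverse of
  the metric.
\<close>

lemma riesz_lipschitz:
  fixes G :: "'e::real_normed_vector \<Rightarrow> 'e \<Rightarrow> 'e \<Rightarrow> real"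
  assumes X: "q \<in> X" "q' \<in> X"
    and lin: "linear (\<lambda>a. G q a (a1 - a2))"
    and M: "\<And>a b. bound_lip X (M * (norm a * norm b)) (\<lambda>q. G q a b)"
    and l: "l > 0" "\<And>q a. q \<in> X \<Longrightarrow> l * (norm a)\<^sup>2 \<le> G q a a"
    and a1: "\<And>b. G q a1 b = \<phi> b" and a2: "\<And>b. G q' a2 b = \<psi> b"
    and \<epsilon>: "\<epsilon> \<ge> 0" "M \<ge> 0" "\<And>b. \<bar>\<phi> b - \<psi> b\<bar> \<le> \<epsilon> * norm b"
  shows "l * norm (a1 - a2) \<le> \<epsilon> + M * dist q q' * norm a2"
proof (cases "a1 = a2")
  case False
  let ?d = "a1 - a2"
  have "l * (norm ?d)\<^sup>2 \<le> G q ?d ?d" by (rule l(2)[OF X(1)])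
  \<comment> \<open>Inserting \<open>G q' a2 ?d\<close> separates the change of the functional from
    the change of the metric.\<close>
  also have "\<dots> = (\<phi> ?d - \<psi> ?d) - (G q a2 ?d - G q' a2 ?d)"
    using linear_diff[OF lin] a1 a2 by simp
  also have "\<dots> \<le> \<epsilon> * norm ?d + M * (norm a2 * norm ?d) * dist q q'"
    using \<epsilon>(3)[of ?d] bound_lip_diff[OF M X, of a2 ?d] by linarith
  finally have "norm ?d * (l * norm ?d) \<le> norm ?d * (\<epsilon> + M * dist q q' * norm a2)"
    by (simp add: power2_eq_square algebra_simps)
  then show ?thesis using False by simp
qed (use \<epsilon> in auto)

text \<open>A Riemannian metric as seen in one chart. Two continuous derivatives of its coefficients
  make the Christoffel symbols locally Lipschitz, as Gronwall's inequality for the geodesic equation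
  demands.\<close>

locale coord_metric =
  fixes S :: "'e::euclidean_space set" and G :: "'e \<Rightarrow> 'e \<Rightarrow> 'e \<Rightarrow> real"
  assumes open_S: "open S"
    and G_sym: "q \<in> S \<Longrightarrow> G q a b = G q b a"
    and G_linear_left: "q \<in> S \<Longrightarrow> linear (\<lambda>a. G q a b)"
    and G_pos: "q \<in> S \<Longrightarrow> a \<noteq> 0 \<Longrightarrow> G q a a > 0"
    and G_C2: "Ck_on 2 S (\<lambda>q. G q a b)"
begin

lemma G_linear: "q \<in> S \<Longrightarrow> linear (G q a)"
  using G_linear_left[of q a] G_sym[of q _ a] by (simp add: linear_iff)

text \<open>\<open>?F\<close> lists the values of the functional \<open>G q a\<close> on the
  standard basis. Positivity makes it injective, finite dimension then makes it surjective.\<close>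

lemma riesz:
  assumes q: "q \<in> S" and \<phi>: "linear \<phi>"
  shows "\<exists>!a. \<forall>b. G q a b = \<phi> b"
proof -
  let ?F = "\<lambda>a. \<Sum>i\<in>Basis. G q a i *\<^sub>R i"
  have lin: "linear ?F"
    using G_linear_left[OF q]
    by (auto simp: linear_iff sum.distrib scaleR_sum_right algebra_simps intro!: linearI)
  have eq: "(\<forall>b. G q a b = \<psi> b) \<longleftrightarrow> ?F a = (\<Sum>i\<in>Basis. \<psi> i *\<^sub>R i)" if \<psi>: "linear \<psi>" for a \<psi>
  proof
    assume *: "?F a = (\<Sum>i\<in>Basis. \<psi> i *\<^sub>R i)"
    have "G q a i = \<psi> i" if "i \<in> Basis" for i
    proof -
      have "G q a i = ?F a \<bullet> i" using that by simp
      also have "\<dots> = \<psi> i" unfolding * using that by simp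
      finally show ?thesis .
    qed
    then have "G q a = \<psi>"
      by (intro linear_eq_stdbasis[OF G_linear[OF q] \<psi>]) auto
    then show "\<forall>b. G q a b = \<psi> b" by simp
  qed simp
  have "inj ?F"
  proof (subst linear_injective_0[OF lin], intro allI impI)
    fix a assume "?F a = 0"
    then have "\<forall>b. G q a b = 0"
      using eq[of "\<lambda>_. 0" a] by (simp add: linear_zero)
    then show "a = 0" using G_pos[OF q, of a] by force
  qed
  then have "surj ?F" using linear_injective_imp_surjective[OF lin] by simp
  then obtain a where Fa: "(\<Sum>i\<in>Basis. \<phi> i *\<^sub>R i) = ?F a"
    by (rule surjE)
  have a: "\<forall>b. G q a b = \<phi> b"
    by (rule eq[OF \<phi>, THEN iffD2, OF Fa[symmetric]])
  show ?thesis
  proof (rule ex1I[of _ a], rule a)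
    fix a' assume "\<forall>b. G q a' b = \<phi> b"
    then have "?F a' = ?F a" using a by simp
    then show "a' = a" by (rule injD[OF \<open>inj ?F\<close>])
  qed
qed

section \<open>Derivatives of the metric and Christoffel symbols\<close>

definition DG :: "'e \<Rightarrow> 'e \<Rightarrow> 'e \<Rightarrow> 'e \<Rightarrow> real" where
  "DG q a b c = frechet_derivative (\<lambda>r. G r b c) (at q) a"

lemma G_has_derivative: "q \<in> S \<Longrightarrow> ((\<lambda>r. G r b c) has_derivative (\<lambda>a. DG q a b c)) (at q)"
  unfolding DG_def using Ck_on_Suc_has_derivative[of 1 S "\<lambda>r. G r b c" q] G_C2[of b c]
  by (simp add: numeral_2_eq_2)

lemma DG_C1: "Ck_on 1 S (\<lambda>q. DG q a b c)"
  unfolding DG_def using G_C2[of b c] by (auto simp: numeral_2_eq_2)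

text \<open>Identities for \<open>G\<close> hold throughout the open set \<open>S\<close>, so they
  pass to derivatives by uniqueness. Symmetry and linearity of \<open>DG\<close> in its metric
  arguments are obtained this way.\<close>

lemma DG_eqI:
  assumes "q \<in> S" "(f has_derivative f') (at q)" "\<And>r. r \<in> S \<Longrightarrow> f r = G r b c"
  shows "DG q a b c = f' a"
proof -
  have "((\<lambda>r. G r b c) has_derivative f') (at q)"
    using assms open_S by (auto intro: has_derivative_transform_within_open)
  then show ?thesis
    using G_has_derivative[OF assms(1), of b c] by (metis has_derivative_unique)
qed

lemma DG_sym: "q \<in> S \<Longrightarrow> DG q a b c = DG q a c b"
  by (rule DG_eqI[OF _ G_has_derivative]) (auto simp: G_sym)

lemma DG_linear1: "q \<in> S \<Longrightarrow> linear (\<lambda>a. DG q a b c)"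
  using G_has_derivative by (rule has_derivative_linear)

lemma DG_linear2: "q \<in> S \<Longrightarrow> linear (\<lambda>b. DG q a b c)"
proof (rule linearI)
  assume q: "q \<in> S"
  show "DG q a (b + b') c = DG q a b c + DG q a b' c" for b b'
    by (rule DG_eqI[OF q has_derivative_add[OF G_has_derivative G_has_derivative]])
      (use q in \<open>auto simp: linear_add[OF G_linear_left]\<close>)
  show "DG q a (s *\<^sub>R b) c = s *\<^sub>R DG q a b c" for s b
    by (rule DG_eqI[OF q has_derivative_scaleR_right[OF G_has_derivative]])
      (use q in \<open>auto simp: linear_scale[OF G_linear_left]\<close>)
qed

lemma DG_linear3: "q \<in> S \<Longrightarrow> linear (\<lambda>c. DG q a b c)"
  using DG_linear2[of q a b] by (simp add: DG_sym[of q a b])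

text \<open>The Koszul formula again, now inside the local theory, where \<open>riesz\<close> shows
  that the definite description denotes; \<open>christoffel_eq\<close> is the link to
  \<open>christoffel\<close>.\<close>

definition chr :: "'e \<Rightarrow> 'e \<Rightarrow> 'e \<Rightarrow> 'e" where
  "chr q x y = (THE a. \<forall>b. G q a b = (DG q x y b + DG q y x b - DG q b x y) / 2)"

lemma G_chr: "q \<in> S \<Longrightarrow> G q (chr q x y) b = (DG q x y b + DG q y x b - DG q b x y) / 2"
  and chr_eqI: "q \<in> S \<Longrightarrow> (\<And>b. G q a b = (DG q x y b + DG q y x b - DG q b x y) / 2) \<Longrightarrow> chr q x y = a"
proof -
  assume q: "q \<in> S"
  have "linear (\<lambda>b. (DG q x y b + DG q y x b - DG q b x y) / 2)"
    using DG_linear1[OF q, of x y] DG_linear3[OF q, of x y] DG_linear3[OF q, of y x]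
    by (simp add: linear_iff algebra_simps add_divide_distrib diff_divide_distrib)
  note ex1 = riesz[OF q this]
  show "G q (chr q x y) b = (DG q x y b + DG q y x b - DG q b x y) / 2"
    unfolding chr_def by (rule theI'[OF ex1, THEN spec])
  show "chr q x y = a" if "\<And>b. G q a b = (DG q x y b + DG q y x b - DG q b x y) / 2"
    unfolding chr_def using that by (intro the1_equality[OF ex1]) auto
qed

text \<open>This quadratic homogeneity is what makes affine reparametrisations of geodesics
  geodesics.\<close>

lemma chr_scale: "q \<in> S \<Longrightarrow> chr q (s *\<^sub>R x) (s *\<^sub>R x) = s\<^sup>2 *\<^sub>R chr q x x"
proof (rule chr_eqI)
  assume q: "q \<in> S"
  fix b
  show "G q (s\<^sup>2 *\<^sub>R chr q x x) b = (DG q (s *\<^sub>R x) (s *\<^sub>R x) b + DG q (s *\<^sub>R x) (s *\<^sub>R x) b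
     - DG q b (s *\<^sub>R x) (s *\<^sub>R x)) / 2"
    by (simp add: linear_scale[OF G_linear_left[OF q]] G_chr[OF q] linear_scale[OF DG_linear1[OF q]]
        linear_scale[OF DG_linear2[OF q]] linear_scale[OF DG_linear3[OF q]] power2_eq_square algebra_simps)
qed

section \<open>Constants valid on a whole coordinate ball\<close>

lemma G_bound_lip:
  assumes "cball x r \<subseteq> S"
  obtains M where "M \<ge> 0" "\<And>a b. bound_lip (cball x r) (M * (norm a * norm b)) (\<lambda>q. G q a b)"
proof -
  let ?X = "cball x r"
  have X: "q \<in> S" if "q \<in> ?X" for q using that assms by blast
  \<comment> \<open>The one-point index type with weight 1 starts the iteration of
    \<open>bound_lip_linear\<close>, in which no argument has been treated yet.\<close>
  have "\<exists>M. \<forall>u::unit. bound_lip ?X (M * 1) (\<lambda>q. G q a b)" for a b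
  proof -
    have "Ck_on 1 S (\<lambda>q. G q a b)" using G_C2 by (rule Ck_on_mono) simp
    from Ck_on_bound_lip[OF this assms] show ?thesis by (metis mult_1_right)
  qed
  then have "\<exists>M\<ge>0. \<forall>b (u::unit). bound_lip ?X (M * (norm b * 1)) (\<lambda>q. G q a b)" for a
    by (intro bound_lip_linear) (auto intro: G_linear X simp del: mem_cball)
  then have "\<exists>M. \<forall>b. bound_lip ?X (M * norm b) (\<lambda>q. G q a b)" for a
    by (metis mult_1_right)
  then have "\<exists>M\<ge>0. \<forall>a b. bound_lip ?X (M * (norm a * norm b)) (\<lambda>q. G q a b)"
    by (intro bound_lip_linear) (auto intro: G_linear_left X simp del: mem_cball)
  then show thesis using that by blast
qed

lemma DG_bound_lip:
  assumes "cball x r \<subseteq> S"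
  obtains M where "M \<ge> 0"
    "\<And>a b c. bound_lip (cball x r) (M * (norm a * (norm b * norm c))) (\<lambda>q. DG q a b c)"
proof -
  let ?X = "cball x r"
  have X: "q \<in> S" if "q \<in> ?X" for q using that assms by blast
  have "\<exists>M. \<forall>u::unit. bound_lip ?X (M * 1) (\<lambda>q. DG q a b c)" for a b c
    using Ck_on_bound_lip[OF DG_C1 assms, of a b c] by (metis mult_1_right)
  then have "\<exists>M\<ge>0. \<forall>c (u::unit). bound_lip ?X (M * (norm c * 1)) (\<lambda>q. DG q a b c)" for a b
    by (intro bound_lip_linear) (auto intro: DG_linear3 X simp del: mem_cball)
  then have "\<exists>M. \<forall>c. bound_lip ?X (M * norm c) (\<lambda>q. DG q a b c)" for a b
    by (metis mult_1_right)
  then have "\<exists>M\<ge>0. \<forall>b c. bound_lip ?X (M * (norm b * norm c)) (\<lambda>q. DG q a b c)" for a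
    by (intro bound_lip_linear) (auto intro: DG_linear2 X simp del: mem_cball)
  \<comment> \<open>The two arguments already treated are packed into a pair, as
    \<open>bound_lip_linear\<close> has a single index.\<close>
  then have "\<exists>M. \<forall>p. bound_lip ?X (M * (norm (fst p) * norm (snd p))) (\<lambda>q. DG q a (fst p) (snd p))" for a
    by meson
  then have "\<exists>M\<ge>0. \<forall>a p. bound_lip ?X (M * (norm a * (norm (fst p) * norm (snd p))))
      (\<lambda>q. DG q a (fst p) (snd p))"
    by (intro bound_lip_linear) (auto intro: DG_linear1 X simp del: mem_cball)
  then obtain M where M: "M \<ge> 0" "\<And>a p. bound_lip ?X (M * (norm a * (norm (fst p) * norm (snd p))))
      (\<lambda>q. DG q a (fst p) (snd p))"
    by blast
  show thesis using that[OF M(1)] M(2)[of _ "(_, _)"] by simp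
qed

text \<open>\<open>l\<close> is the minimum of the metric over the compact product of the ball with
  the unit sphere; it is positive, and homogeneity extends the bound to all vectors.\<close>

lemma G_coercive:
  assumes "cball x r \<subseteq> S" "r \<ge> 0"
  obtains l where "l > 0" "\<And>q a. q \<in> cball x r \<Longrightarrow> l * (norm a)\<^sup>2 \<le> G q a a"
proof -
  obtain M where M: "M \<ge> 0" "\<And>a b. bound_lip (cball x r) (M * (norm a * norm b)) (\<lambda>q. G q a b)"
    using G_bound_lip[OF assms(1)] by metis
  let ?X = "cball x r \<times> sphere (0::'e) 1"
  obtain b0 :: 'e where b0: "b0 \<in> Basis" using nonempty_Basis by blast
  have "continuous_on ?X (\<lambda>p. G (fst p) (snd p) (snd p))"
  proof -
    \<comment> \<open>Joint continuity in point and vector reduces to continuity in the point of the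
      finitely many coefficients.\<close>
    have "G (fst p) (snd p) (snd p) = (\<Sum>i\<in>Basis. \<Sum>j\<in>Basis. (snd p \<bullet> i) * ((snd p \<bullet> j) * G (fst p) i j))"
      if "p \<in> ?X" for p
    proof -
      have q: "fst p \<in> S" using that assms by auto
      have "G (fst p) (snd p) (snd p) = (\<Sum>i\<in>Basis. (snd p \<bullet> i) * G (fst p) i (snd p))"
        by (rule linear_sum_Basis[OF G_linear_left[OF q]])
      also have "\<dots> = (\<Sum>i\<in>Basis. \<Sum>j\<in>Basis. (snd p \<bullet> i) * ((snd p \<bullet> j) * G (fst p) i j))"
        by (subst linear_sum_Basis[OF G_linear[OF q], of _ "snd p"]) (simp add: sum_distrib_left)
      finally show ?thesis .
    qed
    moreover have "continuous_on ?X (\<lambda>p. G (fst p) i j)" for i j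
      by (rule continuous_on_compose2[OF Ck_on_continuous_on[OF G_C2] continuous_on_fst])
        (use assms in auto)
    ultimately show ?thesis
      by (subst continuous_on_cong[OF refl]) (auto intro!: continuous_intros)
  qed
  moreover have "compact ?X" by (intro compact_Times) auto
  moreover have "(x, b0) \<in> ?X" using assms b0 by auto
  ultimately have "\<exists>p\<in>?X. \<forall>p'\<in>?X. G (fst p) (snd p) (snd p) \<le> G (fst p') (snd p') (snd p')"
    by (intro continuous_attains_inf) auto
  then obtain p where p: "p \<in> ?X"
    "\<And>p'. p' \<in> ?X \<Longrightarrow> G (fst p) (snd p) (snd p) \<le> G (fst p') (snd p') (snd p')"
    by blast
  define l where "l = G (fst p) (snd p) (snd p)"
  show thesis
  proof
    show "l > 0" unfolding l_def using p(1) assms by (intro G_pos) auto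
    fix q a assume q: "q \<in> cball x r"
    show "l * (norm a)\<^sup>2 \<le> G q a a"
    proof (cases "a = 0")
      case False
      let ?u = "a /\<^sub>R norm a"
      have "l \<le> G q ?u ?u" unfolding l_def using p(2)[of "(q, ?u)"] q False by auto
      also have "\<dots> = G q a a / (norm a)\<^sup>2"
      proof -
        have "q \<in> S" using q assms by auto
        then show ?thesis
          by (simp add: linear_scale[OF G_linear_left] linear_scale[OF G_linear] power2_eq_square
              divide_inverse del: norm_eq_zero)
      qed
      finally show ?thesis using False by (simp add: field_simps)
    next
      case True
      have "q \<in> S" using q assms by auto
      then show ?thesis using True linear_0[OF G_linear, of q 0] by simp
    qed
  qed
qed

text \<open>Both bounds rest on coercivity: the quadratic one by testing the Koszul formula with
  \<open>chr q v v\<close> itself, the Lipschitz one through \<open>riesz_lipschitz\<close>. The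
  latter is confined to vectors of norm at most \<open>R\<close> because \<open>chr\<close> is
  quadratic in the velocity.\<close>

lemma chr_bound_lip:
  assumes "cball x r \<subseteq> S" "r \<ge> 0" "R \<ge> 0"
  obtains L where "L \<ge> 0"
    "\<And>q v. q \<in> cball x r \<Longrightarrow> norm (chr q v v) \<le> L * (norm v)\<^sup>2"
    "\<And>q q' v u. q \<in> cball x r \<Longrightarrow> q' \<in> cball x r \<Longrightarrow> norm v \<le> R \<Longrightarrow> norm u \<le> R \<Longrightarrow>
       norm (chr q v v - chr q' u u) \<le> L * (dist q q' + norm (v - u))"
proof -
  let ?X = "cball x r"
  have X: "q \<in> S" if "q \<in> ?X" for q using that assms by blast
  obtain M where M: "M \<ge> 0" "\<And>a b. bound_lip ?X (M * (norm a * norm b)) (\<lambda>q. G q a b)"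
    using G_bound_lip[OF assms(1)] by metis
  obtain N where N: "N \<ge> 0" "\<And>a b c. bound_lip ?X (N * (norm a * (norm b * norm c))) (\<lambda>q. DG q a b c)"
    using DG_bound_lip[OF assms(1)] by metis
  obtain l where l: "l > 0" "\<And>q a. q \<in> ?X \<Longrightarrow> l * (norm a)\<^sup>2 \<le> G q a a"
    using G_coercive[OF assms(1,2)] by metis
  \<comment> \<open>The Koszul functional with both vectors equal to \<open>v\<close>, where its
    first two terms coincide.\<close>
  define k where "k q v b = DG q v v b - DG q b v v / 2" for q v b
  have Gk: "G q (chr q v v) b = k q v b" if "q \<in> ?X" for q v b
    using G_chr[OF X[OF that], of v v b] by (simp add: k_def field_simps)
  have k_le: "\<bar>k q v b\<bar> \<le> 2 * N * (norm v)\<^sup>2 * norm b" if "q \<in> ?X" for q v b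
    using bound_lip_abs[OF N(2)[of v v b] that] bound_lip_abs[OF N(2)[of b v v] that]
    unfolding k_def by (simp add: power2_eq_square mult_ac)
  have bound: "norm (chr q v v) \<le> 2 * N / l * (norm v)\<^sup>2" if q: "q \<in> ?X" for q v
  proof -
    let ?c = "chr q v v"
    have "l * (norm ?c)\<^sup>2 \<le> 2 * N * (norm v)\<^sup>2 * norm ?c"
      using l(2)[OF q, of ?c] Gk[OF q, of v ?c] k_le[OF q, of v ?c] by linarith
    then have "norm ?c * (l * norm ?c) \<le> norm ?c * (2 * N * (norm v)\<^sup>2)"
      by (simp add: power2_eq_square mult_ac)
    then have "l * norm ?c \<le> 2 * N * (norm v)\<^sup>2"
      using N(1) by (cases "?c = 0") auto
    then show ?thesis using l(1) by (simp add: field_simps)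
  qed
  \<comment> \<open>The first two summands come from the variation of the Koszul functional, the
    third from the variation of the metric times the bound for \<open>chr\<close>.\<close>
  define L where "L = 2 * N * R\<^sup>2 + 4 * N * R + M * (2 * N / l * R\<^sup>2)"
  have "L \<ge> 0" using N(1) M(1) assms(3) l(1) by (auto simp: L_def intro!: add_nonneg_nonneg)
  have lip: "norm (chr q v v - chr q' u u) \<le> L / l * (dist q q' + norm (v - u))"
    if q: "q \<in> ?X" "q' \<in> ?X" and v: "norm v \<le> R" "norm u \<le> R" for q q' v u
  proof -
    define d where "d = dist q q' + norm (v - u)"
    have d: "0 \<le> d" "dist q q' \<le> d" "norm (v - u) \<le> d" by (auto simp: d_def)
    have diff: "\<bar>k q v b - k q' u b\<bar> \<le> (2 * N * R\<^sup>2 + 4 * N * R) * d * norm b" for b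
    proof -
      have 1: "\<bar>DG q a1 a2 a3 - DG q' a1 a2 a3\<bar> \<le> N * (R * R * norm b) * d"
        if "norm a1 * (norm a2 * norm a3) \<le> R * R * norm b" for a1 a2 a3
        using bound_lip_diff[OF N(2) q, of a1 a2 a3]
          mult_mono[OF mult_left_mono[OF that N(1)] d(2)] N(1) assms(3)
        by (auto intro: order.trans)
      have vv: "norm v * norm v \<le> R * R" using v assms(3) by (intro mult_mono) auto
      have A: "\<bar>DG q v v b - DG q' v v b\<bar> \<le> N * (R * R * norm b) * d"
        using mult_right_mono[OF vv, of "norm b"] by (intro 1) (simp add: mult_ac)
      have B: "\<bar>DG q b v v - DG q' b v v\<bar> \<le> N * (R * R * norm b) * d"
        using mult_right_mono[OF vv, of "norm b"] by (intro 1) (simp add: mult_ac)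
      have 2: "\<bar>DG q' a1 a2 a3\<bar> \<le> N * (d * R * norm b)"
        if "norm a1 * (norm a2 * norm a3) \<le> d * R * norm b" for a1 a2 a3
        using bound_lip_abs[OF N(2) q(2), of a1 a2 a3] mult_left_mono[OF that N(1)] by linarith
      have w: "norm (v - u) * norm v \<le> d * R" "norm (v - u) * norm u \<le> d * R"
        using v d by (auto intro!: mult_mono)
      note w' = mult_right_mono[OF w(1), of "norm b"] mult_right_mono[OF w(2), of "norm b"]
      have C: "\<bar>DG q' (v - u) v b\<bar> \<le> N * (d * R * norm b)" "\<bar>DG q' u (v - u) b\<bar> \<le> N * (d * R * norm b)"
        "\<bar>DG q' b (v - u) v\<bar> \<le> N * (d * R * norm b)" "\<bar>DG q' b u (v - u)\<bar> \<le> N * (d * R * norm b)"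
        using w' by (intro 2; simp add: mult_ac)+
      note q'S = X[OF q(2)]
      \<comment> \<open>Telescoping: first the base point moves with \<open>v\<close> fixed, then
        \<open>v\<close> is exchanged for \<open>u\<close> one slot at a time.\<close>
      have "k q v b - k q' u b = (DG q v v b - DG q' v v b) - (DG q b v v - DG q' b v v) / 2
          + DG q' (v - u) v b + DG q' u (v - u) b - (DG q' b (v - u) v + DG q' b u (v - u)) / 2"
        unfolding k_def
        by (simp add: linear_diff[OF DG_linear1[OF q'S]] linear_diff[OF DG_linear2[OF q'S]]
            linear_diff[OF DG_linear3[OF q'S]] diff_divide_distrib add_divide_distrib)
      moreover have "\<bar>a - b / 2 + c + d - (e + f) / 2\<bar> \<le> 3 / 2 * \<alpha> + 3 * \<beta>"
        if "\<bar>a\<bar> \<le> \<alpha>" "\<bar>b\<bar> \<le> \<alpha>" "\<bar>c\<bar> \<le> \<beta>" "\<bar>d\<bar> \<le> \<beta>" "\<bar>e\<bar> \<le> \<beta>" "\<bar>f\<bar> \<le> \<beta>"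
        for a b c d e f \<alpha> \<beta> :: real
        using that by argo
      ultimately have "\<bar>k q v b - k q' u b\<bar> \<le> 3 / 2 * (N * (R * R * norm b) * d) + 3 * (N * (d * R * norm b))"
        using A B C by presburger
      also have "\<dots> \<le> 2 * (N * (R * R * norm b) * d) + 4 * (N * (d * R * norm b))"
        using N(1) assms(3) d(1) by (intro add_mono mult_right_mono) auto
      finally show ?thesis by (simp add: power2_eq_square algebra_simps)
    qed
    have "l * norm (chr q v v - chr q' u u)
        \<le> (2 * N * R\<^sup>2 + 4 * N * R) * d + M * dist q q' * norm (chr q' u u)"
      by (rule riesz_lipschitz[OF q _ M(2) l Gk[OF q(1)] Gk[OF q(2)]])
        (use diff M N assms d in \<open>auto intro!: G_linear_left X q add_nonneg_nonneg\<close>)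
    also have "\<dots> \<le> (2 * N * R\<^sup>2 + 4 * N * R) * d + M * d * (2 * N / l * R\<^sup>2)"
    proof -
      have "norm (chr q' u u) \<le> 2 * N / l * R\<^sup>2"
        using v(2) N(1) l(1) by (intro order.trans[OF bound[OF q(2)]] mult_left_mono power_mono) auto
      then show ?thesis
        using M(1) d by (intro add_left_mono mult_mono) auto
    qed
    also have "\<dots> = L * d" by (simp add: L_def algebra_simps)
    finally show ?thesis using l(1) by (simp add: field_simps d_def)
  qed
  show thesis
  proof (rule that[of "max (2 * N / l) (L / l)"])
    show "0 \<le> max (2 * N / l) (L / l)" using N(1) l(1) by (simp add: le_max_iff_disj)
    show "norm (chr q v v) \<le> max (2 * N / l) (L / l) * (norm v)\<^sup>2" if "q \<in> ?X" for q v
      by (rule order.trans[OF bound[OF that]], rule mult_right_mono) auto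
    show "norm (chr q v v - chr q' u u) \<le> max (2 * N / l) (L / l) * (dist q q' + norm (v - u))"
      if "q \<in> ?X" "q' \<in> ?X" "norm v \<le> R" "norm u \<le> R" for q q' v u
      by (rule order.trans[OF lip[OF that]], rule mult_right_mono) auto
  qed
qed

text \<open>Expanding the vector arguments in the standard basis leaves only scalar product rules;
  symmetry of \<open>G\<close> merges the two terms containing \<open>u'\<close>.\<close>

lemma G_curve_derivative:
  assumes q: "x t \<in> S"
    and x: "(x has_vector_derivative x') (at t within J)"
    and u: "(u has_vector_derivative u') (at t within J)"
    and S: "\<forall>\<^sub>F s in at t within J. x s \<in> S"
    and t: "t \<in> J"
  shows "((\<lambda>s. G (x s) (u s) (u s)) has_real_derivative (DG (x t) x' (u t) (u t) + 2 * G (x t) u' (u t)))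
    (at t within J)"
proof -
  have ui: "((\<lambda>s. u s \<bullet> i) has_real_derivative u' \<bullet> i) (at t within J)" for i
    using u unfolding has_vector_derivative_def has_field_derivative_def
    by (auto intro!: derivative_eq_intros)
  have Gi: "((\<lambda>s. G (x s) i j) has_real_derivative DG (x t) x' i j) (at t within J)" for i j
  proof -
    have "((\<lambda>s. G (x s) i j) has_derivative (\<lambda>h. DG (x t) (h *\<^sub>R x') i j)) (at t within J)"
      using x unfolding has_vector_derivative_def
      by (rule has_derivative_in_compose[where g = "\<lambda>q. G q i j"])
        (rule has_derivative_at_withinI[OF G_has_derivative[OF q]])
    moreover have "(\<lambda>h. DG (x t) (h *\<^sub>R x') i j) = (*) (DG (x t) x' i j)"
      by (simp add: fun_eq_iff linear_scale[OF DG_linear1[OF q]] mult.commute)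
    ultimately show ?thesis
      by (simp add: has_field_derivative_def)
  qed
  have expand: "B a b = (\<Sum>i\<in>Basis. \<Sum>j\<in>Basis. (a \<bullet> i) * (b \<bullet> j) * B i j)"
    if "bilinear B" for B :: "'e \<Rightarrow> 'e \<Rightarrow> real" and a b
  proof -
    have lin: "linear (\<lambda>a. B a b)" "\<And>a. linear (B a)" for b
      using that by (auto simp: bilinear_def)
    have "B a b = (\<Sum>i\<in>Basis. (a \<bullet> i) * B i b)" by (rule linear_sum_Basis[OF lin(1)])
    then show ?thesis
      by (subst (asm) linear_sum_Basis[OF lin(2), of _ b]) (simp add: sum_distrib_left mult.assoc)
  qed
  have bil: "bilinear (G q)" "bilinear (DG q a)" if "q \<in> S" for q a
    using that by (auto simp: bilinear_def G_linear G_linear_left DG_linear2 DG_linear3)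
  have "((\<lambda>s. \<Sum>i\<in>Basis. \<Sum>j\<in>Basis. (u s \<bullet> i) * (u s \<bullet> j) * G (x s) i j) has_real_derivative
      (\<Sum>i\<in>Basis. \<Sum>j\<in>Basis. (u t \<bullet> i) * (u t \<bullet> j) * DG (x t) x' i j + (u' \<bullet> i) * (u t \<bullet> j) * G (x t) i j
        + (u t \<bullet> i) * (u' \<bullet> j) * G (x t) i j)) (at t within J)"
    by (rule derivative_eq_intros ui Gi refl)+ (simp add: algebra_simps)
  moreover have "(\<Sum>i\<in>Basis. \<Sum>j\<in>Basis. (u t \<bullet> i) * (u t \<bullet> j) * DG (x t) x' i j
        + (u' \<bullet> i) * (u t \<bullet> j) * G (x t) i j + (u t \<bullet> i) * (u' \<bullet> j) * G (x t) i j)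
      = DG (x t) x' (u t) (u t) + 2 * G (x t) u' (u t)"
    using expand[OF bil(1)[OF q], of u' "u t"] expand[OF bil(1)[OF q], of "u t" u']
      expand[OF bil(2)[OF q], of x' "u t" "u t"] G_sym[OF q, of "u t" u']
    by (simp add: sum.distrib)
  ultimately have *: "((\<lambda>s. \<Sum>i\<in>Basis. \<Sum>j\<in>Basis. (u s \<bullet> i) * (u s \<bullet> j) * G (x s) i j) has_real_derivative
      (DG (x t) x' (u t) (u t) + 2 * G (x t) u' (u t))) (at t within J)"
    by simp
  have ev: "\<forall>\<^sub>F s in at t within J. (\<Sum>i\<in>Basis. \<Sum>j\<in>Basis. (u s \<bullet> i) * (u s \<bullet> j) * G (x s) i j) = G (x s) (u s) (u s)"
    using S by eventually_elim (rule expand[OF bil(1), symmetric])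
  show ?thesis
    unfolding has_field_derivative_def
    by (rule has_derivative_transform_eventually[OF *[unfolded has_field_derivative_def] ev])
      (use t expand[OF bil(1)[OF q], of "u t" "u t"] in auto)
qed

text \<open>With all three vectors equal, the Koszul formula gives \<open>G q (chr q v v) v\<close>
  as half of \<open>DG q v v v\<close>. This is conservation of energy along geodesics in
  infinitesimal form.\<close>

lemma chr_energy: "q \<in> S \<Longrightarrow> DG q v v v + 2 * G q (- chr q v v) v = 0"
  by (simp add: linear_neg[OF G_linear_left] G_chr)

end

section \<open>Riemannian manifolds and geodesics\<close>

text \<open>At a first exit time from \<open>W\<close> the curve would be a limit of points of the
  closed set \<open>Z\<close>, hence still in \<open>W\<close>. The first exit time exists because
  the exit times form a closed set.\<close>

lemma continuation:
  fixes \<sigma> :: "real \<Rightarrow> 'a::topological_space"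
  assumes cont: "continuous_on {a..b} \<sigma>" and W: "open W" and Z: "closed Z" "Z \<subseteq> W"
    and start: "\<sigma> a \<in> W"
    and step: "\<And>t. t \<in> {a..b} \<Longrightarrow> \<sigma> ` {a..t} \<subseteq> W \<Longrightarrow> \<sigma> t \<in> Z"
  shows "\<sigma> ` {a..b} \<subseteq> W"
proof (rule ccontr)
  assume "\<not> \<sigma> ` {a..b} \<subseteq> W"
  define N where "N = {a..b} \<inter> \<sigma> -` (- W)"
  have ne: "N \<noteq> {}" using \<open>\<not> \<sigma> ` {a..b} \<subseteq> W\<close> by (auto simp: N_def)
  have "closed N" unfolding N_def using cont W by (intro continuous_closed_preimage) auto
  moreover have bdd: "bdd_below N" unfolding N_def by (rule bdd_below_Int1) simp
  ultimately have t1: "Inf N \<in> N" using ne by (intro closed_contains_Inf)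
  define t1 where "t1 = Inf N"
  have t1: "t1 \<in> {a..b}" "\<sigma> t1 \<notin> W" using t1 by (auto simp: N_def t1_def)
  then have "a < t1" using start by (cases "a = t1") auto
  have before: "\<sigma> t \<in> W" if "t \<in> {a..<t1}" for t
  proof (rule ccontr)
    assume "\<sigma> t \<notin> W"
    then have "t \<in> N" using that t1(1) by (auto simp: N_def)
    then have "t1 \<le> t" unfolding t1_def using bdd by (rule cInf_lower)
    then show False using that by auto
  qed
  have "{a..<t1} \<subseteq> {a..b} \<inter> \<sigma> -` Z"
    using before t1(1) by (fastforce intro: step)
  then have "closure {a..<t1} \<subseteq> {a..b} \<inter> \<sigma> -` Z"
    using cont Z(1) by (intro closure_minimal continuous_closed_preimage) auto
  then show False using \<open>a < t1\<close> t1 Z(2) by (auto simp: subset_iff)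
qed

section \<open>Tangent spaces and the metric across charts\<close>

locale riemannian_manifold =
  fixes A :: "('m::{t2_space,second_countable_topology}, 'e::euclidean_space) chart set"
    and g :: "('m, 'e) metric"
  assumes atlas: "smooth_atlas A" and metric: "riemannian_metric A g"
begin

abbreviation img :: "('m, 'e) chart \<Rightarrow> 'e set" where
  "img c \<equiv> chart_map c ` chart_dom c"

lemma chart_cover: obtains c where "c \<in> A" "p \<in> chart_dom c"
  using atlas unfolding smooth_atlas_def by (metis UNIV_I UN_E)

lemma
  assumes "c \<in> A"
  shows open_dom: "open (chart_dom c)" and open_img: "open (img c)"
    and chart_homeo: "homeomorphism (chart_dom c) (img c) (chart_map c) (chart_inv c)"
  using atlas assms unfolding smooth_atlas_def by blast+

lemma chart_inv_map [simp]: "c \<in> A \<Longrightarrow> p \<in> chart_dom c \<Longrightarrow> chart_inv c (chart_map c p) = p"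
  using chart_homeo by (auto simp: homeomorphism_def)

lemma chart_inv_in: "c \<in> A \<Longrightarrow> q \<in> img c \<Longrightarrow> chart_inv c q \<in> chart_dom c"
  by auto

lemma chart_map_inv: "c \<in> A \<Longrightarrow> q \<in> img c \<Longrightarrow> chart_map c (chart_inv c q) = q"
  by auto

lemma continuous_chart: "c \<in> A \<Longrightarrow> continuous_on (chart_dom c) (chart_map c)"
  and continuous_chart_inv: "c \<in> A \<Longrightarrow> continuous_on (img c) (chart_inv c)"
  using chart_homeo by (auto simp: homeomorphism_def)

lemma tendsto_chart:
  "c \<in> A \<Longrightarrow> p \<in> chart_dom c \<Longrightarrow> (P \<longlongrightarrow> p) F \<Longrightarrow> ((\<lambda>i. chart_map c (P i)) \<longlongrightarrow> chart_map c p) F"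
  using continuous_chart open_dom by (metis continuous_on_eq_continuous_at isCont_tendsto_compose)

lemma tendsto_chart_inv:
  "c \<in> A \<Longrightarrow> q \<in> img c \<Longrightarrow> (P \<longlongrightarrow> q) F \<Longrightarrow> ((\<lambda>i. chart_inv c (P i)) \<longlongrightarrow> chart_inv c q) F"
  using continuous_chart_inv open_img by (metis continuous_on_eq_continuous_at isCont_tendsto_compose)

lemma eventually_in_dom:
  "c \<in> A \<Longrightarrow> p \<in> chart_dom c \<Longrightarrow> (P \<longlongrightarrow> p) F \<Longrightarrow> \<forall>\<^sub>F i in F. P i \<in> chart_dom c"
  using open_dom by (metis topological_tendstoD)

definition overlap :: "('m, 'e) chart \<Rightarrow> ('m, 'e) chart \<Rightarrow> 'e set" where
  "overlap c d = chart_map c ` (chart_dom c \<inter> chart_dom d)"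

lemma open_overlap: "c \<in> A \<Longrightarrow> d \<in> A \<Longrightarrow> open (overlap c d)"
proof -
  assume cd: "c \<in> A" "d \<in> A"
  have "overlap c d = img c \<inter> chart_inv c -` chart_dom d"
    unfolding overlap_def using cd by auto
  then show ?thesis
    using continuous_open_preimage[OF continuous_chart_inv open_img open_dom] cd by simp
qed

lemma transition_smooth: "c \<in> A \<Longrightarrow> d \<in> A \<Longrightarrow> Ck_on k (overlap c d) (chart_map d \<circ> chart_inv c)"
  using atlas unfolding smooth_atlas_def smooth_on_def overlap_def by blast

definition dtrans :: "('m, 'e) chart \<Rightarrow> ('m, 'e) chart \<Rightarrow> 'm \<Rightarrow> 'e \<Rightarrow> 'e" where
  "dtrans c d p = frechet_derivative (chart_map d \<circ> chart_inv c) (at (chart_map c p))"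

lemma dtrans_has_derivative:
  assumes "c \<in> A" "d \<in> A" "p \<in> chart_dom c" "p \<in> chart_dom d"
  shows "((chart_map d \<circ> chart_inv c) has_derivative dtrans c d p) (at (chart_map c p))"
  unfolding dtrans_def
  using assms by (intro Ck_on_Suc_has_derivative[OF transition_smooth[of c d "Suc 0"]]) (auto simp: overlap_def)

lemma dtrans_linear:
  assumes "c \<in> A" "d \<in> A" "p \<in> chart_dom c" "p \<in> chart_dom d"
  shows "linear (dtrans c d p)"
  using dtrans_has_derivative[OF assms] by (rule has_derivative_linear)

text \<open>The chain rule for transition maps. This cocycle identity is what makes
  \<open>coord_vec\<close> a tangent vector.\<close>

lemma dtrans_trans:
  assumes "c \<in> A" "d \<in> A" "e \<in> A" "p \<in> chart_dom c" "p \<in> chart_dom d" "p \<in> chart_dom e"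
  shows "dtrans d e p (dtrans c d p x) = dtrans c e p x"
proof -
  have "((\<lambda>q. (chart_map e \<circ> chart_inv d) ((chart_map d \<circ> chart_inv c) q)) has_derivative
      (\<lambda>x. dtrans d e p (dtrans c d p x))) (at (chart_map c p))"
    using dtrans_has_derivative[of d e p] assms
    by (intro has_derivative_compose[OF dtrans_has_derivative]) (auto simp: o_def)
  then have "((chart_map e \<circ> chart_inv c) has_derivative
      (\<lambda>x. dtrans d e p (dtrans c d p x))) (at (chart_map c p))"
  proof (rule has_derivative_transform_within_open[OF _ open_overlap[of c d]])
    show "chart_map c p \<in> overlap c d" using assms by (auto simp: overlap_def)
  qed (use assms in \<open>auto simp: overlap_def\<close>)
  then show ?thesis
    using dtrans_has_derivative[OF assms(1,3,4,6)] by (metis has_derivative_unique)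
qed

lemma dtrans_refl: "c \<in> A \<Longrightarrow> p \<in> chart_dom c \<Longrightarrow> dtrans c c p x = x"
proof -
  assume c: "c \<in> A" "p \<in> chart_dom c"
  have "((chart_map c \<circ> chart_inv c) has_derivative (\<lambda>x. x)) (at (chart_map c p))"
    by (rule has_derivative_transform_within_open[OF has_derivative_ident open_img])
      (use c in auto)
  then show ?thesis
    using dtrans_has_derivative[OF c(1,1,2,2)] by (metis has_derivative_unique)
qed

lemma coord_vec_eq: "coord_vec A c p x d = (if d \<in> A \<and> p \<in> chart_dom d then dtrans c d p x else 0)"
  by (simp add: coord_vec_def dtrans_def)

lemma tangent_space_iff: "v \<in> tangent_space A p \<longleftrightarrow>
    (\<forall>c. c \<notin> A \<or> p \<notin> chart_dom c \<longrightarrow> v c = 0) \<and>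
    (\<forall>c\<in>A. \<forall>d\<in>A. p \<in> chart_dom c \<longrightarrow> p \<in> chart_dom d \<longrightarrow> v d = dtrans c d p (v c))"
  by (auto simp: tangent_space_def dtrans_def)

lemma tangent_spaceD:
  "v \<in> tangent_space A p \<Longrightarrow> c \<in> A \<Longrightarrow> d \<in> A \<Longrightarrow> p \<in> chart_dom c \<Longrightarrow> p \<in> chart_dom d \<Longrightarrow>
    v d = dtrans c d p (v c)"
  unfolding tangent_space_iff by blast

lemma coord_vec_tangent: "c \<in> A \<Longrightarrow> p \<in> chart_dom c \<Longrightarrow> coord_vec A c p x \<in> tangent_space A p"
  unfolding tangent_space_iff
proof (intro conjI allI ballI impI)
  fix d e assume *: "c \<in> A" "p \<in> chart_dom c" "d \<in> A" "e \<in> A" "p \<in> chart_dom d" "p \<in> chart_dom e"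
  show "coord_vec A c p x e = dtrans d e p (coord_vec A c p x d)"
    using dtrans_trans[OF *(1,3,4,2,5,6), of x] * by (simp add: coord_vec_eq)
qed (auto simp: coord_vec_eq)

text \<open>Together with \<open>coord_vec_of\<close>, this identifies the tangent space at
  \<open>p\<close> with the model space through the chart \<open>c\<close>.\<close>

lemma coord_vec_self: "c \<in> A \<Longrightarrow> p \<in> chart_dom c \<Longrightarrow> coord_vec A c p x c = x"
  by (simp add: coord_vec_eq dtrans_refl)

lemma coord_vec_of: "c \<in> A \<Longrightarrow> p \<in> chart_dom c \<Longrightarrow> v \<in> tangent_space A p \<Longrightarrow> coord_vec A c p (v c) = v"
proof
  fix d assume *: "c \<in> A" "p \<in> chart_dom c" "v \<in> tangent_space A p"
  show "coord_vec A c p (v c) d = v d"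
  proof (cases "d \<in> A \<and> p \<in> chart_dom d")
    case True
    then show ?thesis using tangent_spaceD[of v p c d] * by (simp add: coord_vec_eq)
  next
    case False
    then have "v d = 0" using *(3) unfolding tangent_space_iff by blast
    then show ?thesis using False by (auto simp: coord_vec_eq)
  qed
qed

lemma coord_vec_add: "c \<in> A \<Longrightarrow> p \<in> chart_dom c \<Longrightarrow>
    coord_vec A c p (x + y) = tv_add (coord_vec A c p x) (coord_vec A c p y)"
  by (auto simp: coord_vec_eq tv_add_def fun_eq_iff linear_add[OF dtrans_linear])

lemma coord_vec_scale: "c \<in> A \<Longrightarrow> p \<in> chart_dom c \<Longrightarrow>
    coord_vec A c p (s *\<^sub>R x) = tv_scale s (coord_vec A c p x)"
  by (auto simp: coord_vec_eq tv_scale_def fun_eq_iff linear_scale[OF dtrans_linear])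

lemma tv_scale_tangent: "v \<in> tangent_space A p \<Longrightarrow> tv_scale s v \<in> tangent_space A p"
proof -
  assume v: "v \<in> tangent_space A p"
  obtain c where c: "c \<in> A" "p \<in> chart_dom c" by (rule chart_cover)
  show ?thesis
    using coord_vec_tangent[OF c, of "s *\<^sub>R v c"] by (simp add: coord_vec_scale c coord_vec_of v)
qed

lemma
  assumes "u \<in> tangent_space A p" "v \<in> tangent_space A p"
  shows g_sym: "g p u v = g p v u"
    and g_scale: "g p (tv_scale s u) v = s * g p u v"
    and g_add: "w \<in> tangent_space A p \<Longrightarrow> g p (tv_add u v) w = g p u w + g p v w"
  using metric assms unfolding riemannian_metric_def by blast+

lemma g_pos: "u \<in> tangent_space A p \<Longrightarrow> u \<noteq> (\<lambda>c. 0) \<Longrightarrow> g p u u > 0"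
  using metric unfolding riemannian_metric_def by blast

abbreviation G :: "('m, 'e) chart \<Rightarrow> 'e \<Rightarrow> 'e \<Rightarrow> 'e \<Rightarrow> real" where
  "G c \<equiv> local_metric A g c"

lemma coord_metric: assumes c: "c \<in> A" shows "coord_metric (img c) (G c)"
proof (rule coord_metric.intro)
  note cv = coord_vec_tangent[OF c chart_inv_in[OF c]]
  show "open (img c)" by (rule open_img[OF c])
  fix q a b
  show "Ck_on 2 (img c) (\<lambda>q. G c q a b)"
    using metric c unfolding riemannian_metric_def smooth_on_def by blast
  assume q: "q \<in> img c"
  show "G c q a b = G c q b a" unfolding local_metric_def by (rule g_sym[OF cv cv]; fact q)
  have p: "chart_inv c q \<in> chart_dom c" using q c by auto
  show lin: "linear (\<lambda>a. G c q a b)" for b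
  proof (rule linearI)
    show "G c q (a + a') b = G c q a b + G c q a' b" for a a'
      by (simp add: local_metric_def coord_vec_add[OF c p] g_add[OF cv[OF q] cv[OF q] cv[OF q]])
    show "G c q (s *\<^sub>R a) b = s *\<^sub>R G c q a b" for s a
      by (simp add: local_metric_def coord_vec_scale[OF c p] g_scale[OF cv[OF q] cv[OF q]])
  qed
  show "G c q a a > 0" if "a \<noteq> 0"
  proof -
    have "coord_vec A c (chart_inv c q) a \<noteq> (\<lambda>c. 0)"
      using coord_vec_self[OF c p, of a] that by metis
    then show ?thesis unfolding local_metric_def using cv[OF q] by (intro g_pos)
  qed
qed

lemma g_local:
  assumes "c \<in> A" "p \<in> chart_dom c" "u \<in> tangent_space A p" "v \<in> tangent_space A p"
  shows "g p u v = G c (chart_map c p) (u c) (v c)"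
  using assms by (simp add: local_metric_def coord_vec_of)

lemma g_nonneg: assumes "u \<in> tangent_space A p" shows "g p u u \<ge> 0"
proof (cases "u = (\<lambda>c. 0)")
  case True
  have "g p (tv_scale 0 u) u = 0" using g_scale[OF assms assms, of 0] by simp
  then show ?thesis using True by (simp add: tv_scale_def)
qed (use g_pos[OF assms] in auto)

lemma tv_norm_square: "u \<in> tangent_space A p \<Longrightarrow> (tv_norm g p u)\<^sup>2 = g p u u"
  by (simp add: tv_norm_def g_nonneg)

lemma g_scale2:
  assumes "u \<in> tangent_space A p"
  shows "g p (tv_scale s u) (tv_scale s u) = s\<^sup>2 * g p u u"
  using assms g_scale[OF assms tv_scale_tangent[OF assms]] g_sym[OF assms tv_scale_tangent[OF assms]]
    g_scale[OF assms assms] by (simp add: power2_eq_square)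

lemma tv_norm_scale: "u \<in> tangent_space A p \<Longrightarrow> tv_norm g p (tv_scale s u) = \<bar>s\<bar> * tv_norm g p u"
  by (simp add: tv_norm_def g_scale2 real_sqrt_mult)

lemma g_cauchy_schwarz:
  assumes u: "u \<in> tangent_space A p" and v: "v \<in> tangent_space A p"
  shows "\<bar>g p u v\<bar> \<le> tv_norm g p u * tv_norm g p v"
proof -
  have "(g p u v)\<^sup>2 \<le> g p u u * g p v v"
  proof (cases "g p v v = 0")
    case True
    then have "v = (\<lambda>c. 0)" using g_pos[OF v] by force
    then have "tv_scale 0 v = v" by (simp add: tv_scale_def)
    then have "g p u v = 0" using g_scale[OF v u, of 0] g_sym[OF u v] by simp
    then show ?thesis using True by simp
  next
    case False
    then have pos: "g p v v > 0" using g_nonneg[OF v] by simp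
    \<comment> \<open>The minimiser of the quadratic polynomial obtained by evaluating
      \<open>g p\<close> on the diagonal at \<open>u\<close> plus \<open>s\<close> times
      \<open>v\<close>.\<close>
    define s where "s = - (g p u v / g p v v)"
    define w where "w = tv_scale s v"
    have w: "w \<in> tangent_space A p" using v by (simp add: w_def tv_scale_tangent)
    obtain c where c: "c \<in> A" "p \<in> chart_dom c" by (rule chart_cover)
    have uw: "tv_add u w \<in> tangent_space A p"
      using coord_vec_tangent[OF c, of "u c + w c"] by (simp add: coord_vec_add c coord_vec_of u w)
    have "0 \<le> g p (tv_add u w) (tv_add u w)" by (rule g_nonneg[OF uw])
    also have "\<dots> = g p u u + 2 * s * g p u v + s\<^sup>2 * g p v v"
      using g_add[OF u w uw] g_sym[OF u uw] g_sym[OF w uw] g_add[OF u w u] g_add[OF u w w]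
        g_sym[OF w u] g_scale[OF v u, of s] g_sym[OF v u] g_scale2[OF v, of s]
      by (simp add: w_def)
    also have "\<dots> = g p u u - (g p u v)\<^sup>2 / g p v v"
      using pos by (simp add: s_def power2_eq_square field_simps)
    finally show ?thesis using pos by (simp add: field_simps)
  qed
  then have "sqrt ((g p u v)\<^sup>2) \<le> sqrt (g p u u * g p v v)" by (rule real_sqrt_le_mono)
  then show ?thesis by (simp add: tv_norm_def real_sqrt_mult)
qed

section \<open>Geodesics: reparametrisation, gluing and constancy of the speed\<close>

abbreviation chr :: "('m, 'e) chart \<Rightarrow> 'e \<Rightarrow> 'e \<Rightarrow> 'e \<Rightarrow> 'e" where
  "chr c \<equiv> coord_metric.chr (G c)"

lemma christoffel_eq: "c \<in> A \<Longrightarrow> christoffel A g c q x y = chr c q x y"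
  by (simp add: christoffel_def coord_metric.chr_def[OF coord_metric] coord_metric.DG_def[OF coord_metric])

text \<open>
  Geodesics with an explicit velocity field, which spares the one-sided derivatives hidden in
  \<open>velocity\<close> when restricting, reparametrising and joining them.
\<close>

definition geod :: "real \<Rightarrow> real \<Rightarrow> (real \<Rightarrow> 'm) \<Rightarrow> (real \<Rightarrow> ('m, 'e) tvec) \<Rightarrow> bool" where
  "geod a b \<sigma> V \<longleftrightarrow> continuous_on {a..b} \<sigma> \<and>
     (\<forall>t\<in>{a..b}. \<forall>c. c \<notin> A \<or> \<sigma> t \<notin> chart_dom c \<longrightarrow> V t c = 0) \<and>
     (\<forall>t\<in>{a..b}. \<forall>c\<in>A. \<sigma> t \<in> chart_dom c \<longrightarrow>
        ((chart_map c \<circ> \<sigma>) has_vector_derivative V t c) (at t within {a..b}) \<and>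
        ((\<lambda>s. V s c) has_vector_derivative - chr c (chart_map c (\<sigma> t)) (V t c) (V t c)) (at t within {a..b}))"

lemma
  assumes "geod a b \<sigma> V"
  shows geod_continuous_on: "continuous_on {a..b} \<sigma>"
    and geod_zero: "t \<in> {a..b} \<Longrightarrow> c \<notin> A \<or> \<sigma> t \<notin> chart_dom c \<Longrightarrow> V t c = 0"
    and geod_deriv: "t \<in> {a..b} \<Longrightarrow> c \<in> A \<Longrightarrow> \<sigma> t \<in> chart_dom c \<Longrightarrow>
      ((chart_map c \<circ> \<sigma>) has_vector_derivative V t c) (at t within {a..b})"
    and geod_deriv2: "t \<in> {a..b} \<Longrightarrow> c \<in> A \<Longrightarrow> \<sigma> t \<in> chart_dom c \<Longrightarrow>
      ((\<lambda>s. V s c) has_vector_derivative - chr c (chart_map c (\<sigma> t)) (V t c) (V t c)) (at t within {a..b})"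
  using assms unfolding geod_def by blast+

lemma geodI:
  assumes "continuous_on {a..b} \<sigma>"
    "\<And>t c. t \<in> {a..b} \<Longrightarrow> c \<notin> A \<or> \<sigma> t \<notin> chart_dom c \<Longrightarrow> V t c = 0"
    "\<And>t c. t \<in> {a..b} \<Longrightarrow> c \<in> A \<Longrightarrow> \<sigma> t \<in> chart_dom c \<Longrightarrow>
      ((chart_map c \<circ> \<sigma>) has_vector_derivative V t c) (at t within {a..b})"
    "\<And>t c. t \<in> {a..b} \<Longrightarrow> c \<in> A \<Longrightarrow> \<sigma> t \<in> chart_dom c \<Longrightarrow>
      ((\<lambda>s. V s c) has_vector_derivative - chr c (chart_map c (\<sigma> t)) (V t c) (V t c)) (at t within {a..b})"
  shows "geod a b \<sigma> V"
  unfolding geod_def using assms by blast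

lemma geodesic_on_imp_geod:
  "geodesic_on A g {a..b} \<sigma> \<Longrightarrow> geod a b \<sigma> (velocity A {a..b} \<sigma>)"
  unfolding geodesic_on_def
  by (intro geodI) (auto simp: velocity_def christoffel_eq)

lemma geod_velocity:
  assumes "geod a b \<sigma> V" "a < b" "t \<in> {a..b}"
  shows "velocity A {a..b} \<sigma> t = V t"
proof
  fix c
  show "velocity A {a..b} \<sigma> t c = V t c"
  proof (cases "c \<in> A \<and> \<sigma> t \<in> chart_dom c")
    case True
    then show ?thesis
      using vector_derivative_within_closed_interval[OF assms(2,3) geod_deriv[OF assms(1,3)]]
      by (simp add: velocity_def)
  next
    case False
    then show ?thesis using geod_zero[OF assms(1,3), of c] by (auto simp: velocity_def)
  qed
qed

lemma geod_imp_geodesic_on: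
  assumes "geod a b \<sigma> V" "a < b"
  shows "geodesic_on A g {a..b} \<sigma>"
  unfolding geodesic_on_def
proof (intro conjI ballI impI)
  show "continuous_on {a..b} \<sigma>" by (rule geod_continuous_on[OF assms(1)])
  fix t c assume *: "t \<in> {a..b}" "c \<in> A" "\<sigma> t \<in> chart_dom c"
  show "((chart_map c \<circ> \<sigma>) has_vector_derivative velocity A {a..b} \<sigma> t c) (at t within {a..b})"
    using geod_deriv[OF assms(1) *] geod_velocity[OF assms *(1)] by simp
  show "((\<lambda>s. velocity A {a..b} \<sigma> s c) has_vector_derivative
      - christoffel A g c (chart_map c (\<sigma> t)) (velocity A {a..b} \<sigma> t c) (velocity A {a..b} \<sigma> t c))
      (at t within {a..b})"
    unfolding geod_velocity[OF assms *(1)] christoffel_eq[OF *(2)]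
    by (rule has_vector_derivative_transform[OF *(1) _ geod_deriv2[OF assms(1) *]])
      (simp add: geod_velocity[OF assms])
qed

lemma geod_eventually_in_dom:
  assumes "geod a b \<sigma> V" "t \<in> {a..b}" "c \<in> A" "\<sigma> t \<in> chart_dom c"
  shows "\<forall>\<^sub>F s in at t within {a..b}. \<sigma> s \<in> chart_dom c"
  using geod_continuous_on[OF assms(1)] assms(2-4)
  by (intro eventually_in_dom) (auto simp: continuous_on_def)

text \<open>The chain rule through the transition map relates the velocities in two charts.
  One-sided derivatives are unique because the interval is nondegenerate.\<close>

lemma geod_tangent:
  assumes "geod a b \<sigma> V" "a < b" "t \<in> {a..b}"
  shows "V t \<in> tangent_space A (\<sigma> t)"
  unfolding tangent_space_iff
proof (intro conjI allI ballI impI)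
  show "V t c = 0" if "c \<notin> A \<or> \<sigma> t \<notin> chart_dom c" for c
    using geod_zero[OF assms(1,3) that] .
  fix c d assume *: "c \<in> A" "d \<in> A" "\<sigma> t \<in> chart_dom c" "\<sigma> t \<in> chart_dom d"
  have "((chart_map c \<circ> \<sigma>) has_derivative (\<lambda>h. h *\<^sub>R V t c)) (at t within {a..b})"
    using geod_deriv[OF assms(1,3) *(1,3)] by (simp add: has_vector_derivative_def)
  then have "((\<lambda>s. (chart_map d \<circ> chart_inv c) ((chart_map c \<circ> \<sigma>) s)) has_derivative
      (\<lambda>h. dtrans c d (\<sigma> t) (h *\<^sub>R V t c))) (at t within {a..b})"
    by (rule has_derivative_in_compose)
      (use dtrans_has_derivative[OF *] in \<open>simp add: o_def has_derivative_at_withinI\<close>)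
  then have "((chart_map d \<circ> \<sigma>) has_derivative (\<lambda>h. dtrans c d (\<sigma> t) (h *\<^sub>R V t c))) (at t within {a..b})"
  proof (rule has_derivative_transform_eventually)
    show "\<forall>\<^sub>F s in at t within {a..b}. (chart_map d \<circ> chart_inv c) ((chart_map c \<circ> \<sigma>) s) = (chart_map d \<circ> \<sigma>) s"
      using geod_eventually_in_dom[OF assms(1,3) *(1,3)] by eventually_elim (use * in auto)
  qed (use * assms in auto)
  then have "((chart_map d \<circ> \<sigma>) has_vector_derivative dtrans c d (\<sigma> t) (V t c)) (at t within {a..b})"
    by (simp add: has_vector_derivative_def linear_scale[OF dtrans_linear[OF *]])
  then have "vector_derivative (chart_map d \<circ> \<sigma>) (at t within {a..b}) = dtrans c d (\<sigma> t) (V t c)"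
    by (rule vector_derivative_within_closed_interval[OF assms(2,3)])
  moreover have "vector_derivative (chart_map d \<circ> \<sigma>) (at t within {a..b}) = V t d"
    by (rule vector_derivative_within_closed_interval[OF assms(2,3) geod_deriv[OF assms(1,3) *(2,4)]])
  ultimately show "V t d = dtrans c d (\<sigma> t) (V t c)" by simp
qed

text \<open>The velocity acquires the factor \<open>s\<close> and the acceleration the factor
  \<open>s\<^sup>2\<close>, in accordance with the homogeneity of the Christoffel symbols.\<close>

lemma geod_affine:
  assumes "geod a b \<sigma> V" "\<And>t. t \<in> {a'..b'} \<Longrightarrow> s * t + r \<in> {a..b}"
  shows "geod a' b' (\<lambda>t. \<sigma> (s * t + r)) (\<lambda>t. tv_scale s (V (s * t + r)))"
proof (rule geodI)
  let ?h = "\<lambda>t. s * t + r"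
  have img: "?h ` {a'..b'} \<subseteq> {a..b}" using assms(2) by auto
  show "continuous_on {a'..b'} (\<lambda>t. \<sigma> (?h t))"
    by (rule continuous_on_compose2[OF geod_continuous_on[OF assms(1)] _ img]) (intro continuous_intros)
  fix t c assume t: "t \<in> {a'..b'}"
  show "tv_scale s (V (?h t)) c = 0" if "c \<notin> A \<or> \<sigma> (?h t) \<notin> chart_dom c"
    using geod_zero[OF assms(1) assms(2)[OF t] that] by (simp add: tv_scale_def)
  assume c: "c \<in> A" "\<sigma> (?h t) \<in> chart_dom c"
  have h: "(?h has_vector_derivative s) (at t within {a'..b'})"
    unfolding has_vector_derivative_def by (auto intro!: derivative_eq_intros)
  have D: "((\<lambda>t. f (?h t)) has_vector_derivative s *\<^sub>R f') (at t within {a'..b'})"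
    if "(f has_vector_derivative f') (at (?h t) within {a..b})" for f :: "real \<Rightarrow> 'e" and f'
    using vector_diff_chain_within[OF h has_vector_derivative_within_subset[OF that img]]
    by (simp add: o_def)
  show "((chart_map c \<circ> (\<lambda>t. \<sigma> (?h t))) has_vector_derivative tv_scale s (V (?h t)) c) (at t within {a'..b'})"
    using D[OF geod_deriv[OF assms(1) assms(2)[OF t] c]] by (simp add: o_def tv_scale_def)
  have "chart_map c (\<sigma> (?h t)) \<in> img c" using c by auto
  note chr_scale = coord_metric.chr_scale[OF coord_metric[OF c(1)] this]
  have "((\<lambda>t. s *\<^sub>R V (?h t) c) has_vector_derivative
      s *\<^sub>R s *\<^sub>R - chr c (chart_map c (\<sigma> (?h t))) (V (?h t) c) (V (?h t) c)) (at t within {a'..b'})"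
    using D[OF geod_deriv2[OF assms(1) assms(2)[OF t] c]]
    by (rule bounded_linear.has_vector_derivative[OF bounded_linear_scaleR_right])
  then show "((\<lambda>t. tv_scale s (V (?h t)) c) has_vector_derivative
      - chr c (chart_map c (\<sigma> (?h t))) (tv_scale s (V (?h t)) c) (tv_scale s (V (?h t)) c)) (at t within {a'..b'})"
    by (simp add: tv_scale_def chr_scale power2_eq_square)
qed

lemma geod_subset: "geod a b \<sigma> V \<Longrightarrow> a \<le> a' \<Longrightarrow> b' \<le> b \<Longrightarrow> geod a' b' \<sigma> V"
  using geod_affine[of a b \<sigma> V a' b' 1 0] by (simp add: tv_scale_def)

text \<open>Equal positions and velocities at \<open>b\<close> imply equal accelerations by the
  geodesic equation, so the one-sided derivatives of the position and of the velocity both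
  glue.\<close>

lemma geod_join:
  assumes 1: "geod a b \<sigma> V" and 2: "geod b c \<tau> W" and le: "a < b" "b < c"
    and eq: "\<sigma> b = \<tau> b" "V b = W b"
  shows "geod a c (\<lambda>t. if t \<in> {a..b} then \<sigma> t else \<tau> t) (\<lambda>t. if t \<in> {a..b} then V t else W t)"
    (is "geod a c ?\<sigma> ?V")
proof (rule geodI)
  have un: "{a..c} = {a..b} \<union> {b..c}" and int: "{a..b} \<inter> {b..c} = {b}"
    using le by auto
  have join: "((\<lambda>s. if s \<in> {a..b} then f s else h s) has_vector_derivative
      (if t \<in> {a..b} then f' t else h' t)) (at t within {a..c})"
    if "t \<in> {a..c}"
      and "t \<in> {a..b} \<Longrightarrow> (f has_vector_derivative f' t) (at t within {a..b})"
      and "t \<in> {b..c} \<Longrightarrow> (h has_vector_derivative h' t) (at t within {b..c})"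
      and "f b = h b" "t = b \<Longrightarrow> f' b = h' b" for t f h and f' h' :: "real \<Rightarrow> 'e"
    by (rule has_vector_derivative_If_within_closures[OF _ un])
      (use that le in \<open>auto simp: un int insert_absorb\<close>)
  show "continuous_on {a..c} ?\<sigma>"
    unfolding un
    by (rule continuous_on_If) (use geod_continuous_on[OF 1] geod_continuous_on[OF 2] eq le in auto)
  fix t d assume t: "t \<in> {a..c}"
  show "?V t d = 0" if "d \<notin> A \<or> ?\<sigma> t \<notin> chart_dom d"
    using that t geod_zero[OF 1, of t d] geod_zero[OF 2, of t d] by (auto split: if_splits)
  assume d: "d \<in> A" "?\<sigma> t \<in> chart_dom d"
  have d1: "\<sigma> t \<in> chart_dom d" if "t \<in> {a..b}" using d that by simp
  have d2: "\<tau> t \<in> chart_dom d" if "t \<in> {b..c}" using d that eq le by (cases "t = b") auto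
  have "((\<lambda>s. if s \<in> {a..b} then chart_map d (\<sigma> s) else chart_map d (\<tau> s)) has_vector_derivative
      (if t \<in> {a..b} then V t d else W t d)) (at t within {a..c})"
    using geod_deriv[OF 1 _ d(1) d1] geod_deriv[OF 2 _ d(1) d2] eq t by (intro join) (auto simp: o_def)
  then show "((chart_map d \<circ> ?\<sigma>) has_vector_derivative ?V t d) (at t within {a..c})"
    by (simp add: o_def if_distrib[of "chart_map d"] if_distribR cong: if_cong)
  have "((\<lambda>s. if s \<in> {a..b} then V s d else W s d) has_vector_derivative
      (if t \<in> {a..b} then - chr d (chart_map d (\<sigma> t)) (V t d) (V t d)
       else - chr d (chart_map d (\<tau> t)) (W t d) (W t d))) (at t within {a..c})"
    using geod_deriv2[OF 1 _ d(1) d1] geod_deriv2[OF 2 _ d(1) d2] eq t by (intro join) auto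
  then show "((\<lambda>s. ?V s d) has_vector_derivative - chr d (chart_map d (?\<sigma> t)) (?V t d) (?V t d))
      (at t within {a..c})"
    by (cases "t \<in> {a..b}") (simp_all add: if_distribR del: atLeastAtMost_iff)
qed

text \<open>In a chart around each point of the curve, the product rule and
  \<open>chr_energy\<close> make the derivative of the squared speed vanish.\<close>

lemma geod_speed:
  assumes "geod a b \<sigma> V" "a < b" "t \<in> {a..b}"
  shows "g (\<sigma> t) (V t) (V t) = g (\<sigma> a) (V a) (V a)"
proof -
  have "((\<lambda>s. g (\<sigma> s) (V s) (V s)) has_field_derivative 0) (at t within {a..b})" if t: "t \<in> {a..b}" for t
  proof -
    obtain c where c: "c \<in> A" "\<sigma> t \<in> chart_dom c" by (rule chart_cover)
    interpret C: coord_metric "img c" "G c" by (rule coord_metric[OF c(1)])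
    note ev = geod_eventually_in_dom[OF assms(1) t c]
    let ?x = "chart_map c \<circ> \<sigma>"
    have "((\<lambda>s. G c (?x s) (V s c) (V s c)) has_real_derivative
       (C.DG (?x t) (V t c) (V t c) (V t c) + 2 * G c (?x t) (- C.chr (?x t) (V t c) (V t c)) (V t c)))
       (at t within {a..b})"
    proof (rule C.G_curve_derivative)
      show "\<forall>\<^sub>F s in at t within {a..b}. ?x s \<in> img c"
        using ev by eventually_elim auto
      show "(?x has_vector_derivative V t c) (at t within {a..b})"
        by (rule geod_deriv[OF assms(1) t c])
    qed (use geod_deriv2[OF assms(1) t c] t c in auto)
    moreover have "?x t \<in> img c" using c by auto
    ultimately have "((\<lambda>s. G c (?x s) (V s c) (V s c)) has_real_derivative 0) (at t within {a..b})"
      using C.chr_energy by simp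
    then show ?thesis
      unfolding has_field_derivative_def
    proof (rule has_derivative_transform_eventually)
      have *: "G c (?x s) (V s c) (V s c) = g (\<sigma> s) (V s) (V s)"
        if "\<sigma> s \<in> chart_dom c" "s \<in> {a..b}" for s
        using g_local[OF c(1) that(1)] geod_tangent[OF assms(1,2) that(2)] by simp
      show "G c (?x t) (V t c) (V t c) = g (\<sigma> t) (V t) (V t)" using * c t by blast
      show "\<forall>\<^sub>F s in at t within {a..b}. G c (?x s) (V s c) (V s c) = g (\<sigma> s) (V s) (V s)"
        using ev unfolding eventually_at_filter by (rule eventually_mono) (use * in simp)
    qed (rule t)
  qed
  then have "\<exists>k. \<forall>t\<in>{a..b}. g (\<sigma> t) (V t) (V t) = k"
    by (intro has_field_derivative_zero_constant) auto
  then show ?thesis using assms by auto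
qed

text \<open>Constancy of the speed bounds the coordinate velocity as long as the curve stays in the chart ball.\<close>

lemma geod_trapped:
  assumes c: "c \<in> A" and r: "cball x0 (2 * r) \<subseteq> img c"
    and l: "l > 0" "\<And>q u. q \<in> cball x0 (2 * r) \<Longrightarrow> l * (norm u)\<^sup>2 \<le> G c q u u"
    and geod: "geod a b \<sigma> V" "a < b"
    and start: "\<sigma> a \<in> chart_dom c" "dist x0 (chart_map c (\<sigma> a)) < r"
    and \<rho>: "\<rho> \<ge> 0" "g (\<sigma> a) (V a) (V a) \<le> l * \<rho>\<^sup>2" "\<rho> * (b - a) < r"
    and t: "t \<in> {a..b}"
  shows "\<sigma> t \<in> chart_dom c" "chart_map c (\<sigma> t) \<in> cball x0 (2 * r)" "norm (V t c) \<le> \<rho>"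
proof -
  define W where "W = chart_dom c \<inter> chart_map c -` ball x0 (2 * r)"
  \<comment> \<open>The largest distance from \<open>x0\<close> that can be reached at coordinate
    speed \<open>\<rho>\<close>; it is below \<open>2 * r\<close> as both summands are below
    \<open>r\<close>.\<close>
  define r' where "r' = dist x0 (chart_map c (\<sigma> a)) + \<rho> * (b - a)"
  have r': "r' < 2 * r" using start \<rho> by (simp add: r'_def)
  define Z where "Z = chart_inv c ` cball x0 r'"
  have cb: "cball x0 r' \<subseteq> ball x0 (2 * r)" "ball x0 (2 * r) \<subseteq> cball x0 (2 * r)" using r' by auto
  have "r > 0" using start(2) by (rule le_less_trans[OF zero_le_dist])
  have V: "norm (V t c) \<le> \<rho>" if "t \<in> {a..b}" "\<sigma> t \<in> W" for t
  proof -
    have *: "\<sigma> t \<in> chart_dom c" "chart_map c (\<sigma> t) \<in> cball x0 (2 * r)" using that by (auto simp: W_def)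
    have "l * (norm (V t c))\<^sup>2 \<le> g (\<sigma> t) (V t) (V t)"
      using l(2)[OF *(2), of "V t c"] g_local[OF c *(1)] geod_tangent[OF geod that(1)] by simp
    also have "\<dots> \<le> l * \<rho>\<^sup>2" using geod_speed[OF geod that(1)] \<rho>(2) by simp
    finally have "(norm (V t c))\<^sup>2 \<le> \<rho>\<^sup>2" using l(1) by simp
    then show ?thesis using \<rho>(1) by (rule power2_le_imp_le)
  qed
  have "\<sigma> ` {a..b} \<subseteq> W"
  proof (rule continuation[OF geod_continuous_on[OF geod(1)]])
    show "open W" unfolding W_def
      by (rule continuous_open_preimage[OF continuous_chart[OF c] open_dom[OF c]]) simp
    have "cball x0 r' \<subseteq> img c" using cb r by blast
    \<comment> \<open>Closedness is needed in the manifold and not only in the chart domain; it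
      follows from compactness in a Hausdorff space.\<close>
    then have "compact Z" unfolding Z_def
      by (intro compact_continuous_image continuous_on_subset[OF continuous_chart_inv[OF c]] compact_cball)
    then show "closed Z" by (rule compact_imp_closed)
    show "Z \<subseteq> W"
      unfolding Z_def W_def using cb r chart_inv_in[OF c] chart_map_inv[OF c] by (auto simp: subset_iff)
    show "\<sigma> a \<in> W" using start \<open>r > 0\<close> by (auto simp: W_def)
    fix t assume t: "t \<in> {a..b}" "\<sigma> ` {a..t} \<subseteq> W"
    have sub: "{a..t} \<subseteq> {a..b}" using t by auto
    have "norm ((chart_map c \<circ> \<sigma>) t - (chart_map c \<circ> \<sigma>) a) \<le> \<rho> * (t - a)"
    proof (rule vector_derivative_bound)
      fix s assume s: "s \<in> {a..t}"
      then have s': "s \<in> {a..b}" "\<sigma> s \<in> W" using t by auto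
      then have s': "s \<in> {a..b}" "\<sigma> s \<in> W" "\<sigma> s \<in> chart_dom c" by (auto simp: W_def)
      show "(chart_map c \<circ> \<sigma> has_vector_derivative V s c) (at s within {a..t})"
        using geod_deriv[OF geod(1) s'(1) c s'(3)] sub by (rule has_vector_derivative_within_subset)
      show "norm (V s c) \<le> \<rho>" by (rule V[OF s'(1,2)])
    qed (use t in auto)
    also have "\<dots> \<le> \<rho> * (b - a)" using t \<rho>(1) by (intro mult_left_mono) auto
    finally have "dist (chart_map c (\<sigma> t)) (chart_map c (\<sigma> a)) \<le> \<rho> * (b - a)" by (simp add: dist_norm)
    then have "chart_map c (\<sigma> t) \<in> cball x0 r'"
      using dist_triangle2[of x0 "chart_map c (\<sigma> t)" "chart_map c (\<sigma> a)"]
      by (simp add: r'_def)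
    moreover have "\<sigma> t \<in> chart_dom c" using t by (auto simp: W_def)
    ultimately show "\<sigma> t \<in> Z" unfolding Z_def by (metis chart_inv_map[OF c] imageI)
  qed
  then have "\<sigma> t \<in> W" using t by auto
  then show "\<sigma> t \<in> chart_dom c" "chart_map c (\<sigma> t) \<in> cball x0 (2 * r)" "norm (V t c) \<le> \<rho>"
    using V[OF t] by (auto simp: W_def)
qed

section \<open>Dependence of geodesics on their initial data\<close>

lemma chart_ball:
  assumes "c \<in> A" "p \<in> chart_dom c"
  obtains r where "r > 0" "cball (chart_map c p) (2 * r) \<subseteq> img c"
proof -
  have "chart_map c p \<in> img c" using assms by auto
  then obtain e where "e > 0" "cball (chart_map c p) e \<subseteq> img c"
    using open_img[OF assms(1)] open_contains_cball by blast
  then show thesis by (intro that[of "e / 2"]) auto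
qed

text \<open>Convergence in the tangent bundle, whose topology is not constructed.\<close>

definition tconv :: "('i \<Rightarrow> 'm) \<Rightarrow> ('i \<Rightarrow> ('m, 'e) tvec) \<Rightarrow> 'm \<Rightarrow> ('m, 'e) tvec \<Rightarrow> 'i filter \<Rightarrow> bool" where
  "tconv P U p v F \<longleftrightarrow> (P \<longlongrightarrow> p) F \<and> (\<forall>c\<in>A. p \<in> chart_dom c \<longrightarrow> ((\<lambda>i. U i c) \<longlongrightarrow> v c) F)"

text \<open>Convergence of the coordinates in one chart suffices: the derivatives of the transition
  maps depend continuously on the point and carry it to the other charts.\<close>

lemma tconvI:
  assumes c: "c \<in> A" "p \<in> chart_dom c" and P: "(P \<longlongrightarrow> p) F" and U: "((\<lambda>i. U i c) \<longlongrightarrow> v c) F"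
    and tan: "\<forall>\<^sub>F i in F. U i \<in> tangent_space A (P i)" "v \<in> tangent_space A p"
  shows "tconv P U p v F"
  unfolding tconv_def
proof (intro conjI ballI impI)
  fix d assume d: "d \<in> A" "p \<in> chart_dom d"
  let ?f = "\<lambda>b q. frechet_derivative (chart_map d \<circ> chart_inv c) (at q) b"
  have cont: "((\<lambda>i. dtrans c d (P i) b) \<longlongrightarrow> dtrans c d p b) F" for b
  proof -
    have "Ck_on 0 (overlap c d) (?f b)"
      using transition_smooth[OF c(1) d(1), of "Suc 0"] by simp
    then have "continuous_on (overlap c d) (?f b)" by simp
    moreover have "chart_map c p \<in> overlap c d" using c d by (auto simp: overlap_def)
    ultimately have "isCont (?f b) (chart_map c p)"
      using open_overlap[OF c(1) d(1)] continuous_on_eq_continuous_at by blast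
    then show ?thesis
      unfolding dtrans_def by (rule isCont_tendsto_compose[OF _ tendsto_chart[OF c P]])
  qed
  \<comment> \<open>\<open>dtrans\<close> is known to be continuous only for a fixed vector;
    linearity lets point and vector vary together.\<close>
  have "((\<lambda>i. \<Sum>b\<in>Basis. (U i c \<bullet> b) *\<^sub>R dtrans c d (P i) b) \<longlongrightarrow>
      (\<Sum>b\<in>Basis. (v c \<bullet> b) *\<^sub>R dtrans c d p b)) F"
    by (intro tendsto_intros U cont)
  moreover have expand: "(\<Sum>b\<in>Basis. (x \<bullet> b) *\<^sub>R dtrans c d q b) = dtrans c d q x"
    if "q \<in> chart_dom c" "q \<in> chart_dom d" for q x
  proof -
    have "dtrans c d q (\<Sum>b\<in>Basis. (x \<bullet> b) *\<^sub>R b) = (\<Sum>b\<in>Basis. (x \<bullet> b) *\<^sub>R dtrans c d q b)"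
      using dtrans_linear[OF c(1) d(1) that] by (simp add: linear_sum linear_scale)
    then show ?thesis by (simp add: euclidean_representation)
  qed
  have "(\<Sum>b\<in>Basis. (v c \<bullet> b) *\<^sub>R dtrans c d p b) = v d"
    using tangent_spaceD[OF tan(2) c(1) d(1) c(2) d(2)] expand[OF c(2) d(2)] by simp
  moreover have "\<forall>\<^sub>F i in F. (\<Sum>b\<in>Basis. (U i c \<bullet> b) *\<^sub>R dtrans c d (P i) b) = U i d"
    using tan(1) eventually_in_dom[OF c P] eventually_in_dom[OF d P]
  proof eventually_elim
    case (elim i)
    then show ?case using tangent_spaceD[OF elim(1) c(1) d(1) elim(2,3)] expand by simp
  qed
  ultimately show "((\<lambda>i. U i d) \<longlongrightarrow> v d) F"
    using tendsto_cong by force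
qed (rule P)

text \<open>All geodesics are assumed to exist on the whole interval. Convergence is propagated from
  \<open>a\<close> to \<open>b\<close> by Bolzano's subdivision argument: on short intervals around
  any time, the limit geodesic and eventually the approximating ones stay in one chart ball, where
  Gronwall's inequality compares them. The filter is arbitrary, so that both continuity of exp and
  uniqueness of geodesics follow.\<close>

lemma geod_flow_continuous:
  assumes geod: "geod a b \<sigma> V" "a < b"
    and geods: "\<forall>\<^sub>F i in F. geod a b (\<sigma>s i) (Vs i)"
    and start: "tconv (\<lambda>i. \<sigma>s i a) (\<lambda>i. Vs i a) (\<sigma> a) (V a) F"
  shows "tconv (\<lambda>i. \<sigma>s i b) (\<lambda>i. Vs i b) (\<sigma> b) (V b) F"
proof -
  define S where "S t \<longleftrightarrow> tconv (\<lambda>i. \<sigma>s i t) (\<lambda>i. Vs i t) (\<sigma> t) (V t) F" for t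
  have "a \<le> u \<longrightarrow> v \<le> b \<longrightarrow> S u \<longrightarrow> S v" if "u = a" "v = b" for u v
    unfolding that using less_imp_le[OF geod(2)]
  proof (rule Bolzano[where P = "\<lambda>u v. a \<le> u \<longrightarrow> v \<le> b \<longrightarrow> S u \<longrightarrow> S v"])
    fix t assume t: "a \<le> t" "t \<le> b"
    obtain c where c: "c \<in> A" "\<sigma> t \<in> chart_dom c" by (rule chart_cover)
    let ?x0 = "chart_map c (\<sigma> t)"
    obtain r where r: "r > 0" "cball ?x0 (2 * r) \<subseteq> img c" using chart_ball[OF c] .
    interpret C: coord_metric "img c" "G c" by (rule coord_metric[OF c(1)])
    have r2: "2 * r \<ge> 0" using r(1) by simp
    obtain l where l: "l > 0" "\<And>q u. q \<in> cball ?x0 (2 * r) \<Longrightarrow> l * (norm u)\<^sup>2 \<le> G c q u u"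
      using C.G_coercive[OF r(2) r2] by metis
    obtain M where M: "M \<ge> 0" "\<And>u v. bound_lip (cball ?x0 (2 * r)) (M * (norm u * norm v)) (\<lambda>q. G c q u v)"
      using C.G_bound_lip[OF r(2)] by metis
    define s0 where "s0 = g (\<sigma> a) (V a) (V a)"
    have s0: "s0 \<ge> 0" unfolding s0_def using geod_tangent[OF geod, of a] geod(2) by (intro g_nonneg) auto
    \<comment> \<open>By coercivity the square root bounds the coordinate velocity of the limit
      geodesic; the extra 1 leaves room for the approximating ones.\<close>
    define R where "R = sqrt (s0 / l) + 1"
    \<comment> \<open>Chosen so that \<open>l * \<rho>\<^sup>2\<close> dominates the squared speed
      of the limit geodesic, \<open>s0\<close>, as well as that of the approximating ones, at most
      \<open>M * R\<^sup>2\<close>.\<close>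
    define \<rho> where "\<rho> = sqrt ((M * R\<^sup>2 + s0) / l)"
    have \<rho>: "\<rho> \<ge> 0" "l * \<rho>\<^sup>2 = M * R\<^sup>2 + s0"
      using M(1) s0 l(1) by (auto simp: \<rho>_def)
    obtain L where L: "L \<ge> 0"
      "\<And>q q' v u. q \<in> cball ?x0 (2 * r) \<Longrightarrow> q' \<in> cball ?x0 (2 * r) \<Longrightarrow> norm v \<le> \<rho> \<Longrightarrow> norm u \<le> \<rho> \<Longrightarrow>
       norm (chr c q v v - chr c q' u u) \<le> L * (dist q q' + norm (v - u))"
      using C.chr_bound_lip[OF r(2) r2 \<rho>(1)] by metis
    define U where "U = chart_dom c \<inter> chart_map c -` ball ?x0 r"
    have U: "open U" unfolding U_def
      by (rule continuous_open_preimage[OF continuous_chart[OF c(1)] open_dom[OF c(1)]]) simp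
    have "\<sigma> t \<in> U" using r c by (auto simp: U_def)
    moreover have "(\<sigma> \<longlongrightarrow> \<sigma> t) (at t within {a..b})"
      using geod_continuous_on[OF geod(1)] t by (auto simp: continuous_on_def)
    ultimately have "\<forall>\<^sub>F s in at t within {a..b}. \<sigma> s \<in> U"
      using topological_tendstoD[OF _ U] by blast
    then obtain d1 where d1: "d1 > 0" "\<And>s. s \<in> {a..b} \<Longrightarrow> dist s t < d1 \<Longrightarrow> \<sigma> s \<in> U"
      unfolding eventually_at using \<open>\<sigma> t \<in> U\<close> by metis
    \<comment> \<open>The first bound makes the interval start with the curve in \<open>U\<close>;
      the second keeps the distance travelled at speed \<open>\<rho>\<close> below
      \<open>r\<close>.\<close>
    define d where "d = min d1 (r / (\<rho> + 1))"
    show "\<exists>d>0. \<forall>u v. u \<le> t \<and> t \<le> v \<and> v - u < d \<longrightarrow> a \<le> u \<longrightarrow> v \<le> b \<longrightarrow> S u \<longrightarrow> S v"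
    proof (intro exI[of _ d] conjI allI impI)
      show "d > 0" using d1(1) r(1) \<rho>(1) by (auto simp: d_def)
      fix u v assume uv: "u \<le> t \<and> t \<le> v \<and> v - u < d" "a \<le> u" "v \<le> b" and Su: "S u"
      show "S v"
      proof (cases "u = v")
        case False
        then have lt: "u < v" using uv by auto
        have geod_uv: "geod u v \<sigma> V" using uv by (intro geod_subset[OF geod(1)]) auto
        have uU: "\<sigma> u \<in> U" using uv t by (intro d1(2)) (auto simp: d_def dist_real_def)
        then have u_dom: "\<sigma> u \<in> chart_dom c" "dist ?x0 (chart_map c (\<sigma> u)) < r" by (auto simp: U_def)
        have speed: "g (\<sigma> u) (V u) (V u) = s0"
          unfolding s0_def using uv t by (intro geod_speed[OF geod]) auto
        have le_r: "\<rho> * (v - u) < r"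
        proof -
          have "v - u < r / (\<rho> + 1)" using uv by (simp add: d_def)
          then have "(\<rho> + 1) * (v - u) < r" using \<rho>(1) by (simp add: field_simps)
          then show ?thesis using lt by (simp add: algebra_simps)
        qed
        have "M * R\<^sup>2 \<ge> 0" using M(1) by simp
        then have "g (\<sigma> u) (V u) (V u) \<le> l * \<rho>\<^sup>2" using \<rho>(2) speed by simp
        then have trap: "\<sigma> s \<in> chart_dom c" "chart_map c (\<sigma> s) \<in> cball ?x0 (2 * r)" "norm (V s c) \<le> \<rho>"
          if "s \<in> {u..v}" for s
          using geod_trapped[OF c(1) r(2) l(1) l(2) geod_uv lt u_dom \<rho>(1) _ le_r that] by blast+
        have "l * (norm (V u c))\<^sup>2 \<le> s0"
          using l(2)[of "chart_map c (\<sigma> u)" "V u c"] u_dom r(1) lt speed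
            g_local[OF c(1) u_dom(1) geod_tangent[OF geod_uv lt] geod_tangent[OF geod_uv lt]] by simp
        then have "(norm (V u c))\<^sup>2 \<le> s0 / l" using l(1) by (simp add: field_simps)
        then have "norm (V u c) \<le> sqrt (s0 / l)" by (rule real_le_rsqrt)
        then have "norm (V u c) < R" by (simp add: R_def)
        moreover have "((\<lambda>i. norm (Vs i u c)) \<longlongrightarrow> norm (V u c)) F"
          using Su c(1) u_dom(1) unfolding S_def tconv_def by (intro tendsto_norm) blast
        ultimately have VsR: "\<forall>\<^sub>F i in F. norm (Vs i u c) < R"
          by (intro order_tendstoD(2))
        have sU: "\<forall>\<^sub>F i in F. \<sigma>s i u \<in> U"
          using Su uU topological_tendstoD[OF _ U] unfolding S_def tconv_def by blast
        \<comment> \<open>The difference of position and velocity together, which turns the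
          second-order equation into a first-order one.\<close>
        define f where "f i t = (chart_map c (\<sigma>s i t) - chart_map c (\<sigma> t), Vs i t c - V t c)" for i t
        define E where "E = exp ((1 + 2 * L) * (v - u))"
        have main: "\<forall>\<^sub>F i in F. \<sigma>s i v \<in> chart_dom c \<and> norm (f i v) \<le> E * norm (f i u)
            \<and> Vs i v \<in> tangent_space A (\<sigma>s i v)"
          using VsR sU geods
        proof eventually_elim
          case (elim i)
          have gi: "geod u v (\<sigma>s i) (Vs i)" using uv by (intro geod_subset[OF elim(3)]) auto
          have i_dom: "\<sigma>s i u \<in> chart_dom c" "dist ?x0 (chart_map c (\<sigma>s i u)) < r"
            using elim(2) by (auto simp: U_def)
          have "g (\<sigma>s i u) (Vs i u) (Vs i u) = G c (chart_map c (\<sigma>s i u)) (Vs i u c) (Vs i u c)"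
            using lt by (intro g_local c(1) i_dom(1) geod_tangent[OF gi lt]) auto
          also have "\<dots> \<le> M * (norm (Vs i u c) * norm (Vs i u c))"
            using bound_lip_abs[OF M(2)[of "Vs i u c" "Vs i u c"], of "chart_map c (\<sigma>s i u)"] i_dom r(1) by simp
          also have "\<dots> \<le> M * (R * R)"
            using elim(1) M(1) le_less_trans[OF norm_ge_zero elim(1)] by (intro mult_left_mono mult_mono) auto
          also have "\<dots> \<le> l * \<rho>\<^sup>2" using \<rho>(2) s0 by (simp add: power2_eq_square)
          finally have "g (\<sigma>s i u) (Vs i u) (Vs i u) \<le> l * \<rho>\<^sup>2" .
          then have trapi: "\<sigma>s i s \<in> chart_dom c" "chart_map c (\<sigma>s i s) \<in> cball ?x0 (2 * r)"
            "norm (Vs i s c) \<le> \<rho>" if "s \<in> {u..v}" for s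
            using geod_trapped[OF c(1) r(2) l(1) l(2) gi lt i_dom \<rho>(1) _ le_r that] by blast+
          \<comment> \<open>In the rate \<open>1 + 2 * L\<close>, the 1 stems from the derivative of
            the position, and \<open>2 * L\<close> from the Lipschitz bound on \<open>chr\<close>,
            whose two terms are each at most \<open>norm (f i t)\<close>.\<close>
          have "norm (f i v) \<le> exp ((1 + 2 * L) * (v - u)) * norm (f i u)"
          proof (rule gronwall)
            fix t assume t: "t \<in> {u..v}"
            let ?f' = "(Vs i t c - V t c, - chr c (chart_map c (\<sigma>s i t)) (Vs i t c) (Vs i t c)
                - - chr c (chart_map c (\<sigma> t)) (V t c) (V t c))"
            show "(f i has_vector_derivative ?f') (at t within {u..v})"
              unfolding f_def
              using geod_deriv[OF geod_uv t c(1) trap(1)[OF t]] geod_deriv2[OF geod_uv t c(1) trap(1)[OF t]]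
                geod_deriv[OF gi t c(1) trapi(1)[OF t]] geod_deriv2[OF gi t c(1) trapi(1)[OF t]]
              by (intro has_vector_derivative_Pair has_vector_derivative_diff) (auto simp: o_def)
            have "norm ?f' \<le> norm (fst ?f') + norm (snd ?f')" by (metis norm_Pair_le prod.collapse)
            also have "\<dots> \<le> norm (snd (f i t)) + L * (norm (fst (f i t)) + norm (snd (f i t)))"
              using L(2)[OF trapi(2)[OF t] trap(2)[OF t] trapi(3)[OF t] trap(3)[OF t]]
              by (simp add: f_def dist_norm norm_minus_commute)
            also have "\<dots> \<le> norm (f i t) + L * (norm (f i t) + norm (f i t))"
              using L(1) norm_fst_le[of "fst (f i t)" "snd (f i t)"] norm_snd_le[of "snd (f i t)" "fst (f i t)"]
              by (intro add_mono mult_left_mono) auto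
            finally show "norm ?f' \<le> (1 + 2 * L) * norm (f i t)" by (simp add: algebra_simps)
          qed (use lt in auto)
          moreover have "v \<in> {u..v}" using lt by auto
          ultimately show ?case using trapi(1) geod_tangent[OF gi lt] by (auto simp: E_def)
        qed
        have "((\<lambda>i. chart_map c (\<sigma>s i u)) \<longlongrightarrow> chart_map c (\<sigma> u)) F" "((\<lambda>i. Vs i u c) \<longlongrightarrow> V u c) F"
          using Su c u_dom unfolding S_def tconv_def by (auto intro: tendsto_chart)
        then have "((\<lambda>i. f i u) \<longlongrightarrow> (chart_map c (\<sigma> u) - chart_map c (\<sigma> u), V u c - V u c)) F"
          unfolding f_def by (intro tendsto_intros)
        then have "((\<lambda>i. E * norm (f i u)) \<longlongrightarrow> E * norm (0 :: 'e \<times> 'e)) F"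
          by (intro tendsto_intros) (simp add: zero_prod_def)
        then have E0: "((\<lambda>i. E * norm (f i u)) \<longlongrightarrow> 0) F" by simp
        have "\<forall>\<^sub>F i in F. norm (f i v) \<le> E * norm (f i u)"
          using main by (rule eventually_mono) blast
        then have f0: "((\<lambda>i. f i v) \<longlongrightarrow> 0) F"
          using E0 by (rule Lim_null_comparison)
        have v_dom: "\<sigma> v \<in> chart_dom c" using trap(1) lt by auto
        have "((\<lambda>i. fst (f i v) + chart_map c (\<sigma> v)) \<longlongrightarrow> fst (0 :: 'e \<times> 'e) + chart_map c (\<sigma> v)) F"
          by (intro tendsto_intros f0)
        then have "((\<lambda>i. chart_inv c (chart_map c (\<sigma>s i v))) \<longlongrightarrow> chart_inv c (chart_map c (\<sigma> v))) F"
          using v_dom by (intro tendsto_chart_inv c(1)) (auto simp: f_def)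
        then have conv: "((\<lambda>i. \<sigma>s i v) \<longlongrightarrow> \<sigma> v) F"
          unfolding chart_inv_map[OF c(1) v_dom]
          by (rule Lim_transform_eventually) (rule eventually_mono[OF main], simp add: c(1))
        have "((\<lambda>i. snd (f i v) + V v c) \<longlongrightarrow> snd (0 :: 'e \<times> 'e) + V v c) F"
          by (intro tendsto_intros f0)
        then have "((\<lambda>i. Vs i v c) \<longlongrightarrow> V v c) F" by (simp add: f_def)
        then show ?thesis
          unfolding S_def using lt
          by (intro tconvI[OF c(1) v_dom conv] eventually_mono[OF main] geod_tangent[OF geod_uv lt]) auto
      qed (use Su in simp)
    qed
  qed auto
  then show ?thesis using start by (simp add: S_def)
qed

text \<open>The second geodesic, taken as a constant sequence, converges to the first by
  \<open>geod_flow_continuous\<close>; limits in a Hausdorff space are unique.\<close>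

lemma geod_unique:
  assumes "geod a b \<sigma> V" "geod a b \<tau> W" "a < b" "\<sigma> a = \<tau> a" "V a = W a"
  shows "\<sigma> b = \<tau> b"
proof -
  have "tconv (\<lambda>i::nat. \<tau> b) (\<lambda>i. W b) (\<sigma> b) (V b) sequentially"
    using assms by (intro geod_flow_continuous[OF assms(1,3)]) (auto simp: tconv_def)
  then have "(\<lambda>i::nat. \<tau> b) \<longlonglongrightarrow> \<sigma> b" by (simp add: tconv_def)
  then show ?thesis using LIMSEQ_const_iff by metis
qed

text \<open>Uniqueness of geodesics is what makes the definite description in \<open>exp_map\<close>
  denote.\<close>

lemma exp_map_eq:
  assumes "geod 0 1 \<sigma> V"
  shows "exp_map A g (\<sigma> 0) (V 0) = \<sigma> 1"
  unfolding exp_map_def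
proof (rule the_equality)
  show "\<exists>\<tau>. geodesic_on A g {0..1} \<tau> \<and> \<tau> 0 = \<sigma> 0 \<and> velocity A {0..1} \<tau> 0 = V 0 \<and> \<tau> 1 = \<sigma> 1"
    using assms by (intro exI[of _ \<sigma>]) (auto simp: geod_imp_geodesic_on geod_velocity)
  fix q assume "\<exists>\<tau>. geodesic_on A g {0..1} \<tau> \<and> \<tau> 0 = \<sigma> 0 \<and> velocity A {0..1} \<tau> 0 = V 0 \<and> \<tau> 1 = q"
  then show "q = \<sigma> 1"
    using geod_unique[OF geodesic_on_imp_geod assms] by auto
qed

end

section \<open>Completeness and continuity of the exponential map\<close>

locale bounded_injectivity = riemannian_manifold +
  fixes I :: real
  assumes inj: "I > 0" "\<And>p. injectivity_radius A g p \<ge> ereal I"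
begin

text \<open>The injectivity radius is a supremum, so some admissible radius exceeds the norm of
  \<open>v\<close>; admissibility includes that exp is defined on the ball of that radius.\<close>

lemma geod_short:
  assumes "v \<in> tangent_space A p" "tv_norm g p v < I"
  obtains \<sigma> V where "geod 0 1 \<sigma> V" "\<sigma> 0 = p" "V 0 = v"
proof -
  have "ereal (tv_norm g p v) < injectivity_radius A g p"
    using assms(2) inj(2)[of p] by (meson ereal_less_eq(3) less_ereal.simps(1) less_le_trans)
  then obtain r where "tv_norm g p v < r" "{v \<in> tangent_space A p. tv_norm g p v < r} \<subseteq> exp_domain A g p"
    unfolding injectivity_radius_def less_Sup_iff by auto
  then have "v \<in> exp_domain A g p" using assms by auto
  then show thesis
    using that geodesic_on_imp_geod unfolding exp_domain_def by blast
qed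

text \<open>\<open>v\<close> is scaled down until it is shorter than \<open>I\<close>. Since the
  speed is constant, the end velocity is again shorter than \<open>I\<close>, so extension by one
  unit of time can be repeated; a final reparametrisation undoes the scaling.\<close>

lemma geod_complete:
  assumes v: "v \<in> tangent_space A p"
  obtains \<sigma> V where "geod 0 1 \<sigma> V" "\<sigma> 0 = p" "V 0 = v"
proof -
  obtain N :: nat where N: "tv_norm g p v / I < real N" using reals_Archimedean2 by blast
  define s where "s = inverse (real (Suc N))"
  define u where "u = tv_scale s v"
  have u: "u \<in> tangent_space A p" using v by (simp add: u_def tv_scale_tangent)
  have "tv_norm g p v < I * real (Suc N)" using N inj(1) by (simp add: field_simps)
  then have u_less: "tv_norm g p u < I"
    unfolding u_def tv_norm_scale[OF v] s_def by (simp add: field_simps)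
  have "\<exists>\<sigma> V. geod 0 (real (Suc n)) \<sigma> V \<and> \<sigma> 0 = p \<and> V 0 = u" for n
  proof (induction n)
    case 0
    then show ?case using geod_short[OF u u_less] by (metis of_nat_1 One_nat_def)
  next
    case (Suc n)
    let ?n = "real (Suc n)"
    obtain \<sigma> V where \<sigma>: "geod 0 ?n \<sigma> V" "\<sigma> 0 = p" "V 0 = u" using Suc by blast
    have V: "V ?n \<in> tangent_space A (\<sigma> ?n)" by (intro geod_tangent[OF \<sigma>(1)]) auto
    have "g (\<sigma> ?n) (V ?n) (V ?n) = g p u u" using geod_speed[OF \<sigma>(1), of ?n] \<sigma> by simp
    then have "tv_norm g (\<sigma> ?n) (V ?n) < I" using u_less by (simp add: tv_norm_def)
    then obtain \<tau> W where \<tau>: "geod 0 1 \<tau> W" "\<tau> 0 = \<sigma> ?n" "W 0 = V ?n" using geod_short[OF V] by metis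
    have "geod ?n (real (Suc (Suc n))) (\<lambda>t. \<tau> (1 * t + - ?n)) (\<lambda>t. tv_scale 1 (W (1 * t + - ?n)))"
      by (rule geod_affine[OF \<tau>(1)]) auto
    from geod_join[OF \<sigma>(1) this] show ?case
      using \<sigma>(2,3) \<tau>(2,3) by (fastforce simp: tv_scale_def)
  qed
  then obtain \<sigma> V where \<sigma>: "geod 0 (real (Suc N)) \<sigma> V" "\<sigma> 0 = p" "V 0 = u" by blast
  have "geod 0 1 (\<lambda>t. \<sigma> (real (Suc N) * t + 0)) (\<lambda>t. tv_scale (real (Suc N)) (V (real (Suc N) * t + 0)))"
    by (rule geod_affine[OF \<sigma>(1)]) (auto intro: mult_left_le)
  then show thesis
  proof (rule that)
    show "tv_scale (real (Suc N)) (V (real (Suc N) * 0 + 0)) = v"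
      using \<sigma>(3) by (simp add: u_def s_def tv_scale_def fun_eq_iff del: of_nat_Suc)
  qed (use \<sigma> in simp)
qed

text \<open>One geodesic is selected for each initial datum, and \<open>geod_flow_continuous\<close>
  is applied along the filter of initial data tending to \<open>z\<close>. Joint continuity in base
  point and vector is the input for the measurability of the iterates.\<close>

lemma exp_map_continuous:
  assumes c: "c \<in> A"
  shows "continuous_on (chart_dom c \<times> UNIV) (\<lambda>(p, x). exp_map A g p (coord_vec A c p x))"
  unfolding continuous_on_def
proof
  define D where "D = chart_dom c \<times> (UNIV :: 'b set)"
  fix z assume z: "z \<in> chart_dom c \<times> (UNIV :: 'b set)"
  have "\<forall>z\<in>D. \<exists>\<sigma> V. geod 0 1 \<sigma> V \<and> \<sigma> 0 = fst z \<and> V 0 = coord_vec A c (fst z) (snd z)"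
    unfolding D_def using geod_complete coord_vec_tangent[OF c] by (metis mem_Times_iff)
  then obtain \<sigma> V where \<sigma>: "\<And>z. z \<in> D \<Longrightarrow> geod 0 1 (\<sigma> z) (V z)"
    "\<And>z. z \<in> D \<Longrightarrow> \<sigma> z 0 = fst z" "\<And>z. z \<in> D \<Longrightarrow> V z 0 = coord_vec A c (fst z) (snd z)"
    by metis
  let ?F = "at z within D"
  have zD: "z \<in> D" using z by (simp add: D_def)
  have evD: "\<forall>\<^sub>F i in ?F. i \<in> D" by (simp add: eventually_at_filter)
  have "tconv (\<lambda>i. \<sigma> i 1) (\<lambda>i. V i 1) (\<sigma> z 1) (V z 1) ?F"
  proof (rule geod_flow_continuous[OF \<sigma>(1)[OF zD]])
    show "\<forall>\<^sub>F i in ?F. geod 0 1 (\<sigma> i) (V i)" using evD by eventually_elim (rule \<sigma>)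
    have lim: "((\<lambda>i. i) \<longlongrightarrow> z) ?F" by (rule tendsto_ident_at)
    show "tconv (\<lambda>i. \<sigma> i 0) (\<lambda>i. V i 0) (\<sigma> z 0) (V z 0) ?F"
    proof (rule tconvI[OF c])
      show "\<sigma> z 0 \<in> chart_dom c" using z \<sigma>(2)[OF zD] by auto
      show "((\<lambda>i. \<sigma> i 0) \<longlongrightarrow> \<sigma> z 0) ?F"
        unfolding \<sigma>(2)[OF zD]
        by (rule Lim_transform_eventually[OF tendsto_fst[OF lim]])
          (rule eventually_mono[OF evD], simp add: \<sigma>)
      show "((\<lambda>i. V i 0 c) \<longlongrightarrow> V z 0 c) ?F"
      proof (rule Lim_transform_eventually)
        have *: "V i 0 c = snd i" if "i \<in> D" for i
          using \<sigma>(3)[OF that] coord_vec_self[OF c] that by (auto simp: D_def)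
        show "((\<lambda>i. snd i) \<longlongrightarrow> V z 0 c) ?F" unfolding *[OF zD] by (rule tendsto_snd[OF lim])
        show "\<forall>\<^sub>F i in ?F. snd i = V i 0 c" using evD by eventually_elim (simp add: *)
      qed
      show "\<forall>\<^sub>F i in ?F. V i 0 \<in> tangent_space A (\<sigma> i 0)"
        using evD by eventually_elim (intro geod_tangent[OF \<sigma>(1)]; simp)
      show "V z 0 \<in> tangent_space A (\<sigma> z 0)" by (intro geod_tangent[OF \<sigma>(1)[OF zD]]) auto
    qed
  qed simp
  then have lim: "((\<lambda>i. \<sigma> i 1) \<longlongrightarrow> \<sigma> z 1) ?F" by (simp add: tconv_def)
  have eq: "\<sigma> i 1 = (\<lambda>(p, x). exp_map A g p (coord_vec A c p x)) i" if "i \<in> D" for i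
    using exp_map_eq[OF \<sigma>(1)[OF that]] \<sigma>(2,3)[OF that] by (simp add: case_prod_unfold)
  show "((\<lambda>(p, x). exp_map A g p (coord_vec A c p x)) \<longlongrightarrow> (\<lambda>(p, x). exp_map A g p (coord_vec A c p x)) z)
      (at z within chart_dom c \<times> UNIV)"
    unfolding D_def[symmetric] eq[OF zD, symmetric]
    by (rule Lim_transform_eventually[OF lim]) (rule eventually_mono[OF evD], erule eq)
qed

end

section \<open>Gradients and descent along geodesics\<close>

text \<open>A finite subcover leaves finitely many local constants; by \<open>mono\<close> the
  smallest \<open>\<delta>\<close> and the largest \<open>k\<close> serve everywhere.\<close>

lemma compact_uniform_constants:
  fixes K :: "'a::topological_space set" and Q :: "real \<Rightarrow> real \<Rightarrow> 'a \<Rightarrow> bool"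
  assumes "compact K"
    and loc: "\<And>p. p \<in> K \<Longrightarrow> \<exists>U \<delta> k. open U \<and> p \<in> U \<and> \<delta> > 0 \<and> k \<ge> 0 \<and> (\<forall>q\<in>U. Q \<delta> k q)"
    and mono: "\<And>\<delta> k \<delta>' k' q. Q \<delta> k q \<Longrightarrow> \<delta>' \<le> \<delta> \<Longrightarrow> k \<le> k' \<Longrightarrow> Q \<delta>' k' q"
  obtains \<delta> k where "\<delta> > 0" "k \<ge> 0" "\<And>q. q \<in> K \<Longrightarrow> Q \<delta> k q"
proof -
  obtain U \<delta> k where U: "\<And>p. p \<in> K \<Longrightarrow> open (U p) \<and> p \<in> U p \<and> \<delta> p > 0 \<and> k p \<ge> 0 \<and> (\<forall>q\<in>U p. Q (\<delta> p) (k p) q)"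
    using loc by metis
  have "K \<subseteq> (\<Union>p\<in>K. U p)" using U by blast
  then obtain T where T: "T \<subseteq> K" "finite T" "K \<subseteq> (\<Union>p\<in>T. U p)"
    using compactE_image[OF assms(1), of K U] U by metis
  \<comment> \<open>The inserted values 1 here and 0 below cover an empty subcover.\<close>
  define d where "d = Min (insert 1 (\<delta> ` T))"
  define m where "m = Max (insert 0 (k ` T))"
  show thesis
  proof
    show "d > 0" unfolding d_def using T U by (subst Min_gr_iff) auto
    show "m \<ge> 0" unfolding m_def using T by (intro Max_ge) auto
    fix q assume "q \<in> K"
    then obtain p where p: "p \<in> T" "q \<in> U p" using T(3) by blast
    have "Q (\<delta> p) (k p) q" using U p T(1) by blast
    then show "Q d m q"
    proof (rule mono)
      show "d \<le> \<delta> p" unfolding d_def using p T(2) by (intro Min_le) auto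
      show "k p \<le> m" unfolding m_def using p T(2) by (intro Max_ge) auto
    qed
  qed
qed

section \<open>Differential and gradient of a twice continuously differentiable function\<close>

context riemannian_manifold
begin

definition dchart :: "('m \<Rightarrow> real) \<Rightarrow> ('m, 'e) chart \<Rightarrow> 'e \<Rightarrow> 'e \<Rightarrow> real" where
  "dchart f c q = frechet_derivative (f \<circ> chart_inv c) (at q)"

context
  fixes f :: "'m \<Rightarrow> real"
  assumes f: "Ck_function A 2 f"
begin

lemma f_C2: "c \<in> A \<Longrightarrow> Ck_on (Suc (Suc 0)) (img c) (f \<circ> chart_inv c)"
  using f by (simp add: Ck_function_def numeral_2_eq_2)

lemma dchart_has_derivative: "c \<in> A \<Longrightarrow> q \<in> img c \<Longrightarrow> ((f \<circ> chart_inv c) has_derivative dchart f c q) (at q)"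
  unfolding dchart_def by (rule Ck_on_Suc_has_derivative[OF f_C2])

lemma dchart_linear: "c \<in> A \<Longrightarrow> q \<in> img c \<Longrightarrow> linear (dchart f c q)"
  using dchart_has_derivative by (rule has_derivative_linear)

lemma dchart_C1: "c \<in> A \<Longrightarrow> Ck_on 1 (img c) (\<lambda>q. dchart f c q b)"
  unfolding dchart_def using f_C2 by simp

text \<open>The chain rule again: the differential does not depend on the chart, so the identity
  defining the gradient may be checked in any one of them.\<close>

lemma dchart_change:
  assumes "c \<in> A" "d \<in> A" "p \<in> chart_dom c" "p \<in> chart_dom d"
  shows "dchart f d (chart_map d p) (dtrans c d p x) = dchart f c (chart_map c p) x"
proof -
  have "((\<lambda>q. (f \<circ> chart_inv d) ((chart_map d \<circ> chart_inv c) q)) has_derivative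
      (\<lambda>x. dchart f d (chart_map d p) (dtrans c d p x))) (at (chart_map c p))"
    using dchart_has_derivative[of d "chart_map d p"] assms
    by (intro has_derivative_compose[OF dtrans_has_derivative]) (auto simp: o_def)
  then have "((f \<circ> chart_inv c) has_derivative (\<lambda>x. dchart f d (chart_map d p) (dtrans c d p x)))
      (at (chart_map c p))"
  proof (rule has_derivative_transform_within_open[OF _ open_overlap[OF assms(1,2)]])
    show "chart_map c p \<in> overlap c d" using assms by (auto simp: overlap_def)
  qed (use assms in \<open>auto simp: overlap_def\<close>)
  moreover have "chart_map c p \<in> img c" using assms by auto
  ultimately show ?thesis
    using dchart_has_derivative[OF assms(1)] by (metis has_derivative_unique)
qed

text \<open>Riesz representation in one chart produces a candidate, \<open>dchart_change\<close>
  carries its defining identity to all charts, and testing with coordinate vectors shows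
  uniqueness.\<close>

lemma
  shows gradient_tangent: "gradient A g f p \<in> tangent_space A p"
    and g_gradient: "v \<in> tangent_space A p \<Longrightarrow> c \<in> A \<Longrightarrow> p \<in> chart_dom c \<Longrightarrow>
      g p (gradient A g f p) v = dchart f c (chart_map c p) (v c)"
proof -
  define S where "S u \<longleftrightarrow> u \<in> tangent_space A p \<and>
        (\<forall>v\<in>tangent_space A p. \<forall>c\<in>A. p \<in> chart_dom c \<longrightarrow> g p u v = dchart f c (chart_map c p) (v c))" for u
  obtain c where c: "c \<in> A" "p \<in> chart_dom c" by (rule chart_cover)
  interpret C: coord_metric "img c" "G c" by (rule coord_metric[OF c(1)])
  have q: "chart_map c p \<in> img c" using c by auto
  have ex1: "\<exists>!a. \<forall>b. G c (chart_map c p) a b = dchart f c (chart_map c p) b"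
    by (rule C.riesz[OF q dchart_linear[OF c(1) q]])
  then obtain a where a: "\<And>b. G c (chart_map c p) a b = dchart f c (chart_map c p) b" by blast
  have "S (coord_vec A c p a)"
    unfolding S_def
  proof (intro conjI ballI impI)
    show cv: "coord_vec A c p a \<in> tangent_space A p" by (rule coord_vec_tangent[OF c])
    fix v d assume v: "v \<in> tangent_space A p" and d: "d \<in> A" "p \<in> chart_dom d"
    have "g p (coord_vec A c p a) v = dchart f c (chart_map c p) (v c)"
      using g_local[OF c cv v] a by (simp add: coord_vec_self[OF c])
    also have "\<dots> = dchart f d (chart_map d p) (v d)"
      using dchart_change[OF c(1) d(1) c(2) d(2)] tangent_spaceD[OF v c(1) d(1) c(2) d(2)] by simp
    finally show "g p (coord_vec A c p a) v = dchart f d (chart_map d p) (v d)" .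
  qed
  moreover have "u = coord_vec A c p a" if "S u" for u
  proof -
    have u: "u \<in> tangent_space A p" using that by (simp add: S_def)
    have "G c (chart_map c p) (u c) b = dchart f c (chart_map c p) b" for b
    proof -
      have "g p u (coord_vec A c p b) = dchart f c (chart_map c p) (coord_vec A c p b c)"
        using that c coord_vec_tangent[OF c] unfolding S_def by blast
      then show ?thesis
        using g_local[OF c u coord_vec_tangent[OF c]] by (simp add: coord_vec_self[OF c])
    qed
    then have "u c = a" using ex1 a by blast
    then show ?thesis using coord_vec_of[OF c u] by simp
  qed
  ultimately have "\<exists>!u. S u" by blast
  moreover have "gradient A g f p = (THE u. S u)"
    by (simp add: gradient_def S_def dchart_def)
  ultimately have "S (gradient A g f p)" by (metis theI')
  then show "gradient A g f p \<in> tangent_space A p"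
    and "v \<in> tangent_space A p \<Longrightarrow> c \<in> A \<Longrightarrow> p \<in> chart_dom c \<Longrightarrow>
      g p (gradient A g f p) v = dchart f c (chart_map c p) (v c)" for v c
    unfolding S_def by blast+
qed

definition grad_sq :: "'m \<Rightarrow> real" where
  "grad_sq p = g p (gradient A g f p) (gradient A g f p)"

lemma grad_sq_nonneg: "grad_sq p \<ge> 0"
  unfolding grad_sq_def by (intro g_nonneg gradient_tangent)

lemma tv_norm_gradient: "tv_norm g p (gradient A g f p) = sqrt (grad_sq p)"
  by (simp add: tv_norm_def grad_sq_def)

lemma dchart_bound_lip:
  assumes c: "c \<in> A" and X: "cball x0 r \<subseteq> img c"
  obtains N where "N \<ge> 0" "\<And>b. bound_lip (cball x0 r) (N * norm b) (\<lambda>q. dchart f c q b)"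
proof -
  have "\<exists>M. \<forall>u::unit. bound_lip (cball x0 r) (M * 1) (\<lambda>q. dchart f c q b)" for b
    using Ck_on_bound_lip[OF dchart_C1[OF c] X, of b] by (metis mult_1_right)
  then have "\<exists>M\<ge>0. \<forall>b (u::unit). bound_lip (cball x0 r) (M * (norm b * 1)) (\<lambda>q. dchart f c q b)"
    using X by (intro bound_lip_linear) (auto intro: dchart_linear[OF c] simp del: mem_cball)
  then show thesis using that by (metis mult_1_right)
qed

text \<open>\<open>grad_sq\<close> is the differential evaluated at the gradient. Both factors are
  bounded and Lipschitz on the ball, the differential since \<open>f\<close> is twice continuously
  differentiable, the gradient by \<open>riesz_lipschitz\<close>.\<close>

lemma grad_sq_lipschitz:
  assumes c: "c \<in> A" and X: "cball x0 r \<subseteq> img c" and r: "r \<ge> 0"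
  obtains L where "L \<ge> 0" "\<And>q q'. q \<in> cball x0 r \<Longrightarrow> q' \<in> cball x0 r \<Longrightarrow>
    \<bar>grad_sq (chart_inv c q) - grad_sq (chart_inv c q')\<bar> \<le> L * dist q q'"
proof -
  let ?X = "cball x0 r"
  interpret C: coord_metric "img c" "G c" by (rule coord_metric[OF c])
  obtain N where N: "N \<ge> 0" "\<And>b. bound_lip ?X (N * norm b) (\<lambda>q. dchart f c q b)"
    using dchart_bound_lip[OF c X] by metis
  obtain l where l: "l > 0" "\<And>q u. q \<in> ?X \<Longrightarrow> l * (norm u)\<^sup>2 \<le> G c q u u"
    using C.G_coercive[OF X r] by metis
  obtain M where M: "M \<ge> 0" "\<And>u v. bound_lip ?X (M * (norm u * norm v)) (\<lambda>q. G c q u v)"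
    using C.G_bound_lip[OF X] by metis
  define a where "a q = gradient A g f (chart_inv c q) c" for q
  have a: "G c q (a q) b = dchart f c q b" if "q \<in> ?X" for q b
  proof -
    have q: "q \<in> img c" using that X by blast
    note p = chart_inv_in[OF c q]
    show ?thesis
      using g_gradient[OF coord_vec_tangent[OF c p, of b] c p]
        g_local[OF c p gradient_tangent coord_vec_tangent[OF c p, of b]]
      by (simp add: coord_vec_self[OF c p] chart_map_inv[OF c q] a_def)
  qed
  have h: "grad_sq (chart_inv c q) = dchart f c q (a q)" if "q \<in> ?X" for q
  proof -
    have q: "q \<in> img c" using that X by blast
    show ?thesis
      using g_gradient[OF gradient_tangent c chart_inv_in[OF c q]]
      by (simp add: grad_sq_def chart_map_inv[OF c q] a_def)
  qed
  \<comment> \<open>Coercivity, with the representing identity tested on the gradient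
    itself.\<close>
  have a_le: "norm (a q) \<le> N / l" if q: "q \<in> ?X" for q
  proof -
    have "l * (norm (a q))\<^sup>2 \<le> N * norm (a q)"
      using l(2)[OF q, of "a q"] a[OF q, of "a q"] bound_lip_abs[OF N(2)[of "a q"] q] by linarith
    then have "norm (a q) * (l * norm (a q)) \<le> norm (a q) * N" by (simp add: power2_eq_square mult_ac)
    then have "l * norm (a q) \<le> N" using N(1) by (cases "a q = 0") auto
    then show ?thesis using l(1) by (simp add: field_simps)
  qed
  define L1 where "L1 = (N + M * (N / l)) / l"
  have L1: "L1 \<ge> 0" using N(1) M(1) l(1) by (auto simp: L1_def)
  have a_lip: "norm (a q - a q') \<le> L1 * dist q q'" if q: "q \<in> ?X" "q' \<in> ?X" for q q'
  proof -
    have "l * norm (a q - a q') \<le> N * dist q q' + M * dist q q' * norm (a q')"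
    proof (rule riesz_lipschitz[OF q _ M(2) l(1) l(2) a[OF q(1)] a[OF q(2)]])
      show "linear (\<lambda>u. G c q u (a q - a q'))" using q X by (intro C.G_linear_left) blast
      show "\<bar>dchart f c q b - dchart f c q' b\<bar> \<le> N * dist q q' * norm b" for b
        using bound_lip_diff[OF N(2) q, of b] by (simp add: mult_ac)
    qed (use N M in auto)
    also have "\<dots> \<le> N * dist q q' + M * dist q q' * (N / l)"
      using a_le[OF q(2)] M(1) by (intro add_left_mono mult_left_mono) auto
    also have "\<dots> = l * (L1 * dist q q')" using l(1) by (simp add: L1_def field_simps)
    finally show ?thesis using l(1) by simp
  qed
  show thesis
  proof (rule that[of "N * (N / l) + N * L1"])
    show "0 \<le> N * (N / l) + N * L1" using N(1) l(1) L1 by auto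
    fix q q' assume q: "q \<in> ?X" "q' \<in> ?X"
    have lin: "linear (dchart f c q')" using q X by (intro dchart_linear[OF c]) blast
    have "grad_sq (chart_inv c q) - grad_sq (chart_inv c q')
        = (dchart f c q (a q) - dchart f c q' (a q)) + dchart f c q' (a q - a q')"
      using h q linear_diff[OF lin] by simp
    moreover have "\<bar>dchart f c q (a q) - dchart f c q' (a q)\<bar> \<le> N * (N / l) * dist q q'"
      by (rule order.trans[OF bound_lip_diff[OF N(2) q]])
        (use a_le[OF q(1)] N(1) in \<open>intro mult_right_mono mult_left_mono; simp\<close>)
    moreover have "\<bar>dchart f c q' (a q - a q')\<bar> \<le> N * (L1 * dist q q')"
      by (rule order.trans[OF bound_lip_abs[OF N(2) q(2)]])
        (use a_lip[OF q] N(1) in \<open>intro mult_left_mono; simp\<close>)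
    ultimately show "\<bar>grad_sq (chart_inv c q) - grad_sq (chart_inv c q')\<bar> \<le> (N * (N / l) + N * L1) * dist q q'"
      by (simp add: algebra_simps)
  qed
qed

lemma continuous_grad_sq: "continuous_on UNIV grad_sq"
proof -
  have "isCont grad_sq p" for p
  proof -
    obtain c where c: "c \<in> A" "p \<in> chart_dom c" by (rule chart_cover)
    obtain r where r: "r > 0" "cball (chart_map c p) (2 * r) \<subseteq> img c" using chart_ball[OF c] .
    have r2: "2 * r \<ge> 0" using r(1) by simp
    let ?X = "cball (chart_map c p) (2 * r)"
    obtain L where L: "L \<ge> 0" "\<And>q q'. q \<in> ?X \<Longrightarrow> q' \<in> ?X \<Longrightarrow>
      \<bar>grad_sq (chart_inv c q) - grad_sq (chart_inv c q')\<bar> \<le> L * dist q q'"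
      using grad_sq_lipschitz[OF c(1) r(2) r2] by metis
    have lim: "((\<lambda>s. chart_map c s) \<longlongrightarrow> chart_map c p) (at p)"
      by (rule tendsto_chart[OF c tendsto_ident_at])
    have "((\<lambda>s. L * dist (chart_map c s) (chart_map c p)) \<longlongrightarrow> L * dist (chart_map c p) (chart_map c p)) (at p)"
      by (intro tendsto_intros lim)
    then have "((\<lambda>s. L * dist (chart_map c s) (chart_map c p)) \<longlongrightarrow> 0) (at p)" by simp
    moreover have "\<forall>\<^sub>F s in at p. norm (grad_sq s - grad_sq p) \<le> L * dist (chart_map c s) (chart_map c p)"
      using eventually_in_dom[OF c tendsto_ident_at] topological_tendstoD[OF lim, of "ball (chart_map c p) (2 * r)"] r(1)
    proof (simp, elim eventually_elim2)
      fix s assume "s \<in> chart_dom c" "dist (chart_map c p) (chart_map c s) < 2 * r"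
      then show "\<bar>grad_sq s - grad_sq p\<bar> \<le> L * dist (chart_map c s) (chart_map c p)"
        using L(2)[of "chart_map c s" "chart_map c p"] c r(1) by simp
    qed
    ultimately have "((\<lambda>s. grad_sq s - grad_sq p) \<longlongrightarrow> 0) (at p)" by (rule Lim_null_comparison[rotated])
    then show ?thesis by (simp add: isCont_def LIM_zero_iff)
  qed
  then show ?thesis by (simp add: continuous_at_imp_continuous_on)
qed

lemma continuous_f: "continuous_on UNIV f"
proof -
  have "isCont f p" for p
  proof -
    obtain c where c: "c \<in> A" "p \<in> chart_dom c" by (rule chart_cover)
    have "continuous_on (chart_dom c) (\<lambda>s. (f \<circ> chart_inv c) (chart_map c s))"
      by (rule continuous_on_compose2[OF Ck_on_continuous_on[OF f_C2[OF c(1)]] continuous_chart[OF c(1)]]) auto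
    then have "continuous_on (chart_dom c) f"
      by (rule continuous_on_eq) (use c in auto)
    then show ?thesis using continuous_on_eq_continuous_at[OF open_dom[OF c(1)]] c(2) by blast
  qed
  then show ?thesis by (simp add: continuous_at_imp_continuous_on)
qed

text \<open>Prepares the measurability of the derivative of \<open>C\<close> in the sampled
  direction, where point and vector are both random.\<close>

lemma continuous_dchart:
  assumes c: "c \<in> A"
  shows "continuous_on (chart_dom c \<times> UNIV) (\<lambda>(p, x). dchart f c (chart_map c p) x)"
proof -
  have "continuous_on (chart_dom c \<times> UNIV)
      (\<lambda>z. \<Sum>b\<in>Basis. (snd z \<bullet> b) * dchart f c (chart_map c (fst z)) b)"
  proof (intro continuous_intros)
    fix b
    have "continuous_on (chart_dom c) (\<lambda>p. dchart f c (chart_map c p) b)"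
      by (rule continuous_on_compose2[OF Ck_on_continuous_on[OF dchart_C1[OF c]] continuous_chart[OF c]]) auto
    then show "continuous_on (chart_dom c \<times> UNIV) (\<lambda>z. dchart f c (chart_map c (fst z)) b)"
      by (rule continuous_on_compose2) (auto intro: continuous_on_fst)
  qed
  moreover have "(\<Sum>b\<in>Basis. (snd z \<bullet> b) * dchart f c (chart_map c (fst z)) b) = dchart f c (chart_map c (fst z)) (snd z)"
    if "z \<in> chart_dom c \<times> UNIV" for z
    using that by (subst linear_sum_Basis[OF dchart_linear[OF c], of _ "snd z"]) auto
  ultimately show ?thesis
    unfolding case_prod_unfold by (rule continuous_on_eq)
qed

text \<open>Along a geodesic that remains in a chart ball, the coordinate velocity and its
  derivative are controlled by the speed, so the derivative of \<open>f\<close> along the curve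
  varies only to second order in the speed. It is stated for geodesics, so that it holds without
  completeness.\<close>

lemma local_step_estimate:
  obtains U \<delta> k where "open U" "p \<in> U" "\<delta> > 0" "k \<ge> 0"
    "\<And>\<sigma> V. geod 0 1 \<sigma> V \<Longrightarrow> \<sigma> 0 \<in> U \<Longrightarrow> tv_norm g (\<sigma> 0) (V 0) < \<delta> \<Longrightarrow>
      \<bar>f (\<sigma> 1) - f (\<sigma> 0) - g (\<sigma> 0) (gradient A g f (\<sigma> 0)) (V 0)\<bar> \<le> k * (tv_norm g (\<sigma> 0) (V 0))\<^sup>2 \<and>
      \<bar>grad_sq (\<sigma> 1) - grad_sq (\<sigma> 0)\<bar> \<le> k * tv_norm g (\<sigma> 0) (V 0)"
proof -
  obtain c where c: "c \<in> A" "p \<in> chart_dom c" by (rule chart_cover)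
  let ?x0 = "chart_map c p"
  obtain r where r: "r > 0" "cball ?x0 (2 * r) \<subseteq> img c" using chart_ball[OF c] .
  have r2: "2 * r \<ge> 0" using r(1) by simp
  let ?X = "cball ?x0 (2 * r)"
  interpret C: coord_metric "img c" "G c" by (rule coord_metric[OF c(1)])
  obtain N where N: "N \<ge> 0" "\<And>b. bound_lip ?X (N * norm b) (\<lambda>q. dchart f c q b)"
    using dchart_bound_lip[OF c(1) r(2)] by metis
  obtain l where l: "l > 0" "\<And>q u. q \<in> ?X \<Longrightarrow> l * (norm u)\<^sup>2 \<le> G c q u u"
    using C.G_coercive[OF r(2) r2] by metis
  obtain L where L: "L \<ge> 0" "\<And>q v. q \<in> ?X \<Longrightarrow> norm (chr c q v v) \<le> L * (norm v)\<^sup>2"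
    using C.chr_bound_lip[OF r(2) r2, of 0] by (metis order_refl)
  obtain L' where L': "L' \<ge> 0" "\<And>q q'. q \<in> ?X \<Longrightarrow> q' \<in> ?X \<Longrightarrow>
      \<bar>grad_sq (chart_inv c q) - grad_sq (chart_inv c q')\<bar> \<le> L' * dist q q'"
    using grad_sq_lipschitz[OF c(1) r(2) r2] by metis
  define U where "U = chart_dom c \<inter> chart_map c -` ball ?x0 r"
  \<comment> \<open>The constants of the two estimates, with the coordinate speed
    \<open>\<rho>\<close> expressed by the Riemannian speed through coercivity.\<close>
  define k where "k = max ((N + N * L) / l) (L' / sqrt l)"
  show thesis
  \<comment> \<open>Speeds below \<open>r * sqrt l\<close> give \<open>\<rho> < r\<close>, so that
    \<open>geod_trapped\<close> applies up to time 1.\<close>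
  proof (rule that[of U "r * sqrt l" k])
    show "open U" unfolding U_def
      by (rule continuous_open_preimage[OF continuous_chart[OF c(1)] open_dom[OF c(1)]]) simp
    show "p \<in> U" using c r by (auto simp: U_def)
    show "r * sqrt l > 0" using r l by simp
    show "k \<ge> 0" using N(1) L(1) l(1) by (auto simp: k_def le_max_iff_disj)
    fix \<sigma> V assume geod: "geod 0 1 \<sigma> V" and \<sigma>0: "\<sigma> 0 \<in> U" and small: "tv_norm g (\<sigma> 0) (V 0) < r * sqrt l"
    have V0: "V 0 \<in> tangent_space A (\<sigma> 0)" by (intro geod_tangent[OF geod]) auto
    define s where "s = tv_norm g (\<sigma> 0) (V 0)"
    have s: "s \<ge> 0" "s\<^sup>2 = g (\<sigma> 0) (V 0) (V 0)"
      using tv_norm_square[OF V0] g_nonneg[OF V0] by (auto simp: s_def tv_norm_def)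
    define \<rho> where "\<rho> = s / sqrt l"
    have \<rho>: "\<rho> \<ge> 0" "g (\<sigma> 0) (V 0) (V 0) \<le> l * \<rho>\<^sup>2" "\<rho> * (1 - 0) < r"
      using s l(1) small by (auto simp: \<rho>_def power_divide s_def[symmetric] field_simps)
    have dom0: "\<sigma> 0 \<in> chart_dom c" "dist ?x0 (chart_map c (\<sigma> 0)) < r" using \<sigma>0 by (auto simp: U_def)
    have trap: "\<sigma> t \<in> chart_dom c" "chart_map c (\<sigma> t) \<in> ?X" "norm (V t c) \<le> \<rho>" if "t \<in> {0..1}" for t
      using geod_trapped[OF c(1) r(2) l(1) l(2) geod zero_less_one dom0 \<rho> that] by blast+
    have x_le: "norm (chart_map c (\<sigma> t) - chart_map c (\<sigma> 0)) \<le> \<rho>" if t: "t \<in> {0..1}" for t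
    proof -
      have "norm ((chart_map c \<circ> \<sigma>) t - (chart_map c \<circ> \<sigma>) 0) \<le> \<rho> * (t - 0)"
      proof (rule vector_derivative_bound)
        fix s assume "s \<in> {0..t}"
        then have s: "s \<in> {0..1}" using t by auto
        show "(chart_map c \<circ> \<sigma> has_vector_derivative V s c) (at s within {0..t})"
          by (rule has_vector_derivative_within_subset[OF geod_deriv[OF geod s c(1) trap(1)[OF s]]]) (use t in auto)
        show "norm (V s c) \<le> \<rho>" by (rule trap(3)[OF s])
      qed (use t in auto)
      also have "\<dots> \<le> \<rho>" using t \<rho>(1) by (simp add: mult_left_le)
      finally show ?thesis by simp
    qed
    \<comment> \<open>By the geodesic equation, the coordinate acceleration is quadratic in the
      velocity.\<close>
    have V_le: "norm (V t c - V 0 c) \<le> L * \<rho>\<^sup>2" if t: "t \<in> {0..1}" for t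
    proof -
      have "norm (V t c - V 0 c) \<le> (L * \<rho>\<^sup>2) * (t - 0)"
      proof (rule vector_derivative_bound[where f = "\<lambda>s. V s c"])
        fix s assume "s \<in> {0..t}"
        then have s: "s \<in> {0..1}" using t by auto
        show "((\<lambda>s. V s c) has_vector_derivative - chr c (chart_map c (\<sigma> s)) (V s c) (V s c)) (at s within {0..t})"
          by (rule has_vector_derivative_within_subset[OF geod_deriv2[OF geod s c(1) trap(1)[OF s]]]) (use t in auto)
        have "(norm (V s c))\<^sup>2 \<le> \<rho>\<^sup>2" using trap(3)[OF s] by (intro power_mono) auto
        then show "norm (- chr c (chart_map c (\<sigma> s)) (V s c) (V s c)) \<le> L * \<rho>\<^sup>2"
          using L(2)[OF trap(2)[OF s], of "V s c"] mult_left_mono[OF _ L(1)] by fastforce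
      qed (use t in auto)
      also have "\<dots> \<le> L * \<rho>\<^sup>2" using t L(1) by (simp add: mult_left_le)
      finally show ?thesis .
    qed
    define D where "D t = dchart f c (chart_map c (\<sigma> t)) (V t c)" for t
    have D_le: "norm (D t - D 0) \<le> (N + N * L) * \<rho>\<^sup>2" if t: "t \<in> {0..1}" for t
    proof -
      have 0: "(0::real) \<in> {0..1}" by simp
      have lin: "linear (dchart f c (chart_map c (\<sigma> 0)))"
        using dom0 by (intro dchart_linear[OF c(1)]) auto
      have "D t - D 0 = (dchart f c (chart_map c (\<sigma> t)) (V t c) - dchart f c (chart_map c (\<sigma> 0)) (V t c))
          + dchart f c (chart_map c (\<sigma> 0)) (V t c - V 0 c)"
        by (simp add: D_def linear_diff[OF lin])
      moreover have "\<bar>dchart f c (chart_map c (\<sigma> t)) (V t c) - dchart f c (chart_map c (\<sigma> 0)) (V t c)\<bar> \<le> N * \<rho> * \<rho>"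
        by (rule order.trans[OF bound_lip_diff[OF N(2) trap(2)[OF t] trap(2)[OF 0]]])
          (use trap(3)[OF t] x_le[OF t] N(1) \<rho>(1) in \<open>intro mult_mono mult_left_mono; simp add: dist_norm\<close>)
      moreover have "\<bar>dchart f c (chart_map c (\<sigma> 0)) (V t c - V 0 c)\<bar> \<le> N * (L * \<rho>\<^sup>2)"
        by (rule order.trans[OF bound_lip_abs[OF N(2) trap(2)[OF 0]]])
          (use V_le[OF t] N(1) in \<open>intro mult_left_mono; simp\<close>)
      ultimately show ?thesis by (simp add: algebra_simps power2_eq_square)
    qed
    \<comment> \<open>Mean value inequality for \<open>f\<close> along the curve minus its linear
      part; the derivative \<open>D t - D 0\<close> is of second order in
      \<open>\<rho>\<close>.\<close>
    have "norm ((f (\<sigma> 1) - 1 * D 0) - (f (\<sigma> 0) - 0 * D 0)) \<le> (N + N * L) * \<rho>\<^sup>2 * (1 - 0)"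
    proof (rule vector_derivative_bound[where f = "\<lambda>t. f (\<sigma> t) - t * D 0" and f' = "\<lambda>t. D t - D 0"])
      fix t :: real assume t: "t \<in> {0..1}"
      have "(chart_map c \<circ> \<sigma> has_derivative (\<lambda>h. h *\<^sub>R V t c)) (at t within {0..1})"
        using geod_deriv[OF geod t c(1) trap(1)[OF t]] by (simp add: has_vector_derivative_def)
      then have "((\<lambda>s. (f \<circ> chart_inv c) ((chart_map c \<circ> \<sigma>) s)) has_derivative
          (\<lambda>h. dchart f c (chart_map c (\<sigma> t)) (h *\<^sub>R V t c))) (at t within {0..1})"
        by (rule has_derivative_in_compose)
          (use dchart_has_derivative[OF c(1), of "chart_map c (\<sigma> t)"] trap(1)[OF t]
            in \<open>simp add: o_def has_derivative_at_withinI\<close>)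
      moreover have "(\<lambda>h. dchart f c (chart_map c (\<sigma> t)) (h *\<^sub>R V t c)) = (\<lambda>h. h *\<^sub>R D t)"
        using trap(1)[OF t] linear_scale[OF dchart_linear[OF c(1), of "chart_map c (\<sigma> t)"]]
        by (simp add: D_def fun_eq_iff)
      ultimately have "((\<lambda>s. (f \<circ> chart_inv c) ((chart_map c \<circ> \<sigma>) s)) has_vector_derivative D t) (at t within {0..1})"
        by (simp add: has_vector_derivative_def)
      then have "((\<lambda>s. f (\<sigma> s)) has_vector_derivative D t) (at t within {0..1})"
        by (rule has_vector_derivative_transform[OF t, rotated]) (use trap(1) c(1) in auto)
      moreover have "((\<lambda>s. s * D 0) has_vector_derivative D 0) (at t within {0..1})"
        unfolding has_vector_derivative_def by (auto intro!: derivative_eq_intros)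
      ultimately show "((\<lambda>s. f (\<sigma> s) - s * D 0) has_vector_derivative D t - D 0) (at t within {0..1})"
        by (intro has_vector_derivative_diff)
      show "norm (D t - D 0) \<le> (N + N * L) * \<rho>\<^sup>2" by (rule D_le[OF t])
    qed simp
    moreover have "D 0 = g (\<sigma> 0) (gradient A g f (\<sigma> 0)) (V 0)"
      using g_gradient[OF V0 c(1) dom0(1)] by (simp add: D_def)
    moreover have "(N + N * L) * \<rho>\<^sup>2 \<le> k * s\<^sup>2"
    proof -
      have "(N + N * L) * \<rho>\<^sup>2 = (N + N * L) / l * s\<^sup>2"
        using l(1) by (simp add: \<rho>_def power_divide)
      also have "\<dots> \<le> k * s\<^sup>2" by (intro mult_right_mono) (auto simp: k_def)
      finally show ?thesis .
    qed
    ultimately have 1: "\<bar>f (\<sigma> 1) - f (\<sigma> 0) - g (\<sigma> 0) (gradient A g f (\<sigma> 0)) (V 0)\<bar> \<le> k * s\<^sup>2" by simp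
    have one: "(1::real) \<in> {0..1}" "(0::real) \<in> {0..1}" by auto
    have "\<bar>grad_sq (\<sigma> 1) - grad_sq (\<sigma> 0)\<bar> \<le> L' * dist (chart_map c (\<sigma> 1)) (chart_map c (\<sigma> 0))"
      using L'(2)[OF trap(2)[OF one(1)] trap(2)[OF one(2)]] trap(1) one c(1) by simp
    also have "\<dots> \<le> L' * \<rho>" using x_le[OF one(1)] L'(1) by (intro mult_left_mono) (auto simp: dist_norm)
    also have "\<dots> = L' / sqrt l * s" by (simp add: \<rho>_def)
    also have "\<dots> \<le> k * s" using s(1) by (intro mult_right_mono) (auto simp: k_def)
    finally show "\<bar>f (\<sigma> 1) - f (\<sigma> 0) - g (\<sigma> 0) (gradient A g f (\<sigma> 0)) (V 0)\<bar> \<le> k * (tv_norm g (\<sigma> 0) (V 0))\<^sup>2 \<and>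
      \<bar>grad_sq (\<sigma> 1) - grad_sq (\<sigma> 0)\<bar> \<le> k * tv_norm g (\<sigma> 0) (V 0)"
      using 1 by (simp add: s_def)
  qed
qed

end

end

context bounded_injectivity
begin

text \<open>Only the starting point has to lie in \<open>K\<close>: the local estimates already
  cover the whole geodesic. Completeness turns them into statements about
  \<open>exp_map\<close>.\<close>

lemma uniform_step_estimate:
  assumes f: "Ck_function A 2 f" and K: "compact K"
  obtains \<delta> k where "\<delta> > 0" "k \<ge> 0"
    "\<And>p v. p \<in> K \<Longrightarrow> v \<in> tangent_space A p \<Longrightarrow> tv_norm g p v < \<delta> \<Longrightarrow>
      \<bar>f (exp_map A g p v) - f p - g p (gradient A g f p) v\<bar> \<le> k * (tv_norm g p v)\<^sup>2"
    "\<And>p v. p \<in> K \<Longrightarrow> v \<in> tangent_space A p \<Longrightarrow> tv_norm g p v < \<delta> \<Longrightarrow>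
      \<bar>grad_sq f (exp_map A g p v) - grad_sq f p\<bar> \<le> k * tv_norm g p v"
proof -
  define Q where "Q \<delta> k p \<longleftrightarrow> (\<forall>v\<in>tangent_space A p. tv_norm g p v < \<delta> \<longrightarrow>
      \<bar>f (exp_map A g p v) - f p - g p (gradient A g f p) v\<bar> \<le> k * (tv_norm g p v)\<^sup>2 \<and>
      \<bar>grad_sq f (exp_map A g p v) - grad_sq f p\<bar> \<le> k * tv_norm g p v)" for \<delta> k p
  have "\<exists>\<delta> k. \<delta> > 0 \<and> k \<ge> 0 \<and> (\<forall>p\<in>K. Q \<delta> k p)"
  proof (rule compact_uniform_constants[OF K, of Q])
    fix p
    obtain U \<delta> k where U: "open U" "p \<in> U" "\<delta> > 0" "k \<ge> 0"
      and est: "\<And>\<sigma> V. geod 0 1 \<sigma> V \<Longrightarrow> \<sigma> 0 \<in> U \<Longrightarrow> tv_norm g (\<sigma> 0) (V 0) < \<delta> \<Longrightarrow>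
      \<bar>f (\<sigma> 1) - f (\<sigma> 0) - g (\<sigma> 0) (gradient A g f (\<sigma> 0)) (V 0)\<bar> \<le> k * (tv_norm g (\<sigma> 0) (V 0))\<^sup>2 \<and>
      \<bar>grad_sq f (\<sigma> 1) - grad_sq f (\<sigma> 0)\<bar> \<le> k * tv_norm g (\<sigma> 0) (V 0)"
      using local_step_estimate[OF f, of p] by metis
    have "Q \<delta> k q" if q: "q \<in> U" for q
      unfolding Q_def
    proof (intro ballI impI)
      fix v assume v: "v \<in> tangent_space A q" "tv_norm g q v < \<delta>"
      obtain \<sigma> V where \<sigma>: "geod 0 1 \<sigma> V" "\<sigma> 0 = q" "V 0 = v" using geod_complete[OF v(1)] .
      show "\<bar>f (exp_map A g q v) - f q - g q (gradient A g f q) v\<bar> \<le> k * (tv_norm g q v)\<^sup>2 \<and>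
          \<bar>grad_sq f (exp_map A g q v) - grad_sq f q\<bar> \<le> k * tv_norm g q v"
        using est[OF \<sigma>(1)] exp_map_eq[OF \<sigma>(1)] \<sigma>(2,3) v q by simp
    qed
    then show "\<exists>U \<delta> k. open U \<and> p \<in> U \<and> \<delta> > 0 \<and> k \<ge> 0 \<and> (\<forall>q\<in>U. Q \<delta> k q)"
      using U by blast
  next
    fix \<delta> k \<delta>' k' :: real and q
    assume *: "Q \<delta> k q" "\<delta>' \<le> \<delta>" "k \<le> k'"
    show "Q \<delta>' k' q"
      unfolding Q_def
    proof (intro ballI impI)
      fix v assume v: "v \<in> tangent_space A q" "tv_norm g q v < \<delta>'"
      have "tv_norm g q v \<ge> 0" using g_nonneg[OF v(1)] by (simp add: tv_norm_def)
      then have "k * (tv_norm g q v)\<^sup>2 \<le> k' * (tv_norm g q v)\<^sup>2" "k * tv_norm g q v \<le> k' * tv_norm g q v"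
        using *(3) by (auto intro: mult_right_mono)
      then show "\<bar>f (exp_map A g q v) - f q - g q (gradient A g f q) v\<bar> \<le> k' * (tv_norm g q v)\<^sup>2 \<and>
          \<bar>grad_sq f (exp_map A g q v) - grad_sq f q\<bar> \<le> k' * tv_norm g q v"
        using *(1,2) v unfolding Q_def by (meson less_le_trans order.trans)
    qed
  qed blast
  then show thesis using that unfolding Q_def by blast
qed

end

section \<open>Stochastic approximation\<close>

text \<open>
  Being a martingale difference is expressed by orthogonality to the past. The proof stops the
  martingale \<open>S\<close> when it first reaches \<open>\<epsilon>\<close>, which gives \<open>T\<close>, and applies Chebyshev to \<open>T\<close>.
\<close>

lemma (in prob_space) martingale_maximal_inequality:
  fixes \<xi> :: "nat \<Rightarrow> 'a \<Rightarrow> real"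
  assumes sub: "\<And>n. subalgebra M (F n)" and filt: "\<And>n. sets (F n) \<subseteq> sets (F (Suc n))"
    and meas: "\<And>n. \<xi> n \<in> borel_measurable (F (Suc n))"
    and bound: "\<And>n \<omega>. \<omega> \<in> space M \<Longrightarrow> \<bar>\<xi> n \<omega>\<bar> \<le> a n"
    and orth: "\<And>n Y. Y \<in> borel_measurable (F n) \<Longrightarrow> (\<exists>b. \<forall>\<omega>\<in>space M. \<bar>Y \<omega>\<bar> \<le> b) \<Longrightarrow>
       expectation (\<lambda>\<omega>. Y \<omega> * \<xi> n \<omega>) = 0"
    and "\<epsilon> > 0"
  shows "prob {\<omega>\<in>space M. \<exists>j\<le>k. \<epsilon> \<le> \<bar>\<Sum>i<j. \<xi> i \<omega>\<bar>} \<le> (\<Sum>i<k. (a i)\<^sup>2) / \<epsilon>\<^sup>2"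
proof -
  define S where "S j \<omega> = (\<Sum>i<j. \<xi> i \<omega>)" for j \<omega>
  \<comment> \<open>\<open>J i\<close> multiplies the increment from time \<open>i\<close> to
    \<open>i + 1\<close> and looks at \<open>S\<close> up to time \<open>i\<close> inclusive, hence
    is known before that increment.\<close>
  define J :: "nat \<Rightarrow> 'a \<Rightarrow> real" where "J i = indicator {\<omega>\<in>space M. \<forall>j\<le>i. \<bar>S j \<omega>\<bar> < \<epsilon>}" for i
  define T where "T j \<omega> = (\<Sum>i<j. J i \<omega> * \<xi> i \<omega>)" for j \<omega>
  have sp: "space (F n) = space M" for n using sub by (simp add: subalgebra_def)
  have mono: "sets (F m) \<subseteq> sets (F n)" if "m \<le> n" for m n
    using that by (induction rule: dec_induct) (use filt in blast)+
  have le: "f \<in> borel_measurable (F n)" if "f \<in> borel_measurable (F m)" "m \<le> n" for f :: "'a \<Rightarrow> real" and m n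
  proof -
    have "subalgebra (F n) (F m)" using sp mono[OF that(2)] by (simp add: subalgebra_def)
    then show ?thesis using that(1) by (rule measurable_from_subalg)
  qed
  have S_meas: "S j \<in> borel_measurable (F n)" if "j \<le> n" for j n
    unfolding S_def using that by (intro borel_measurable_sum le[OF meas]) auto
  have J_meas: "J i \<in> borel_measurable (F i)" for i
  proof -
    have "{\<omega>\<in>space (F i). \<forall>j\<in>{..i}. \<bar>S j \<omega>\<bar> < \<epsilon>} \<in> sets (F i)"
    proof (rule sets.sets_Collect_finite_All)
      fix j assume "j \<in> {..i}"
      then have [measurable]: "S j \<in> borel_measurable (F i)" by (intro S_meas) auto
      show "{\<omega>\<in>space (F i). \<bar>S j \<omega>\<bar> < \<epsilon>} \<in> sets (F i)" by measurable
    qed simp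
    moreover have "{\<omega>\<in>space (F i). \<forall>j\<in>{..i}. \<bar>S j \<omega>\<bar> < \<epsilon>} = {\<omega>\<in>space M. \<forall>j\<le>i. \<bar>S j \<omega>\<bar> < \<epsilon>}"
      by (auto simp: sp)
    ultimately have "{\<omega>\<in>space M. \<forall>j\<le>i. \<bar>S j \<omega>\<bar> < \<epsilon>} \<in> sets (F i)" by (simp only:)
    then show ?thesis unfolding J_def by (rule borel_measurable_indicator)
  qed
  have T_meas: "T j \<in> borel_measurable (F j)" for j
    unfolding T_def by (intro borel_measurable_sum borel_measurable_times le[OF meas] le[OF J_meas]) auto
  have M_meas: "f \<in> borel_measurable M" if "f \<in> borel_measurable (F n)" for f :: "'a \<Rightarrow> real" and n
    using sub that by (rule measurable_from_subalg)
  have J01: "J i \<omega> = 0 \<or> J i \<omega> = 1" for i \<omega> by (auto simp: J_def split: split_indicator)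
  have J_le: "\<bar>J i \<omega> * x\<bar> \<le> \<bar>x\<bar>" for i \<omega> x using J01[of i \<omega>] by auto
  have T_le: "\<bar>T j \<omega>\<bar> \<le> (\<Sum>i<j. a i)" if "\<omega> \<in> space M" for j \<omega>
    unfolding T_def by (rule order.trans[OF sum_abs sum_mono]) (rule order.trans[OF J_le bound[OF that]])
  have int: "integrable M f" if "f \<in> borel_measurable M" "\<And>\<omega>. \<omega> \<in> space M \<Longrightarrow> \<bar>f \<omega>\<bar> \<le> b"
    for f :: "'a \<Rightarrow> real" and b
    using that by (intro integrable_const_bound[of _ b]) auto
  have T2_int: "integrable M (\<lambda>\<omega>. (T j \<omega>)\<^sup>2)" for j
  proof (rule int)
    show "(\<lambda>\<omega>. (T j \<omega>)\<^sup>2) \<in> borel_measurable M" using M_meas[OF T_meas] by simp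
    show "\<bar>(T j \<omega>)\<^sup>2\<bar> \<le> (\<Sum>i<j. a i)\<^sup>2" if "\<omega> \<in> space M" for \<omega>
      using power_mono[OF T_le[OF that, of j], of 2] by simp
  qed
  have ET: "expectation (\<lambda>\<omega>. (T j \<omega>)\<^sup>2) \<le> (\<Sum>i<j. (a i)\<^sup>2)" for j
  proof (induction j)
    case (Suc j)
    let ?Y = "\<lambda>\<omega>. T j \<omega> * J j \<omega>"
    have Y: "?Y \<in> borel_measurable (F j)" using T_meas J_meas by (intro borel_measurable_times)
    have Y_le: "\<bar>?Y \<omega>\<bar> \<le> (\<Sum>i<j. a i)" if "\<omega> \<in> space M" for \<omega>
      using J_le[of j \<omega> "T j \<omega>"] T_le[OF that, of j] by (simp add: mult.commute)
    have "\<xi> j \<in> borel_measurable M" by (rule M_meas[OF meas])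
    note [measurable] = M_meas[OF Y] this M_meas[OF J_meas]
    have Y\<xi>: "integrable M (\<lambda>\<omega>. ?Y \<omega> * \<xi> j \<omega>)"
    proof (rule int)
      show "\<bar>?Y \<omega> * \<xi> j \<omega>\<bar> \<le> (\<Sum>i<j. a i) * a j" if "\<omega> \<in> space M" for \<omega>
        unfolding abs_mult[of "?Y \<omega>"] using Y_le[OF that] bound[OF that, of j] by (intro mult_mono) auto
    qed measurable
    have \<xi>2_le: "\<bar>J j \<omega> * (\<xi> j \<omega>)\<^sup>2\<bar> \<le> (a j)\<^sup>2" if "\<omega> \<in> space M" for \<omega>
      using J_le[of j \<omega> "(\<xi> j \<omega>)\<^sup>2"] power_mono[OF bound[OF that, of j], of 2] by simp
    have \<xi>2: "integrable M (\<lambda>\<omega>. J j \<omega> * (\<xi> j \<omega>)\<^sup>2)"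
      by (rule int[OF _ \<xi>2_le]) measurable
    \<comment> \<open>\<open>J j\<close> takes only the values 0 and 1, so its square is
      \<open>J j\<close>.\<close>
    have "(T (Suc j) \<omega>)\<^sup>2 = (T j \<omega>)\<^sup>2 + (2 * (?Y \<omega> * \<xi> j \<omega>) + J j \<omega> * (\<xi> j \<omega>)\<^sup>2)" for \<omega>
      using J01[of j \<omega>] by (auto simp: T_def power2_eq_square algebra_simps)
    then have "expectation (\<lambda>\<omega>. (T (Suc j) \<omega>)\<^sup>2) =
        expectation (\<lambda>\<omega>. (T j \<omega>)\<^sup>2) + (2 * expectation (\<lambda>\<omega>. ?Y \<omega> * \<xi> j \<omega>) + expectation (\<lambda>\<omega>. J j \<omega> * (\<xi> j \<omega>)\<^sup>2))"
      using T2_int Y\<xi> \<xi>2 by simp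
    \<comment> \<open>\<open>?Y\<close> is bounded and determined by the past, so the cross term
      vanishes by orthogonality.\<close>
    also have "expectation (\<lambda>\<omega>. ?Y \<omega> * \<xi> j \<omega>) = 0" using Y_le by (intro orth[OF Y]) blast
    also have "expectation (\<lambda>\<omega>. J j \<omega> * (\<xi> j \<omega>)\<^sup>2) \<le> (a j)\<^sup>2"
      using \<xi>2_le by (intro integral_le_const[OF \<xi>2] AE_I2) (auto dest: abs_le_D1)
    finally show ?case using Suc by simp
  qed (simp add: T_def)
  have T_ge: "\<epsilon> \<le> \<bar>T k \<omega>\<bar>" if \<omega>: "\<omega> \<in> space M" "\<exists>j\<le>k. \<epsilon> \<le> \<bar>S j \<omega>\<bar>" for \<omega>
  proof -
    obtain j' where j': "j' \<le> k" "\<epsilon> \<le> \<bar>S j' \<omega>\<bar>" using \<omega>(2) by blast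
    define j where "j = (LEAST j. \<epsilon> \<le> \<bar>S j \<omega>\<bar>)"
    have j: "\<epsilon> \<le> \<bar>S j \<omega>\<bar>" unfolding j_def using j'(2) by (rule LeastI)
    have j_less: "\<bar>S i \<omega>\<bar> < \<epsilon>" if "i < j" for i
      using not_less_Least[of i "\<lambda>j. \<epsilon> \<le> \<bar>S j \<omega>\<bar>"] that unfolding j_def by linarith
    have "j \<le> j'" unfolding j_def using j'(2) by (rule Least_le)
    then have "j \<le> k" using j'(1) by simp
    have J0: "J i \<omega> = 0" if "j \<le> i" for i
      using j that unfolding J_def indicator_def by (auto simp: not_less)
    have J1: "J i \<omega> = 1" if "i < j" for i
      using j_less \<omega>(1) that unfolding J_def indicator_def by auto
    \<comment> \<open>From the first passage time \<open>j\<close> on, the stopped sum keeps the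
      value \<open>S j\<close>, which has already reached the threshold.\<close>
    have "T k \<omega> = (\<Sum>i<j. J i \<omega> * \<xi> i \<omega>)"
      unfolding T_def by (rule sum.mono_neutral_right) (use \<open>j \<le> k\<close> J0 in auto)
    also have "\<dots> = S j \<omega>"
      unfolding S_def by (rule sum.cong) (simp_all add: J1)
    finally show ?thesis using j by simp
  qed
  have T2_meas: "(\<lambda>\<omega>. (T k \<omega>)\<^sup>2) \<in> borel_measurable M" using M_meas[OF T_meas] by simp
  have "prob {\<omega>\<in>space M. \<exists>j\<le>k. \<epsilon> \<le> \<bar>S j \<omega>\<bar>} \<le> prob {\<omega>\<in>space M. \<epsilon>\<^sup>2 \<le> (T k \<omega>)\<^sup>2}"
  proof (rule finite_measure_mono)
    show "{\<omega>\<in>space M. \<exists>j\<le>k. \<epsilon> \<le> \<bar>S j \<omega>\<bar>} \<subseteq> {\<omega>\<in>space M. \<epsilon>\<^sup>2 \<le> (T k \<omega>)\<^sup>2}"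
      using T_ge \<open>\<epsilon> > 0\<close> by (auto simp: abs_le_square_iff[symmetric])
    show "{\<omega>\<in>space M. \<epsilon>\<^sup>2 \<le> (T k \<omega>)\<^sup>2} \<in> events" using T2_meas by measurable
  qed
  also have "\<dots> \<le> expectation (\<lambda>\<omega>. (T k \<omega>)\<^sup>2) / \<epsilon>\<^sup>2"
    by (rule integral_Markov_inequality_measure[where A = "{}"]) (use T2_int \<open>\<epsilon> > 0\<close> in auto)
  also have "\<dots> \<le> (\<Sum>i<k. (a i)\<^sup>2) / \<epsilon>\<^sup>2" using ET by (intro divide_right_mono) auto
  finally show ?thesis by (simp add: S_def)
qed

text \<open>The maximal inequality, applied to the series after time \<open>m\<close>, gives a bound
  independent of the horizon, which therefore holds for the whole tail. It tends to 0 with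
  \<open>m\<close>, and almost surely the partial sums are Cauchy.\<close>

lemma (in prob_space) martingale_differences_summable:
  fixes \<xi> :: "nat \<Rightarrow> 'a \<Rightarrow> real"
  assumes sub: "\<And>n. subalgebra M (F n)" and filt: "\<And>n. sets (F n) \<subseteq> sets (F (Suc n))"
    and meas: "\<And>n. \<xi> n \<in> borel_measurable (F (Suc n))"
    and bound: "\<And>n \<omega>. \<omega> \<in> space M \<Longrightarrow> \<bar>\<xi> n \<omega>\<bar> \<le> a n"
    and sq: "summable (\<lambda>n. (a n)\<^sup>2)"
    and orth: "\<And>n Y. Y \<in> borel_measurable (F n) \<Longrightarrow> (\<exists>b. \<forall>\<omega>\<in>space M. \<bar>Y \<omega>\<bar> \<le> b) \<Longrightarrow>
       expectation (\<lambda>\<omega>. Y \<omega> * \<xi> n \<omega>) = 0"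
  shows "AE \<omega> in M. summable (\<lambda>n. \<xi> n \<omega>)"
proof -
  define tail where "tail m = (\<Sum>i. (a (i + m))\<^sup>2)" for m
  have tail_lim: "tail \<longlonglongrightarrow> 0"
    unfolding tail_def using suminf_exist_split2[OF sq] by simp
  have \<xi>_meas: "\<xi> n \<in> borel_measurable M" for n using sub meas by (rule measurable_from_subalg)
  define D where "D m j \<omega> = (\<Sum>i<j. \<xi> (i + m) \<omega>)" for m j \<omega>
  have D_meas: "D m j \<in> borel_measurable M" for m j
    unfolding D_def by (intro borel_measurable_sum \<xi>_meas)
  define B where "B \<epsilon> m k = {\<omega>\<in>space M. \<exists>j\<le>k. \<epsilon> \<le> \<bar>D m j \<omega>\<bar>}" for \<epsilon> m and k :: nat
  have B_meas: "B \<epsilon> m k \<in> events" for \<epsilon> m k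
  proof -
    have "{\<omega>\<in>space M. \<exists>j\<in>{..k}. \<epsilon> \<le> \<bar>D m j \<omega>\<bar>} \<in> events"
    proof (rule sets.sets_Collect_finite_Ex)
      show "{\<omega>\<in>space M. \<epsilon> \<le> \<bar>D m j \<omega>\<bar>} \<in> events" for j
        using D_meas[of m j] by measurable
    qed simp
    moreover have "{\<omega>\<in>space M. \<exists>j\<in>{..k}. \<epsilon> \<le> \<bar>D m j \<omega>\<bar>} = B \<epsilon> m k" unfolding B_def by blast
    ultimately show ?thesis by (simp only:)
  qed
  have B_le: "prob (B \<epsilon> m k) \<le> tail m / \<epsilon>\<^sup>2" if "\<epsilon> > 0" for \<epsilon> m k
  proof -
    have "prob (B \<epsilon> m k) \<le> (\<Sum>i<k. (a (i + m))\<^sup>2) / \<epsilon>\<^sup>2"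
      unfolding B_def D_def
      by (rule martingale_maximal_inequality[where F = "\<lambda>n. F (n + m)"])
        (use sub filt meas bound orth that in auto)
    also have "\<dots> \<le> tail m / \<epsilon>\<^sup>2"
      unfolding tail_def
      by (intro divide_right_mono sum_le_suminf summable_ignore_initial_segment[OF sq]) auto
    finally show ?thesis .
  qed
  have AE1: "AE \<omega> in M. \<exists>m. \<forall>j. \<bar>D m j \<omega>\<bar> < \<epsilon>" if "\<epsilon> > 0" for \<epsilon>
  proof -
    \<comment> \<open>The event that every tail, however late, has a partial sum reaching
      \<open>\<epsilon>\<close>; its probability is below all the bounds
      \<open>tail m / \<epsilon>\<^sup>2\<close>.\<close>
    define N where "N = (\<Inter>m. \<Union>k. B \<epsilon> m k)"
    have [measurable]: "B \<epsilon> m k \<in> events" for m k by (rule B_meas)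
    have N_meas: "N \<in> events" unfolding N_def by measurable
    have U_le: "prob (\<Union>k. B \<epsilon> m k) \<le> tail m / \<epsilon>\<^sup>2" for m
    proof (rule LIMSEQ_le_const2)
      show "(\<lambda>k. prob (B \<epsilon> m k)) \<longlonglongrightarrow> prob (\<Union>k. B \<epsilon> m k)"
      proof (rule finite_Lim_measure_incseq)
        have "B \<epsilon> m k \<subseteq> B \<epsilon> m k'" if "k \<le> k'" for k k'
          unfolding B_def using order.trans[OF _ that] by blast
        then show "incseq (B \<epsilon> m)" by (simp add: incseq_def)
      qed (use B_meas in auto)
      show "\<exists>N. \<forall>n\<ge>N. prob (B \<epsilon> m n) \<le> tail m / \<epsilon>\<^sup>2" using B_le[OF that] by blast
    qed
    have "prob N \<le> tail m / \<epsilon>\<^sup>2" for m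
    proof -
      have "prob N \<le> prob (\<Union>k. B \<epsilon> m k)"
        unfolding N_def using B_meas by (intro finite_measure_mono sets.countable_UN) auto
      then show ?thesis using U_le[of m] by linarith
    qed
    moreover have "(\<lambda>m. tail m / \<epsilon>\<^sup>2) \<longlonglongrightarrow> 0" using tendsto_divide[OF tail_lim tendsto_const] that by fastforce
    ultimately have "prob N \<le> 0" by (meson LIMSEQ_le_const)
    then have "prob N = 0" by (simp add: measure_le_0_iff)
    then have "N \<in> null_sets M" using N_meas by (simp add: emeasure_eq_measure null_sets_def)
    then have "AE \<omega> in M. \<omega> \<notin> N" by (rule AE_not_in)
    then show ?thesis
    proof (rule AE_mp, intro AE_I2 impI)
      fix \<omega> assume "\<omega> \<in> space M" "\<omega> \<notin> N"
      then obtain m where "\<And>k. \<omega> \<notin> B \<epsilon> m k" by (auto simp: N_def)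
      then have "\<forall>j. \<bar>D m j \<omega>\<bar> < \<epsilon>" using \<open>\<omega> \<in> space M\<close> by (auto simp: B_def not_le)
      then show "\<exists>m. \<forall>j. \<bar>D m j \<omega>\<bar> < \<epsilon>" by blast
    qed
  qed
  \<comment> \<open>Countably many thresholds suffice for the Cauchy property and share one null
    set.\<close>
  have "AE \<omega> in M. \<forall>n::nat. \<exists>m. \<forall>j. \<bar>D m j \<omega>\<bar> < inverse (real (Suc n))"
    by (subst AE_all_countable) (intro allI AE1, simp)
  then show ?thesis
  proof (rule AE_mp, intro AE_I2 impI)
    fix \<omega> assume *: "\<forall>n::nat. \<exists>m. \<forall>j. \<bar>D m j \<omega>\<bar> < inverse (real (Suc n))"
    have "Cauchy (\<lambda>n. \<Sum>i<n. \<xi> i \<omega>)"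
    proof (rule metric_CauchyI)
      fix e :: real assume "e > 0"
      then obtain n where n: "inverse (real (Suc n)) < e / 2" using reals_Archimedean[of "e / 2"] by auto
      obtain m where m: "\<And>j. \<bar>D m j \<omega>\<bar> < e / 2" using * n by (meson less_trans)
      have split: "(\<Sum>i<p. \<xi> i \<omega>) = (\<Sum>i<m. \<xi> i \<omega>) + D m (p - m) \<omega>" if "p \<ge> m" for p
      proof -
        have "D m (p - m) \<omega> = (\<Sum>i=m..<p. \<xi> i \<omega>)"
          unfolding D_def using sum.shift_bounds_nat_ivl[of "\<lambda>i. \<xi> i \<omega>" 0 m "p - m"] that
          by (simp add: lessThan_atLeast0)
        then show ?thesis
          using sum.atLeastLessThan_concat[of 0 m p "\<lambda>i. \<xi> i \<omega>"] that by (simp add: lessThan_atLeast0)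
      qed
      show "\<exists>M. \<forall>p\<ge>M. \<forall>q\<ge>M. dist (\<Sum>i<p. \<xi> i \<omega>) (\<Sum>i<q. \<xi> i \<omega>) < e"
      proof (intro exI[of _ m] allI impI)
        fix p q assume "p \<ge> m" "q \<ge> m"
        then show "dist (\<Sum>i<p. \<xi> i \<omega>) (\<Sum>i<q. \<xi> i \<omega>) < e"
          using m[of "p - m"] m[of "q - m"]
          unfolding split[OF \<open>p \<ge> m\<close>] split[OF \<open>q \<ge> m\<close>] dist_real_def by linarith
      qed
    qed
    then show "summable (\<lambda>n. \<xi> n \<omega>)"
      by (simp add: summable_iff_convergent Cauchy_convergent_iff)
  qed
qed

text \<open>
  A sequence whose increments are dominated by the weights cannot stay away from zero on a long
  stretch of small weighted sum, hence it converges to zero without any further averaging.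
\<close>

lemma weighted_summable_imp_tendsto_zero:
  fixes \<gamma> h :: "nat \<Rightarrow> real"
  assumes \<gamma>: "\<And>t. \<gamma> t > 0" "filterlim (\<lambda>n. \<Sum>t<n. \<gamma> t) at_top sequentially" "\<gamma> \<longlonglongrightarrow> 0"
    and h: "\<And>t. h t \<ge> 0" "summable (\<lambda>t. \<gamma> t * h t)"
    and incr: "\<forall>\<^sub>F t in sequentially. \<bar>h (Suc t) - h t\<bar> \<le> \<kappa> * \<gamma> t"
  shows "h \<longlonglongrightarrow> 0"
proof (rule LIMSEQ_I)
  fix r :: real assume "r > 0"
  \<comment> \<open>The final bound is \<open>3 * \<epsilon>\<close>: two from the growth estimate
    and one from the tail of the weighted series.\<close>
  define \<epsilon> where "\<epsilon> = r / 4"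
  define c where "c = \<bar>\<kappa>\<bar> + 1"
  have c: "c > 0" "\<kappa> \<le> c" by (auto simp: c_def)
  have \<epsilon>: "\<epsilon> > 0" using \<open>r > 0\<close> by (simp add: \<epsilon>_def)
  obtain N1 where N1: "\<And>t. t \<ge> N1 \<Longrightarrow> \<bar>h (Suc t) - h t\<bar> \<le> \<kappa> * \<gamma> t"
    using incr by (auto simp: eventually_sequentially)
  obtain N2 where N2: "\<And>t. t \<ge> N2 \<Longrightarrow> \<gamma> t < \<epsilon> / c"
    using order_tendstoD(2)[OF \<gamma>(3), of "\<epsilon> / c"] \<epsilon> c(1) by (auto simp: eventually_sequentially)
  \<comment> \<open>The threshold is such that tails multiplied by \<open>c / \<epsilon>\<close>
    stay below \<open>\<epsilon>\<close>.\<close>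
  obtain N3 where N3: "\<And>m n. m \<ge> N3 \<Longrightarrow> norm (\<Sum>t=m..<n. \<gamma> t * h t) < \<epsilon> * \<epsilon> / c"
    using h(2) \<epsilon> c(1) unfolding summable_Cauchy by (meson divide_pos_pos mult_pos_pos)
  define N where "N = max N1 (max N2 N3)"
  \<comment> \<open>If \<open>h\<close> stayed above \<open>\<epsilon>\<close>, the weights would be
    dominated by the summable \<open>\<gamma> t * h t / \<epsilon>\<close>, against their
    divergence.\<close>
  have "\<exists>m\<ge>N. h m < \<epsilon>"
  proof (rule ccontr)
    assume "\<not> (\<exists>m\<ge>N. h m < \<epsilon>)"
    then have "norm (\<gamma> t) \<le> inverse \<epsilon> * (\<gamma> t * h t)" if "t \<ge> N" for t
      using that \<gamma>(1)[of t] \<epsilon> by (auto simp: field_simps not_less)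
    then have "summable \<gamma>"
      by (intro summable_comparison_test[OF _ summable_mult[OF h(2), of "inverse \<epsilon>"]]) blast
    then have "(\<lambda>n. \<Sum>t<n. \<gamma> t) \<longlonglongrightarrow> suminf \<gamma>" by (rule summable_LIMSEQ)
    then show False using \<gamma>(2) not_tendsto_and_filterlim_at_infinity[OF sequentially_bot]
        filterlim_at_top_imp_at_infinity by blast
  qed
  then obtain m where m: "m \<ge> N" "h m < \<epsilon>" by blast
  \<comment> \<open>From below \<open>\<epsilon>\<close>, one step ends below
    \<open>2 * \<epsilon>\<close>. From above, the increment \<open>c * \<gamma> n\<close> is paid
    for by the term \<open>\<gamma> n * h n\<close> of the weighted sum.\<close>
  have "h n \<le> 2 * \<epsilon> + c / \<epsilon> * (\<Sum>t=m..<n. \<gamma> t * h t)" if "n \<ge> m" for n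
    using that
  proof (induction n rule: dec_induct)
    case base
    then show ?case using m \<epsilon> by simp
  next
    case (step n)
    let ?s = "\<lambda>n. \<Sum>t=m..<n. \<gamma> t * h t"
    have "h (Suc n) \<le> h n + c * \<gamma> n"
    proof -
      have "\<kappa> * \<gamma> n \<le> c * \<gamma> n" using c(2) \<gamma>(1)[of n] by (intro mult_right_mono) auto
      moreover have "\<bar>h (Suc n) - h n\<bar> \<le> \<kappa> * \<gamma> n" using step(1) m(1) by (intro N1) (auto simp: N_def)
      ultimately show ?thesis by linarith
    qed
    moreover have s: "?s (Suc n) = ?s n + \<gamma> n * h n" using step(1) by simp
    ultimately show ?case
    proof (cases "h n < \<epsilon>")
      case True
      have "c * \<gamma> n \<le> \<epsilon>" using N2[of n] c(1) step(1) m(1) by (auto simp: N_def field_simps)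
      moreover have "?s (Suc n) \<ge> 0" using \<gamma>(1) h(1) by (intro sum_nonneg mult_nonneg_nonneg) (auto intro: less_imp_le)
      then have "c / \<epsilon> * ?s (Suc n) \<ge> 0" using c(1) \<epsilon> by simp
      ultimately show ?thesis using \<open>h (Suc n) \<le> h n + c * \<gamma> n\<close> True by linarith
    next
      case False
      then have "c * \<gamma> n \<le> c / \<epsilon> * (\<gamma> n * h n)"
        using c(1) \<epsilon> \<gamma>(1)[of n] by (simp add: field_simps)
      then show ?thesis using \<open>h (Suc n) \<le> h n + c * \<gamma> n\<close> step(3) s by (simp add: distrib_left)
    qed
  qed
  note le = this
  have less: "c / \<epsilon> * (\<Sum>t=m..<n. \<gamma> t * h t) < \<epsilon>" for n
  proof -
    have "(\<Sum>t=m..<n. \<gamma> t * h t) < \<epsilon> * \<epsilon> / c" using N3[of m n] m(1) by (simp add: N_def)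
    then show ?thesis using c(1) \<epsilon> by (simp add: field_simps)
  qed
  have "h n < r" if "n \<ge> m" for n
    using le[OF that] less[of n] \<open>r > 0\<close> unfolding \<epsilon>_def by linarith
  then show "\<exists>no. \<forall>n\<ge>no. norm (h n - 0) < r" using h(1) by (intro exI[of _ m]) auto
qed

text \<open>Telescoping expresses the partial sums of \<open>\<gamma> t * h t\<close> through a
  convergent series and the bounded \<open>X\<close>. Having nonnegative terms, they converge, and
  then so does \<open>X\<close>.\<close>

lemma descent_converges:
  fixes X h \<gamma> \<eta> r :: "nat \<Rightarrow> real"
  assumes \<gamma>: "\<And>t. \<gamma> t > 0" "filterlim (\<lambda>n. \<Sum>t<n. \<gamma> t) at_top sequentially" "\<gamma> \<longlonglongrightarrow> 0"
    and h: "\<And>t. h t \<ge> 0" and X: "\<And>t. \<bar>X t\<bar> \<le> b"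
    and noise: "summable \<eta>" and err: "summable r"
    and step: "\<forall>\<^sub>F t in sequentially. \<bar>X (Suc t) - X t + \<gamma> t * h t + \<eta> t\<bar> \<le> r t"
    and incr: "\<forall>\<^sub>F t in sequentially. \<bar>h (Suc t) - h t\<bar> \<le> \<kappa> * \<gamma> t"
  shows "convergent X \<and> h \<longlonglongrightarrow> 0"
proof -
  define e where "e t = X (Suc t) - X t + \<gamma> t * h t" for t
  have "summable (\<lambda>t. e t + \<eta> t)"
    by (rule summable_comparison_test_ev[OF _ err]) (use step in \<open>simp add: e_def\<close>)
  from summable_diff[OF this noise] have e: "summable e" by simp
  have sum_e: "(\<Sum>t<n. e t) = X n - X 0 + (\<Sum>t<n. \<gamma> t * h t)" for n
    by (induction n) (auto simp: e_def)
  obtain b' where b': "\<And>n. norm (\<Sum>t<n. e t) \<le> b'"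
    using convergent_imp_Bseq[OF summable_iff_convergent[THEN iffD1, OF e]] by (auto simp: Bseq_def)
  have \<gamma>h: "\<gamma> t * h t \<ge> 0" for t using \<gamma>(1)[of t] h[of t] by simp
  have "summable (\<lambda>t. \<gamma> t * h t)"
  proof (rule summableI_nonneg_bounded[of _ "b' + 2 * b"])
    show "(\<Sum>t<n. \<gamma> t * h t) \<le> b' + 2 * b" for n
      using sum_e[of n] b'[of n] X[of n] X[of 0] by (simp add: abs_le_iff)
  qed (rule \<gamma>h)
  then have "h \<longlonglongrightarrow> 0"
    by (intro weighted_summable_imp_tendsto_zero[OF \<gamma> h _ incr])
  moreover have "convergent (\<lambda>n. X 0 + (\<Sum>t<n. e t) - (\<Sum>t<n. \<gamma> t * h t))"
    using e \<open>summable (\<lambda>t. \<gamma> t * h t)\<close>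
    by (intro convergent_diff convergent_add convergent_const) (auto simp: summable_iff_convergent)
  then have "convergent X" by (simp add: sum_e)
  ultimately show ?thesis by blast
qed

text \<open>The sigma-algebra generated by the samples before time \<open>t\<close>; leaving out
  \<open>z t\<close> makes the next sample independent of it. As the preimage algebra of a single
  map into a product space, it fits the form in which independence of blocks is stated.\<close>

definition past :: "'w measure \<Rightarrow> 'z measure \<Rightarrow> (nat \<Rightarrow> 'w \<Rightarrow> 'z) \<Rightarrow> nat \<Rightarrow> 'w measure" where
  "past \<Omega> P z t = vimage_algebra (space \<Omega>) (\<lambda>\<omega>. \<lambda>i\<in>{..<t}. z i \<omega>) (PiM {..<t} (\<lambda>_. P))"

lemma space_past [simp]: "space (past \<Omega> P z t) = space \<Omega>"
  by (simp add: past_def)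

lemma past_restrict_measurable:
  assumes "\<And>i. z i \<in> \<Omega> \<rightarrow>\<^sub>M P"
  shows "(\<lambda>\<omega>. \<lambda>i\<in>{..<t}. z i \<omega>) \<in> \<Omega> \<rightarrow>\<^sub>M PiM {..<t} (\<lambda>_. P)"
  using assms by (intro measurable_restrict) auto

lemma sets_past:
  assumes "\<And>i. z i \<in> \<Omega> \<rightarrow>\<^sub>M P"
  shows "sets (past \<Omega> P z t) =
    {(\<lambda>\<omega>. \<lambda>i\<in>{..<t}. z i \<omega>) -` B \<inter> space \<Omega> | B. B \<in> sets (PiM {..<t} (\<lambda>_. P))}"
  unfolding past_def using measurable_space[OF past_restrict_measurable[where z = z, OF assms]]
  by (intro sets_vimage_algebra2) blast

lemma past_subalgebra:
  assumes "\<And>i. z i \<in> \<Omega> \<rightarrow>\<^sub>M P"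
  shows "subalgebra \<Omega> (past \<Omega> P z t)"
  using measurable_sets[OF past_restrict_measurable[where z = z, OF assms]]
  unfolding subalgebra_def sets_past[where z = z, OF assms] by auto

lemma past_measurable:
  assumes "\<And>i. z i \<in> \<Omega> \<rightarrow>\<^sub>M P" "i < t"
  shows "z i \<in> past \<Omega> P z t \<rightarrow>\<^sub>M P"
proof -
  have 1: "(\<lambda>\<omega>. \<lambda>i\<in>{..<t}. z i \<omega>) \<in> past \<Omega> P z t \<rightarrow>\<^sub>M PiM {..<t} (\<lambda>_. P)"
    unfolding past_def using measurable_space[OF past_restrict_measurable[where z = z, OF assms(1)]]
    by (intro measurable_vimage_algebra1) auto
  have "(\<lambda>f. f i) \<in> PiM {..<t} (\<lambda>_. P) \<rightarrow>\<^sub>M P"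
    using assms(2) by (intro measurable_component_singleton) auto
  from measurable_compose[OF 1 this] show ?thesis using assms(2) by simp
qed

lemma past_mono:
  assumes "\<And>i. z i \<in> \<Omega> \<rightarrow>\<^sub>M P"
  shows "sets (past \<Omega> P z t) \<subseteq> sets (past \<Omega> P z (Suc t))"
proof -
  have "(\<lambda>\<omega>. \<lambda>i\<in>{..<t}. z i \<omega>) \<in> past \<Omega> P z (Suc t) \<rightarrow>\<^sub>M PiM {..<t} (\<lambda>_. P)"
    using past_measurable[where z = z, OF assms] by (intro measurable_restrict) auto
  from measurable_sets[OF this] show ?thesis
    unfolding sets_past[where z = z and t = t, OF assms] by auto
qed

text \<open>
  Since \<open>indep_var\<close> relates only variables with values in the same type, the law of \<open>(\<omega>, z t \<omega>)\<close> is
  determined on rectangles.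
\<close>

lemma (in prob_space) expectation_given_past:
  fixes \<phi> :: "'z \<Rightarrow> 'a \<Rightarrow> real"
  assumes indep: "indep_vars (\<lambda>_. P) z (UNIV :: nat set)" and law: "distr M P (z t) = P"
    and meas: "(\<lambda>(\<zeta>, \<omega>). \<phi> \<zeta> \<omega>) \<in> borel_measurable (P \<Otimes>\<^sub>M past M P z t)"
    and bound: "\<And>\<zeta> \<omega>. \<zeta> \<in> space P \<Longrightarrow> \<omega> \<in> space M \<Longrightarrow> \<bar>\<phi> \<zeta> \<omega>\<bar> \<le> b"
  shows "expectation (\<lambda>\<omega>. \<phi> (z t \<omega>) \<omega>) = expectation (\<lambda>\<omega>. \<integral>\<zeta>. \<phi> \<zeta> \<omega> \<partial>P)"
proof -
  let ?F = "past M P z t"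
  have z: "\<And>i. z i \<in> M \<rightarrow>\<^sub>M P" using indep by (auto simp: indep_vars_def)
  \<comment> \<open>Pushing the probability forward along the identity restricts it to the events of
    the past.\<close>
  have id: "(\<lambda>\<omega>. \<omega>) \<in> M \<rightarrow>\<^sub>M ?F"
    using past_subalgebra[where z = z and t = t, OF z] by (auto simp: subalgebra_def intro!: measurableI sets.Int)
  \<comment> \<open>The new sample enters as a family over the singleton \<open>{t}\<close>, so that
    both variables are functions of the same type.\<close>
  have ind: "indep_var (PiM {..<t} (\<lambda>_. P)) (\<lambda>\<omega>. \<lambda>i\<in>{..<t}. z i \<omega>) (PiM {t} (\<lambda>_. P)) (\<lambda>\<omega>. \<lambda>i\<in>{t}. z i \<omega>)"
    by (rule indep_var_restrict[OF indep]) auto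
  have prod: "prob (A \<inter> (z t -` B \<inter> space M)) = prob A * prob (z t -` B \<inter> space M)"
    if "A \<in> sets ?F" "B \<in> sets P" for A B
  proof -
    obtain A' where A': "A' \<in> sets (PiM {..<t} (\<lambda>_. P))" "A = (\<lambda>\<omega>. \<lambda>i\<in>{..<t}. z i \<omega>) -` A' \<inter> space M"
      using \<open>A \<in> sets ?F\<close> unfolding sets_past[where z = z, OF z] by blast
    define B' where "B' = (\<lambda>f. f t) -` B \<inter> space (PiM {t} (\<lambda>_. P))"
    have B': "B' \<in> sets (PiM {t} (\<lambda>_. P))"
      unfolding B'_def using \<open>B \<in> sets P\<close> by (intro measurable_sets[OF measurable_component_singleton]) auto
    have e1: "(\<lambda>\<omega>. \<lambda>i\<in>{t}. z i \<omega>) -` B' \<inter> space M = z t -` B \<inter> space M"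
      using measurable_space[OF z] by (auto simp: B'_def space_PiM)
    have e2: "(\<lambda>\<omega>. (\<lambda>i\<in>{..<t}. z i \<omega>, \<lambda>i\<in>{t}. z i \<omega>)) -` (A' \<times> B') \<inter> space M
        = A \<inter> ((\<lambda>\<omega>. \<lambda>i\<in>{t}. z i \<omega>) -` B' \<inter> space M)"
      unfolding A'(2) by auto
    show ?thesis
      using indep_varD[OF ind A'(1) B'] unfolding e2 A'(2)[symmetric] e1 .
  qed
  interpret law: prob_space P using prob_space_distr[OF z[of t]] by (simp add: law)
  interpret D: prob_space "distr M ?F (\<lambda>\<omega>. \<omega>)" by (rule prob_space_distr[OF id])
  have pair: "(\<lambda>\<omega>. (\<omega>, z t \<omega>)) \<in> M \<rightarrow>\<^sub>M ?F \<Otimes>\<^sub>M P" using id z by (rule measurable_Pair)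
  have joint: "distr M ?F (\<lambda>\<omega>. \<omega>) \<Otimes>\<^sub>M P = distr M (?F \<Otimes>\<^sub>M P) (\<lambda>\<omega>. (\<omega>, z t \<omega>))"
  proof (rule pair_measure_eqI)
    show "sets (distr M ?F (\<lambda>\<omega>. \<omega>) \<Otimes>\<^sub>M P) = sets (distr M (?F \<Otimes>\<^sub>M P) (\<lambda>\<omega>. (\<omega>, z t \<omega>)))"
      unfolding sets_distr by (rule sets_pair_measure_cong) simp_all
    fix A B assume "A \<in> sets (distr M ?F (\<lambda>\<omega>. \<omega>))" and B: "B \<in> sets P"
    then have A: "A \<in> sets ?F" by simp
    have sub: "A \<subseteq> space M" using sets.sets_into_space[OF A] by simp
    have "emeasure P B = emeasure M (z t -` B \<inter> space M)"
      using emeasure_distr[OF z[of t] B] by (simp add: law)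
    moreover have "emeasure (distr M ?F (\<lambda>\<omega>. \<omega>)) A = emeasure M A"
      using emeasure_distr[OF id A] sub by (simp add: Int_absorb2)
    moreover have "emeasure (distr M (?F \<Otimes>\<^sub>M P) (\<lambda>\<omega>. (\<omega>, z t \<omega>))) (A \<times> B)
        = emeasure M (A \<inter> (z t -` B \<inter> space M))"
      by (subst emeasure_distr[OF pair]) (use A B sub in \<open>auto intro!: arg_cong[where f = "emeasure M"]\<close>)
    ultimately show "emeasure (distr M ?F (\<lambda>\<omega>. \<omega>)) A * emeasure P B
        = emeasure (distr M (?F \<Otimes>\<^sub>M P) (\<lambda>\<omega>. (\<omega>, z t \<omega>))) (A \<times> B)"
      using prod[OF A B] by (simp add: emeasure_eq_measure ennreal_mult'')
  qed (rule D.sigma_finite_measure_axioms law.sigma_finite_measure_axioms)+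
  have [measurable]: "(\<lambda>(\<omega>, \<zeta>). \<phi> \<zeta> \<omega>) \<in> borel_measurable (?F \<Otimes>\<^sub>M P)"
    using measurable_pair_swap[OF meas] by simp
  interpret pair: pair_prob_space "distr M ?F (\<lambda>\<omega>. \<omega>)" P ..
  have int: "integrable (distr M ?F (\<lambda>\<omega>. \<omega>) \<Otimes>\<^sub>M P) (\<lambda>(\<omega>, \<zeta>). \<phi> \<zeta> \<omega>)"
    by (rule pair.P.integrable_const_bound[where B = b]) (use bound in \<open>auto simp: space_pair_measure\<close>)
  have "expectation (\<lambda>\<omega>. \<phi> (z t \<omega>) \<omega>) = (\<integral>x. (\<lambda>(\<omega>, \<zeta>). \<phi> \<zeta> \<omega>) x \<partial>distr M (?F \<Otimes>\<^sub>M P) (\<lambda>\<omega>. (\<omega>, z t \<omega>)))"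
    using id z by (subst integral_distr) auto
  also have "\<dots> = (\<integral>\<omega>. (\<integral>\<zeta>. \<phi> \<zeta> \<omega> \<partial>P) \<partial>distr M ?F (\<lambda>\<omega>. \<omega>))"
    unfolding joint[symmetric] by (rule pair.integral_fst[OF int, symmetric])
  also have "\<dots> = expectation (\<lambda>\<omega>. \<integral>\<zeta>. \<phi> \<zeta> \<omega> \<partial>P)"
    by (rule integral_distr[OF id]) measurable
  finally show ?thesis .
qed

section \<open>Measurability through charts\<close>

context riemannian_manifold
begin

text \<open>The manifold is second countable, hence Lindelof. Countability is what allows
  measurability to be glued from the chart domains.\<close>

lemma countable_charts: obtains A0 where "A0 \<subseteq> A" "countable A0" "(\<Union>c\<in>A0. chart_dom c) = UNIV"
proof -
  obtain \<F> where \<F>: "\<F> \<subseteq> chart_dom ` A" "countable \<F>" "\<Union>\<F> = \<Union>(chart_dom ` A)"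
    using Lindelof[of "chart_dom ` A"] open_dom by blast
  obtain A0 where "A0 \<subseteq> A" "countable A0" "\<F> = chart_dom ` A0"
    using \<F>(1,2) by (metis countable_subset_image)
  moreover have "\<Union>(chart_dom ` A) = UNIV" using chart_cover by blast
  ultimately show thesis using that \<F>(3) by simp
qed

text \<open>On the preimage of each chart domain, \<open>f\<close> is a continuous function of the
  random point and of the coordinates of the random vector. This stands in for measurability with
  respect to the tangent bundle.\<close>

lemma chartwise_measurable:
  fixes \<Phi> :: "('m, 'e) chart \<Rightarrow> 'm \<times> 'e \<Rightarrow> 'x::topological_space"
  assumes p: "p \<in> N \<rightarrow>\<^sub>M borel"
    and v: "\<And>c. c \<in> A \<Longrightarrow> (\<lambda>\<omega>. v \<omega> c) \<in> borel_measurable (restrict_space N (p -` chart_dom c \<inter> space N))"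
    and \<Phi>: "\<And>c. c \<in> A \<Longrightarrow> continuous_on (chart_dom c \<times> UNIV) (\<Phi> c)"
    and eq: "\<And>c \<omega>. c \<in> A \<Longrightarrow> \<omega> \<in> space N \<Longrightarrow> p \<omega> \<in> chart_dom c \<Longrightarrow> f \<omega> = \<Phi> c (p \<omega>, v \<omega> c)"
  shows "f \<in> N \<rightarrow>\<^sub>M borel"
proof -
  obtain A0 where A0: "A0 \<subseteq> A" "countable A0" "(\<Union>c\<in>A0. chart_dom c) = UNIV"
    using countable_charts .
  show ?thesis
  proof (rule measurable_piecewise_restrict[where C = "(\<lambda>c. p -` chart_dom c \<inter> space N) ` A0"])
    show "countable ((\<lambda>c. p -` chart_dom c \<inter> space N) ` A0)" using A0(2) by simp
    show "space N \<subseteq> \<Union> ((\<lambda>c. p -` chart_dom c \<inter> space N) ` A0)"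
      using A0(3) by (auto simp: set_eq_iff)
    fix X assume "X \<in> (\<lambda>c. p -` chart_dom c \<inter> space N) ` A0"
    then obtain c where c: "c \<in> A" and X: "X = p -` chart_dom c \<inter> space N" using A0(1) by blast
    show "X \<inter> space N \<in> sets N"
      using measurable_sets[OF p, of "chart_dom c"] open_dom[OF c] by (simp add: X Int_absorb2)
    have sp: "space (restrict_space N X) = X" by (auto simp: space_restrict_space X)
    have "(\<lambda>\<omega>. (p \<omega>, v \<omega> c)) \<in> borel_measurable (restrict_space N X)"
      using measurable_restrict_space1[OF p] v[OF c] by (intro borel_measurable_Pair) (auto simp: X)
    then have "(\<lambda>\<omega>. (p \<omega>, v \<omega> c)) \<in> restrict_space N X \<rightarrow>\<^sub>M restrict_space borel (chart_dom c \<times> UNIV)"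
      by (intro measurable_restrict_space2) (unfold sp, auto simp: X)
    from measurable_compose[OF this borel_measurable_continuous_on_restrict[OF \<Phi>[OF c]]]
    show "f \<in> restrict_space N X \<rightarrow>\<^sub>M borel"
      by (rule measurable_cong[THEN iffD1, rotated]) (unfold sp, auto simp: X eq[OF c])
  qed
qed

end

section \<open>Convergence of the stochastic gradient iteration\<close>

theorem theorem1:
  fixes A :: "('m::{t2_space,second_countable_topology}, 'e::euclidean_space) chart set"
    and g :: "('m, 'e) metric"
    and I :: real
    and P :: "'z measure"
    and Q :: "'z \<Rightarrow> 'm \<Rightarrow> real"
    and C :: "'m \<Rightarrow> real"
    and H :: "'z \<Rightarrow> 'm \<Rightarrow> ('m, 'e) tvec"
    and \<Omega> :: "'w measure"
    and z :: "nat \<Rightarrow> 'w \<Rightarrow> 'z"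
    and \<gamma> :: "nat \<Rightarrow> real"
    and w0 :: 'm
    and w :: "nat \<Rightarrow> 'w \<Rightarrow> 'm"
    and K :: "'m set"
    and B :: real
  assumes atlas: "smooth_atlas A"
    and conn: "connected (UNIV :: 'm set)"
    and metric: "riemannian_metric A g"
    and inj: "I > 0" "\<And>p. injectivity_radius A g p \<ge> ereal I"
    and P: "prob_space P"
    and Q_int: "\<And>p. integrable P (\<lambda>\<zeta>. Q \<zeta> p)"
    and C_def: "\<And>p. C p = (\<integral>\<zeta>. Q \<zeta> p \<partial>P)"
    and C_C3: "Ck_function A 3 C"
    and H_tangent: "\<And>\<zeta> p. \<zeta> \<in> space P \<Longrightarrow> H \<zeta> p \<in> tangent_space A p"
    and H_meas: "\<And>c. c \<in> A \<Longrightarrow>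
      (\<lambda>(\<zeta>, p). H \<zeta> p c) \<in> borel_measurable (P \<Otimes>\<^sub>M restrict_space borel (chart_dom c))"
    and H_int: "\<And>p c. c \<in> A \<Longrightarrow> p \<in> chart_dom c \<Longrightarrow> integrable P (\<lambda>\<zeta>. H \<zeta> p c)"
    and H_grad: "\<And>p c. c \<in> A \<Longrightarrow> p \<in> chart_dom c \<Longrightarrow>
      (\<integral>\<zeta>. H \<zeta> p c \<partial>P) = gradient A g C p c"
    and \<Omega>: "prob_space \<Omega>"
    and z_indep: "prob_space.indep_vars \<Omega> (\<lambda>_. P) z UNIV"
    and z_law: "\<And>t. distr \<Omega> P (z t) = P"
    and \<gamma>_pos: "\<And>t. \<gamma> t > 0"
    and \<gamma>_sq: "summable (\<lambda>t. (\<gamma> t)\<^sup>2)"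
    and \<gamma>_div: "filterlim (\<lambda>n. \<Sum>t<n. \<gamma> t) at_top sequentially"
    and w_0: "\<And>\<omega>. \<omega> \<in> space \<Omega> \<Longrightarrow> w 0 \<omega> = w0"
    and w_Suc: "\<And>t \<omega>. \<omega> \<in> space \<Omega> \<Longrightarrow>
      w (Suc t) \<omega> = exp_map A g (w t \<omega>) (tv_scale (- \<gamma> t) (H (z t \<omega>) (w t \<omega>)))"
    and K: "compact K"
    and w_K: "\<And>t \<omega>. \<omega> \<in> space \<Omega> \<Longrightarrow> w t \<omega> \<in> K"
    and H_bound: "B > 0" "\<And>\<zeta> p. \<zeta> \<in> space P \<Longrightarrow> p \<in> K \<Longrightarrow> tv_norm g p (H \<zeta> p) \<le> B"
  shows "(AE \<omega> in \<Omega>. convergent (\<lambda>t. C (w t \<omega>))) \<and>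
         (AE \<omega> in \<Omega>. (\<lambda>t. tv_norm g (w t \<omega>) (gradient A g C (w t \<omega>))) \<longlonglongrightarrow> 0)"
proof -
  interpret bounded_injectivity A g I
    by (unfold_locales) (use atlas metric inj in auto)
  interpret \<Omega>: prob_space \<Omega> by (rule \<Omega>)
  interpret P: prob_space P by (rule P)
  have C2: "Ck_function A 2 C"
    using C_C3 unfolding Ck_function_def by (auto intro: Ck_on_mono[where k = 3])
  have z: "z i \<in> \<Omega> \<rightarrow>\<^sub>M P" for i using z_indep by (auto simp: \<Omega>.indep_vars_def)
  define F where "F = past \<Omega> P z"
  note spF = space_past[of \<Omega> P z, folded F_def]
  note subF = past_subalgebra[where z = z, OF z, folded F_def]
  note monoF = past_mono[where z = z, OF z, folded F_def]
  define h where "h = grad_sq C"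
  define dC where "dC p v = g p (gradient A g C p) v" for p v

  have H_comp: "(\<lambda>x. H (\<zeta> x) (p x) c) \<in> borel_measurable (restrict_space N (p -` chart_dom c \<inter> space N))"
    if c: "c \<in> A" and \<zeta>: "\<zeta> \<in> N \<rightarrow>\<^sub>M P" and p: "p \<in> N \<rightarrow>\<^sub>M borel" for c \<zeta> p and N :: "'v measure"
  proof -
    let ?R = "restrict_space N (p -` chart_dom c \<inter> space N)"
    have "p \<in> ?R \<rightarrow>\<^sub>M restrict_space borel (chart_dom c)"
      using p by (intro measurable_restrict_space2 measurable_restrict_space1) (auto simp: space_restrict_space)
    then have "(\<lambda>x. (\<zeta> x, p x)) \<in> ?R \<rightarrow>\<^sub>M P \<Otimes>\<^sub>M restrict_space borel (chart_dom c)"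
      by (intro measurable_Pair measurable_restrict_space1[OF \<zeta>])
    from measurable_compose[OF this H_meas[OF c]] show ?thesis by simp
  qed
  have exp_meas: "(\<lambda>x. exp_map A g (p x) (tv_scale s (H (\<zeta> x) (p x)))) \<in> N \<rightarrow>\<^sub>M borel"
    if \<zeta>: "\<zeta> \<in> N \<rightarrow>\<^sub>M P" and p: "p \<in> N \<rightarrow>\<^sub>M borel" for s \<zeta> p and N :: "'v measure"
  proof (rule chartwise_measurable[OF p, where v = "\<lambda>x. tv_scale s (H (\<zeta> x) (p x))"
        and \<Phi> = "\<lambda>c (p, x). exp_map A g p (coord_vec A c p x)"])
    show "(\<lambda>x. tv_scale s (H (\<zeta> x) (p x)) c) \<in> borel_measurable (restrict_space N (p -` chart_dom c \<inter> space N))"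
      if "c \<in> A" for c
      unfolding tv_scale_def using H_comp[OF that \<zeta> p] by (intro borel_measurable_scaleR) auto
    show "exp_map A g (p x) (tv_scale s (H (\<zeta> x) (p x))) =
        (case (p x, tv_scale s (H (\<zeta> x) (p x)) c) of (p, x) \<Rightarrow> exp_map A g p (coord_vec A c p x))"
      if "c \<in> A" "x \<in> space N" "p x \<in> chart_dom c" for c x
      using coord_vec_of[OF that(1,3) tv_scale_tangent[OF H_tangent[OF measurable_space[OF \<zeta> that(2)]]]] by simp
  qed (rule exp_map_continuous)
  \<comment> \<open>The space \<open>N\<close> is arbitrary because this is applied on the
    filtration, on the product of \<open>P\<close> with a past, and on \<open>P\<close>
    alone.\<close>
  have dC_meas: "(\<lambda>x. dC (p x) (H (\<zeta> x) (p x))) \<in> borel_measurable N"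
    if \<zeta>: "\<zeta> \<in> N \<rightarrow>\<^sub>M P" and p: "p \<in> N \<rightarrow>\<^sub>M borel" for \<zeta> p and N :: "'v measure"
  proof (rule chartwise_measurable[OF p H_comp[OF _ \<zeta> p],
        where \<Phi> = "\<lambda>c (p, x). dchart C c (chart_map c p) x"])
    show "dC (p x) (H (\<zeta> x) (p x)) = (case (p x, H (\<zeta> x) (p x) c) of (p, x) \<Rightarrow> dchart C c (chart_map c p) x)"
      if "c \<in> A" "x \<in> space N" "p x \<in> chart_dom c" for c x
      using g_gradient[OF C2 H_tangent[OF measurable_space[OF \<zeta> that(2)]] that(1,3)] by (simp add: dC_def)
  qed (simp_all add: continuous_dchart[OF C2])
  have h_meas [measurable]: "h \<in> borel_measurable borel"
    unfolding h_def by (rule borel_measurable_continuous_onI[OF continuous_grad_sq[OF C2]])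

  have w_meas: "w t \<in> F t \<rightarrow>\<^sub>M borel" for t
  proof (induction t)
    case 0
    have "(\<lambda>_. w0) \<in> F 0 \<rightarrow>\<^sub>M borel" by simp
    then show ?case by (rule measurable_cong[THEN iffD1, rotated]) (simp add: spF w_0)
  next
    case (Suc t)
    have "z t \<in> F (Suc t) \<rightarrow>\<^sub>M P" unfolding F_def by (rule past_measurable) (use z in auto)
    moreover have "w t \<in> F (Suc t) \<rightarrow>\<^sub>M borel"
      using monoF[of t] by (intro measurable_from_subalg[OF _ Suc]) (simp add: subalgebra_def spF)
    ultimately have "(\<lambda>\<omega>. exp_map A g (w t \<omega>) (tv_scale (- \<gamma> t) (H (z t \<omega>) (w t \<omega>)))) \<in> F (Suc t) \<rightarrow>\<^sub>M borel"
      by (rule exp_meas)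
    then show ?case by (rule measurable_cong[THEN iffD1, rotated]) (simp add: spF w_Suc)
  qed

  obtain bC where bC: "\<And>p. p \<in> K \<Longrightarrow> \<bar>C p\<bar> \<le> bC"
    using compact_imp_bounded[OF compact_continuous_image[OF continuous_on_subset[OF continuous_f[OF C2] subset_UNIV] K]]
    by (auto simp: bounded_iff)
  obtain bh where bh: "\<And>p. p \<in> K \<Longrightarrow> \<bar>h p\<bar> \<le> bh"
    using compact_imp_bounded[OF compact_continuous_image[OF continuous_on_subset[OF continuous_grad_sq[OF C2] subset_UNIV] K]]
    by (auto simp: bounded_iff h_def)
  \<comment> \<open>Cauchy-Schwarz bounds the derivative in the sampled direction by the first
    summand, and the squared gradient norm is bounded by the second.\<close>
  define a where "a = sqrt \<bar>bh\<bar> * B + \<bar>bh\<bar>"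
  have a: "a \<ge> 0" using H_bound(1) by (simp add: a_def)
  have noise_le: "\<bar>dC p (H \<zeta> p) - h p\<bar> \<le> a" if "\<zeta> \<in> space P" "p \<in> K" for \<zeta> p
  proof -
    have "\<bar>dC p (H \<zeta> p)\<bar> \<le> tv_norm g p (gradient A g C p) * tv_norm g p (H \<zeta> p)"
      unfolding dC_def by (rule g_cauchy_schwarz[OF gradient_tangent[OF C2] H_tangent[OF that(1)]])
    also have "\<dots> \<le> sqrt \<bar>bh\<bar> * B"
      using bh[OF that(2)] grad_sq_nonneg[OF C2, of p] H_bound(2)[OF that] g_nonneg[OF H_tangent[OF that(1)]]
      unfolding tv_norm_gradient[OF C2] h_def[symmetric] by (intro mult_mono real_sqrt_le_mono) (auto simp: tv_norm_def)
    finally show ?thesis using bh[OF that(2)] by (simp add: a_def)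
  qed
  \<comment> \<open>In a chart, the differential is a fixed linear map and commutes with the
    integral; the mean of \<open>H\<close> is the gradient, at which it takes the value
    \<open>h p\<close>.\<close>
  have dC_mean: "(\<integral>\<zeta>. dC p (H \<zeta> p) \<partial>P) = h p" for p
  proof -
    obtain c where c: "c \<in> A" "p \<in> chart_dom c" by (rule chart_cover)
    have "bounded_linear (dchart C c (chart_map c p))"
      using dchart_linear[OF C2 c(1)] c(2) by (simp add: linear_conv_bounded_linear)
    from integral_bounded_linear[OF this H_int[OF c]]
    have "(\<integral>\<zeta>. dchart C c (chart_map c p) (H \<zeta> p c) \<partial>P) = dchart C c (chart_map c p) (gradient A g C p c)"
      by (simp add: H_grad[OF c])
    also have "\<dots> = h p"
      using g_gradient[OF C2 gradient_tangent[OF C2] c] by (simp add: h_def grad_sq_def[OF C2])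
    also have "(\<integral>\<zeta>. dchart C c (chart_map c p) (H \<zeta> p c) \<partial>P) = (\<integral>\<zeta>. dC p (H \<zeta> p) \<partial>P)"
      by (rule Bochner_Integration.integral_cong) (use g_gradient[OF C2 H_tangent c] in \<open>auto simp: dC_def\<close>)
    finally show ?thesis .
  qed

  \<comment> \<open>As the step is \<open>- \<gamma> t\<close> times the sampled vector, the
    first-order change of \<open>C\<close> equals \<open>- \<gamma> t * h\<close> minus
    \<open>\<xi> t\<close>.\<close>
  define \<xi> where "\<xi> t \<omega> = \<gamma> t * (dC (w t \<omega>) (H (z t \<omega>) (w t \<omega>)) - h (w t \<omega>))" for t \<omega>
  have "AE \<omega> in \<Omega>. summable (\<lambda>t. \<xi> t \<omega>)"
  proof (rule \<Omega>.martingale_differences_summable[where F = F and a = "\<lambda>t. \<gamma> t * a"])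
    show "\<xi> t \<in> borel_measurable (F (Suc t))" for t
    proof -
      have zt: "z t \<in> F (Suc t) \<rightarrow>\<^sub>M P" unfolding F_def by (rule past_measurable) (use z in auto)
      have wt: "w t \<in> F (Suc t) \<rightarrow>\<^sub>M borel"
        using monoF[of t] by (intro measurable_from_subalg[OF _ w_meas]) (simp add: subalgebra_def spF)
      note [measurable] = dC_meas[OF zt wt] wt
      show ?thesis unfolding \<xi>_def by measurable
    qed
    show "\<bar>\<xi> t \<omega>\<bar> \<le> \<gamma> t * a" if "\<omega> \<in> space \<Omega>" for t \<omega>
      using noise_le[OF measurable_space[OF z that] w_K[OF that]] \<gamma>_pos[of t]
      by (simp add: \<xi>_def abs_mult)
    show "summable (\<lambda>t. (\<gamma> t * a)\<^sup>2)"
      unfolding power_mult_distrib by (rule summable_mult2[OF \<gamma>_sq])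
    fix t and Y :: "'w \<Rightarrow> real" assume Y: "Y \<in> borel_measurable (F t)" and "\<exists>b. \<forall>\<omega>\<in>space \<Omega>. \<bar>Y \<omega>\<bar> \<le> b"
    then obtain b where b: "\<And>\<omega>. \<omega> \<in> space \<Omega> \<Longrightarrow> \<bar>Y \<omega>\<bar> \<le> b" by blast
    \<comment> \<open>The sample is separated from the outcome, so that it can be integrated out
      with the past held fixed.\<close>
    define \<phi> where "\<phi> \<zeta> \<omega> = Y \<omega> * (\<gamma> t * (dC (w t \<omega>) (H \<zeta> (w t \<omega>)) - h (w t \<omega>)))" for \<zeta> \<omega>
    have "\<Omega>.expectation (\<lambda>\<omega>. \<phi> (z t \<omega>) \<omega>) = \<Omega>.expectation (\<lambda>\<omega>. \<integral>\<zeta>. \<phi> \<zeta> \<omega> \<partial>P)"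
    proof (rule \<Omega>.expectation_given_past[OF z_indep z_law, folded F_def])
      have "(\<lambda>x. w t (snd x)) \<in> P \<Otimes>\<^sub>M F t \<rightarrow>\<^sub>M borel"
        using w_meas by (rule measurable_compose[OF measurable_snd])
      note [measurable] = dC_meas[OF measurable_fst this] this Y
      have "(\<lambda>x. \<phi> (fst x) (snd x)) \<in> borel_measurable (P \<Otimes>\<^sub>M F t)"
        unfolding \<phi>_def by measurable
      then show "(\<lambda>(\<zeta>, \<omega>). \<phi> \<zeta> \<omega>) \<in> borel_measurable (P \<Otimes>\<^sub>M F t)" by (simp add: case_prod_unfold)
      fix \<zeta> \<omega> assume *: "\<zeta> \<in> space P" "\<omega> \<in> space \<Omega>"
      have "\<bar>\<gamma> t * (dC (w t \<omega>) (H \<zeta> (w t \<omega>)) - h (w t \<omega>))\<bar> \<le> \<gamma> t * a"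
        using noise_le[OF *(1) w_K[OF *(2)]] \<gamma>_pos[of t] by (simp add: abs_mult)
      then show "\<bar>\<phi> \<zeta> \<omega>\<bar> \<le> b * (\<gamma> t * a)"
        unfolding \<phi>_def abs_mult[of "Y \<omega>"] using b[OF *(2)] by (intro mult_mono) auto
    qed
    \<comment> \<open>With the past fixed, the position \<open>w t \<omega>\<close> is constant in
      the sample, and \<open>dC_mean\<close> centres the difference.\<close>
    also have "\<dots> = \<Omega>.expectation (\<lambda>\<omega>. 0)"
    proof (rule Bochner_Integration.integral_cong)
      fix \<omega> assume \<omega>: "\<omega> \<in> space \<Omega>"
      have "(\<lambda>\<zeta>. dC (w t \<omega>) (H \<zeta> (w t \<omega>))) \<in> borel_measurable P"
        by (rule dC_meas) auto
      moreover have "\<bar>dC (w t \<omega>) (H \<zeta> (w t \<omega>))\<bar> \<le> a + \<bar>h (w t \<omega>)\<bar>" if "\<zeta> \<in> space P" for \<zeta>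
        using noise_le[OF that w_K[OF \<omega>, of t]] by linarith
      ultimately have "integrable P (\<lambda>\<zeta>. dC (w t \<omega>) (H \<zeta> (w t \<omega>)))"
        by (intro P.integrable_const_bound[where B = "a + \<bar>h (w t \<omega>)\<bar>"]) auto
      then show "(\<integral>\<zeta>. \<phi> \<zeta> \<omega> \<partial>P) = 0"
        unfolding \<phi>_def by (simp add: dC_mean P.prob_space)
    qed simp
    finally show "\<Omega>.expectation (\<lambda>\<omega>. Y \<omega> * \<xi> t \<omega>) = 0" by (simp add: \<phi>_def \<xi>_def)
  qed (use subF monoF in auto)
  moreover have "convergent (\<lambda>t. C (w t \<omega>)) \<and> (\<lambda>t. h (w t \<omega>)) \<longlonglongrightarrow> 0"
    if \<omega>: "\<omega> \<in> space \<Omega>" and noise: "summable (\<lambda>t. \<xi> t \<omega>)" for \<omega>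
  proof -
    obtain \<delta> k where \<delta>: "\<delta> > 0" "k \<ge> 0"
      "\<And>p v. p \<in> K \<Longrightarrow> v \<in> tangent_space A p \<Longrightarrow> tv_norm g p v < \<delta> \<Longrightarrow>
        \<bar>C (exp_map A g p v) - C p - g p (gradient A g C p) v\<bar> \<le> k * (tv_norm g p v)\<^sup>2"
      "\<And>p v. p \<in> K \<Longrightarrow> v \<in> tangent_space A p \<Longrightarrow> tv_norm g p v < \<delta> \<Longrightarrow>
        \<bar>grad_sq C (exp_map A g p v) - grad_sq C p\<bar> \<le> k * tv_norm g p v"
      using uniform_step_estimate[OF C2 K] by metis
    have \<gamma>_lim: "\<gamma> \<longlonglongrightarrow> 0"
      using summable_LIMSEQ_zero[OF \<gamma>_sq] by (simp add: power_tendsto_0_iff)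
    \<comment> \<open>From then on every step is shorter than \<open>\<delta>\<close>, which puts it
      in the range of the uniform estimates; accordingly \<open>descent_converges\<close> asks for
      its inequalities only eventually.\<close>
    then have small: "\<forall>\<^sub>F t in sequentially. \<gamma> t < \<delta> / B"
      using \<delta>(1) H_bound(1) by (intro order_tendstoD(2)) auto
    define v where "v t = tv_scale (- \<gamma> t) (H (z t \<omega>) (w t \<omega>))" for t
    have Ht: "H (z t \<omega>) (w t \<omega>) \<in> tangent_space A (w t \<omega>)" for t
      using H_tangent measurable_space[OF z \<omega>] by blast
    have vt: "v t \<in> tangent_space A (w t \<omega>)" for t unfolding v_def by (rule tv_scale_tangent[OF Ht])
    have v_le: "tv_norm g (w t \<omega>) (v t) \<le> \<gamma> t * B" for t
      unfolding v_def tv_norm_scale[OF Ht]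
      using H_bound(2)[OF measurable_space[OF z \<omega>] w_K[OF \<omega>]] \<gamma>_pos[of t] by simp
    have v_nonneg: "tv_norm g (w t \<omega>) (v t) \<ge> 0" for t
      using g_nonneg[OF vt] by (simp add: tv_norm_def)
    have gv: "g (w t \<omega>) (gradient A g C (w t \<omega>)) (v t) = - \<gamma> t * dC (w t \<omega>) (H (z t \<omega>) (w t \<omega>))" for t
      unfolding v_def dC_def
      using g_sym[OF gradient_tangent[OF C2] vt[of t]] g_sym[OF gradient_tangent[OF C2] Ht[of t]]
        g_scale[OF Ht gradient_tangent[OF C2], of t "- \<gamma> t"] by (simp add: v_def)
    show ?thesis
    proof (rule descent_converges[OF \<gamma>_pos \<gamma>_div \<gamma>_lim _ _ noise])
      show "0 \<le> h (w t \<omega>)" for t unfolding h_def by (rule grad_sq_nonneg[OF C2])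
      show "\<bar>C (w t \<omega>)\<bar> \<le> bC" for t by (rule bC[OF w_K[OF \<omega>]])
      \<comment> \<open>The error of one step is the Taylor remainder, with the length of the step
        bounded by \<open>\<gamma> t * B\<close>.\<close>
      show "summable (\<lambda>t. k * B\<^sup>2 * (\<gamma> t)\<^sup>2)" by (rule summable_mult[OF \<gamma>_sq])
      show "\<forall>\<^sub>F t in sequentially. \<bar>C (w (Suc t) \<omega>) - C (w t \<omega>) + \<gamma> t * h (w t \<omega>) + \<xi> t \<omega>\<bar> \<le> k * B\<^sup>2 * (\<gamma> t)\<^sup>2"
        using small
      proof eventually_elim
        case (elim t)
        then have "tv_norm g (w t \<omega>) (v t) < \<delta>"
          using v_le[of t] H_bound(1) by (simp add: field_simps)
        from \<delta>(3)[OF w_K[OF \<omega>] vt this]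
        have "\<bar>C (w (Suc t) \<omega>) - C (w t \<omega>) + \<gamma> t * h (w t \<omega>) + \<xi> t \<omega>\<bar> \<le> k * (tv_norm g (w t \<omega>) (v t))\<^sup>2"
          unfolding gv w_Suc[OF \<omega>] v_def[symmetric] \<xi>_def by (simp add: algebra_simps)
        also have "\<dots> \<le> k * (\<gamma> t * B)\<^sup>2"
          using v_le[of t] v_nonneg[of t] \<delta>(2) by (intro mult_left_mono power_mono) auto
        finally show ?case by (simp add: power_mult_distrib mult_ac)
      qed
      show "\<forall>\<^sub>F t in sequentially. \<bar>h (w (Suc t) \<omega>) - h (w t \<omega>)\<bar> \<le> k * B * \<gamma> t"
        using small
      proof eventually_elim
        case (elim t)
        then have "tv_norm g (w t \<omega>) (v t) < \<delta>"
          using v_le[of t] H_bound(1) by (simp add: field_simps)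
        from \<delta>(4)[OF w_K[OF \<omega>] vt this]
        have "\<bar>h (w (Suc t) \<omega>) - h (w t \<omega>)\<bar> \<le> k * tv_norm g (w t \<omega>) (v t)"
          unfolding w_Suc[OF \<omega>] v_def[symmetric] h_def .
        also have "\<dots> \<le> k * (\<gamma> t * B)" using v_le[of t] \<delta>(2) by (intro mult_left_mono) auto
        finally show ?case by (simp add: mult_ac)
      qed
    qed
  qed
  ultimately have main: "AE \<omega> in \<Omega>. convergent (\<lambda>t. C (w t \<omega>)) \<and> (\<lambda>t. h (w t \<omega>)) \<longlonglongrightarrow> 0"
    by (elim AE_mp) (auto intro!: AE_I2)
  show ?thesis
  proof
    show "AE \<omega> in \<Omega>. convergent (\<lambda>t. C (w t \<omega>))" using main by eventually_elim simp
    show "AE \<omega> in \<Omega>. (\<lambda>t. tv_norm g (w t \<omega>) (gradient A g C (w t \<omega>))) \<longlonglongrightarrow> 0"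
      using main
    proof eventually_elim
      case (elim \<omega>)
      then have "(\<lambda>t. sqrt (h (w t \<omega>))) \<longlonglongrightarrow> sqrt 0" by (intro tendsto_real_sqrt) simp
      then show ?case by (simp add: tv_norm_gradient[OF C2] h_def)
    qed
  qed
qed

end
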